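(* Let $(M,\varphi,\xi,\eta,g)$ be a 3-dimensional Sasaki-like almost contact B-metric manifold and $C(t)$ a non-geodesic slant null curve in $M$, with $a=\eta(\dot C)$ (constant) and $b=g(\dot C,\varphi\dot C)$. Let $\epsilon,\epsilon_1\in\{1,-1\}$ and let $W$, $\overline W$ be the unit spacelike vector fields along $C$ orthogonal to $\dot C$ given by $$W=\frac{-\epsilon b}{\sqrt{a^4+b^2}}\xi+\frac{\epsilon a}{\sqrt{a^4+b^2}}\varphi\dot C,$$ $$\overline W=\epsilon_1\left(\frac{-\epsilon b}{\sqrt{a^4+b^2}}\xi+\frac{\epsilon b\dot b}{\sqrt{a^4+b^2}\,(-2(a^4+b^2)+a\dot b)}\dot C+\frac{\epsilon a}{\sqrt{a^4+b^2}}\varphi\dot C\right).$$ (i) If the screen vector bundle of $C(t)$ is $S(TC^\perp)=\mathrm{span}\{W\}$, then in the Frenet frame $\{\dot C,N,W\}$ $$N=\frac{a^3}{a^4+b^2}\xi-\frac{a^2}{2(a^4+b^2)}\dot C+\frac{b}{a^4+b^2}\varphi\dot C,\qquad h=\frac{b\dot b}{2(a^4+b^2)},$$ $$k_2=\epsilon\,\frac{-2a^2(a^4+b^2)+3a^3\dot b}{4(a^4+b^2)^{3/2}}.$$ (ii) If the screen vector bundle of $C(t)$ is $\bar S(TC^\perp)=\mathrm{span}\{\overline W\}$, then the original parameter $t$ of $C(t)$ is distinguished, and in the Frenet frame $\{\dot C,\overline N,\overline W\}$ $$\overline N=\frac{\dot b-2a^3}{-2(a^4+b^2)+a\dot b}\,\xi-\frac{4a^2(a^4+b^2-a\dot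 b)+\dot b^2}{2(-2(a^4+b^2)+a\dot b)^2}\,\dot C-\frac{2b}{-2(a^4+b^2)+a\dot b}\,\varphi\dot C,$$ $$\bar k_2=\epsilon_1\epsilon\,\frac{(a^4+b^2)(8b\ddot b+20a^3\dot b-8a^6-8a^2b^2)-a\dot b^3-2(3a^4+7b^2)\dot b^2}{4\sqrt{a^4+b^2}\,(-2(a^4+b^2)+a\dot b)^2}.$$
   Context: A 3-dimensional almost contact B-metric manifold $(M,\varphi,\xi,\eta,g)$ is a smooth 3-manifold with an endomorphism $\varphi$ of $TM$, a vector field $\xi$, a 1-form $\eta$ and a pseudo-Riemannian metric $g$ (necessarily of signature $(+,+,-)$) such that $\varphi^2X=-X+\eta(X)\xi$, $\eta(\xi)=1$, $g(\varphi X,\varphi Y)=-g(X,Y)+\eta(X)\eta(Y)$. Consequences: $\eta\circ\varphi=0$, $\varphi\xi=0$, $\eta(X)=g(X,\xi)$. With $\nabla$ the Levi-Civita connection of $g$, it is Sasaki-like if $(\nabla_X\varphi)Y=-g(X,Y)\xi-\eta(Y)X+2\eta(X)\eta(Y)\xi$ (then $\nabla_X\xi=-\varphi X$). A smooth curve $C:I\to M$ ($I$ an interval) is null if $g(\dot C,\dot C)=0$ and $\dot C\neq 0$ on $I$; it is slant if $\eta(\dot C)=a$ is constant. Dots on $b$ denote derivatives in $t$. For a slant null curve $a^4+b^2\neq 0$ everywhere. A general Frenet frame along a null curve $C$ is $\{\dot C,N,W\}$ with $g(\dot C,N)=g(W,W)=1$, $g(N,N)=g(N,W)=g(\dot C,W)=0$;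 for given $W$ (spanning the screen vector bundle) the field $N$ is unique. The Frenet equations are $\nabla_{\dot C}\dot C=h\dot C+k_1W$, $\nabla_{\dot C}N=-hN+k_2W$, $\nabla_{\dot C}W=-k_2\dot C-k_1N$, defining the functions $h,k_1,k_2$ for this frame; for the frame $\{\dot C,\overline N,\overline W\}$ they are written $\bar h,\bar k_1,\bar k_2$. The parameter $t$ is distinguished (for a given frame) if the corresponding $h$ vanishes. "Non-geodesic" means that $k_1\neq0$ at every point, equivalently $-2(a^4+b^2)+a\dot b\ne 0$. *)

theory Defs
  imports "HOL-Analysis.Analysis" "HOL-Library.Function_Algebras"
begin

section \<open>Pointwise scalar multiplication of functions\<close>

text \<open>Tangent vectors are represented below by functions from charts to coordinate vectors, and the
  linear structure of a tangent space is the pointwise one.\<close>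

instantiation "fun" :: (type, real_vector) real_vector
begin

definition scaleR_fun :: "real \<Rightarrow> ('a \<Rightarrow> 'b) \<Rightarrow> 'a \<Rightarrow> 'b"
  where "scaleR_fun r f = (\<lambda>x. r *\<^sub>R f x)"

instance
  by standard (simp_all add: scaleR_fun_def fun_eq_iff scaleR_add_right scaleR_add_left)

end

section \<open>Smooth maps between Euclidean spaces\<close>

text \<open>Derivatives are taken within the domain \<open>S\<close>. In the sequel \<open>S\<close> is either an open set or a
  relatively open subset of a nondegenerate real interval, where such derivatives are unique.\<close>

primrec k_smooth_on ::
    "nat \<Rightarrow> 'x::euclidean_space set \<Rightarrow> ('x \<Rightarrow> 'y::real_normed_vector) \<Rightarrow> bool" where
  "k_smooth_on 0 S f \<longleftrightarrow> continuous_on S f"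
| "k_smooth_on (Suc k) S f \<longleftrightarrow> f differentiable_on S \<and>
     (\<forall>v. k_smooth_on k S (\<lambda>x. frechet_derivative f (at x within S) v))"

definition smooth_on :: "'x::euclidean_space set \<Rightarrow> ('x \<Rightarrow> 'y::real_normed_vector) \<Rightarrow> bool"
  where "smooth_on S f \<longleftrightarrow> (\<forall>k. k_smooth_on k S f)"

section \<open>Smooth 3-manifolds and their tangent spaces\<close>

text \<open>The points of the manifold are all the elements of a Hausdorff, second countable type. A chart
  is an open set together with a coordinate map on it.\<close>

type_synonym 'a chart = "'a set \<times> ('a \<Rightarrow> real^3)"

abbreviation chart_dom :: "'a chart \<Rightarrow> 'a set"
  where "chart_dom \<equiv> fst"

abbreviation coords :: "'a chart \<Rightarrow> 'a \<Rightarrow> real^3"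
  where "coords \<equiv> snd"

definition chart_inv :: "'a chart \<Rightarrow> real^3 \<Rightarrow> 'a"
  where "chart_inv c = inv_into (chart_dom c) (coords c)"

definition smooth_atlas :: "'a::{t2_space,second_countable_topology} chart set \<Rightarrow> bool"
  where "smooth_atlas A \<longleftrightarrow>
    (\<Union>c\<in>A. chart_dom c) = UNIV \<and>
    (\<forall>c\<in>A. open (chart_dom c) \<and> open (coords c ` chart_dom c) \<and>
       homeomorphism (chart_dom c) (coords c ` chart_dom c) (coords c) (chart_inv c)) \<and>
    (\<forall>c\<in>A. \<forall>d\<in>A. smooth_on (coords c ` (chart_dom c \<inter> chart_dom d)) (coords d \<circ> chart_inv c))"

definition jacobian :: "'a chart \<Rightarrow> 'a chart \<Rightarrow> 'a \<Rightarrow> real^3 \<Rightarrow> real^3"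
  where "jacobian c d p = frechet_derivative (coords d \<circ> chart_inv c) (at (coords c p))"

text \<open>A tangent vector at \<open>p\<close> is the family of its coordinate vectors in the charts around \<open>p\<close>, which are
  related by the differentials of the transition maps. For the remaining charts the value is \<open>0\<close>,
  so that a tangent vector is determined by any one of its coordinate vectors.\<close>

type_synonym 'a tvec = "'a chart \<Rightarrow> real^3"

definition tangent_space :: "'a chart set \<Rightarrow> 'a \<Rightarrow> 'a tvec set"
  where "tangent_space A p = {v.
    (\<forall>c\<in>A. \<forall>d\<in>A. p \<in> chart_dom c \<inter> chart_dom d \<longrightarrow> v d = jacobian c d p (v c)) \<and>
    (\<forall>c. \<not> (c \<in> A \<and> p \<in> chart_dom c) \<longrightarrow> v c = 0)}"

text \<open>Functions and vector fields are total; smoothness on an open set \<open>U\<close> only concerns their values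
  on \<open>U\<close>.\<close>

definition smooth_function :: "'a chart set \<Rightarrow> 'a set \<Rightarrow> ('a \<Rightarrow> real) \<Rightarrow> bool"
  where "smooth_function A U f \<longleftrightarrow>
    (\<forall>p\<in>U. \<exists>c\<in>A. p \<in> chart_dom c \<and>
       smooth_on (coords c ` (chart_dom c \<inter> U)) (\<lambda>x. f (chart_inv c x)))"

definition smooth_vector_field :: "'a chart set \<Rightarrow> 'a set \<Rightarrow> ('a \<Rightarrow> 'a tvec) \<Rightarrow> bool"
  where "smooth_vector_field A U X \<longleftrightarrow>
    (\<forall>p\<in>U. X p \<in> tangent_space A p) \<and>
    (\<forall>p\<in>U. \<exists>c\<in>A. p \<in> chart_dom c \<and>
       smooth_on (coords c ` (chart_dom c \<inter> U)) (\<lambda>x. X (chart_inv c x) c))"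

text \<open>The derivative \<open>v(f)\<close> of a function in the direction of \<open>v\<close>, a tangent vector at \<open>p\<close>; by the chain
  rule it does not depend on the chart.\<close>

definition dir_deriv :: "'a chart set \<Rightarrow> 'a \<Rightarrow> 'a tvec \<Rightarrow> ('a \<Rightarrow> real) \<Rightarrow> real"
  where "dir_deriv A p v f =
    (let c = (SOME c. c \<in> A \<and> p \<in> chart_dom c)
     in frechet_derivative (\<lambda>x. f (chart_inv c x)) (at (coords c p)) (v c))"

definition lie_bracket :: "'a chart set \<Rightarrow> ('a \<Rightarrow> 'a tvec) \<Rightarrow> ('a \<Rightarrow> 'a tvec) \<Rightarrow> 'a \<Rightarrow> 'a tvec"
  where "lie_bracket A X Y p = (\<lambda>c. if c \<in> A \<and> p \<in> chart_dom c
     then frechet_derivative (\<lambda>x. Y (chart_inv c x) c) (at (coords c p)) (X p c)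
        - frechet_derivative (\<lambda>x. X (chart_inv c x) c) (at (coords c p)) (Y p c)
     else 0)"

definition coord_field :: "'a chart set \<Rightarrow> 'a chart \<Rightarrow> 3 \<Rightarrow> 'a \<Rightarrow> 'a tvec"
  where "coord_field A c i p = (\<lambda>d. if d \<in> A \<and> p \<in> chart_dom c \<inter> chart_dom d
     then jacobian c d p (axis i 1) else 0)"

section \<open>Pseudo-Riemannian metrics and the Levi-Civita connection\<close>

definition pseudo_riemannian_metric ::
    "'a::topological_space chart set \<Rightarrow> ('a \<Rightarrow> 'a tvec \<Rightarrow> 'a tvec \<Rightarrow> real) \<Rightarrow> bool"
  where "pseudo_riemannian_metric A g \<longleftrightarrow>
    (\<forall>p. \<forall>u\<in>tangent_space A p. \<forall>v\<in>tangent_space A p. g p u v = g p v u) \<and>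
    (\<forall>p. \<forall>u\<in>tangent_space A p. \<forall>v\<in>tangent_space A p. \<forall>w\<in>tangent_space A p. \<forall>r.
       g p (u + v) w = g p u w + g p v w \<and> g p (r *\<^sub>R u) w = r * g p u w) \<and>
    (\<forall>p. \<forall>u\<in>tangent_space A p. (\<forall>v\<in>tangent_space A p. g p u v = 0) \<longrightarrow> u = 0) \<and>
    (\<forall>U X Y. open U \<and> smooth_vector_field A U X \<and> smooth_vector_field A U Y \<longrightarrow>
       smooth_function A U (\<lambda>p. g p (X p) (Y p)))"

text \<open>\<open>nabla p v Y\<close> is the covariant derivative at \<open>p\<close>, in the direction of \<open>v\<close> tangent at \<open>p\<close>, of a vector
  field \<open>Y\<close> that is defined and smooth near \<open>p\<close>. It depends only on the germ of \<open>Y\<close> at \<open>p\<close>.\<close>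

type_synonym 'a connection = "'a \<Rightarrow> 'a tvec \<Rightarrow> ('a \<Rightarrow> 'a tvec) \<Rightarrow> 'a tvec"

definition affine_connection :: "'a::topological_space chart set \<Rightarrow> 'a connection \<Rightarrow> bool"
  where "affine_connection A nabla \<longleftrightarrow>
    (\<forall>U p Y. open U \<and> p \<in> U \<and> smooth_vector_field A U Y \<longrightarrow>
       (\<forall>v\<in>tangent_space A p. nabla p v Y \<in> tangent_space A p) \<and>
       (\<forall>u\<in>tangent_space A p. \<forall>v\<in>tangent_space A p. \<forall>r s.
          nabla p (r *\<^sub>R u + s *\<^sub>R v) Y = r *\<^sub>R nabla p u Y + s *\<^sub>R nabla p v Y) \<and>
       (\<forall>v\<in>tangent_space A p. \<forall>Z. smooth_vector_field A U Z \<longrightarrow>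
          nabla p v (\<lambda>q. Y q + Z q) = nabla p v Y + nabla p v Z) \<and>
       (\<forall>v\<in>tangent_space A p. \<forall>f. smooth_function A U f \<longrightarrow>
          nabla p v (\<lambda>q. f q *\<^sub>R Y q) = dir_deriv A p v f *\<^sub>R Y p + f p *\<^sub>R nabla p v Y) \<and>
       (\<forall>v\<in>tangent_space A p. \<forall>Z. (\<forall>q\<in>U. Z q = Y q) \<longrightarrow> nabla p v Z = nabla p v Y)) \<and>
    (\<forall>U X Y. open U \<and> smooth_vector_field A U X \<and> smooth_vector_field A U Y \<longrightarrow>
       smooth_vector_field A U (\<lambda>p. nabla p (X p) Y))"

definition levi_civita ::
    "'a::topological_space chart set \<Rightarrow> ('a \<Rightarrow> 'a tvec \<Rightarrow> 'a tvec \<Rightarrow> real) \<Rightarrow> 'a connection \<Rightarrow> bool"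
  where "levi_civita A g nabla \<longleftrightarrow>
    affine_connection A nabla \<and>
    (\<forall>U p X Y. open U \<and> p \<in> U \<and> smooth_vector_field A U X \<and> smooth_vector_field A U Y \<longrightarrow>
       nabla p (X p) Y - nabla p (Y p) X = lie_bracket A X Y p) \<and>
    (\<forall>U p X Y. open U \<and> p \<in> U \<and> smooth_vector_field A U X \<and> smooth_vector_field A U Y \<longrightarrow>
       (\<forall>v\<in>tangent_space A p. dir_deriv A p v (\<lambda>q. g q (X q) (Y q)) =
          g p (nabla p v X) (Y p) + g p (X p) (nabla p v Y)))"

section \<open>Sasaki-like almost contact B-metric manifolds\<close>

definition smooth_one_form :: "'a::topological_space chart set \<Rightarrow> ('a \<Rightarrow> 'a tvec \<Rightarrow> real) \<Rightarrow> bool"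
  where "smooth_one_form A \<eta> \<longleftrightarrow>
    (\<forall>p. \<forall>u\<in>tangent_space A p. \<forall>v\<in>tangent_space A p. \<forall>r.
       \<eta> p (u + v) = \<eta> p u + \<eta> p v \<and> \<eta> p (r *\<^sub>R u) = r * \<eta> p u) \<and>
    (\<forall>U X. open U \<and> smooth_vector_field A U X \<longrightarrow> smooth_function A U (\<lambda>p. \<eta> p (X p)))"

definition smooth_endomorphism ::
    "'a::topological_space chart set \<Rightarrow> ('a \<Rightarrow> 'a tvec \<Rightarrow> 'a tvec) \<Rightarrow> bool"
  where "smooth_endomorphism A \<phi> \<longleftrightarrow>
    (\<forall>p. \<forall>u\<in>tangent_space A p. \<forall>v\<in>tangent_space A p. \<forall>r.
       \<phi> p u \<in> tangent_space A p \<and>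
       \<phi> p (u + v) = \<phi> p u + \<phi> p v \<and> \<phi> p (r *\<^sub>R u) = r *\<^sub>R \<phi> p u) \<and>
    (\<forall>U X. open U \<and> smooth_vector_field A U X \<longrightarrow> smooth_vector_field A U (\<lambda>p. \<phi> p (X p)))"

definition almost_contact_B_metric_manifold ::
    "'a::{t2_space,second_countable_topology} chart set \<Rightarrow> ('a \<Rightarrow> 'a tvec \<Rightarrow> 'a tvec) \<Rightarrow>
     ('a \<Rightarrow> 'a tvec) \<Rightarrow> ('a \<Rightarrow> 'a tvec \<Rightarrow> real) \<Rightarrow> ('a \<Rightarrow> 'a tvec \<Rightarrow> 'a tvec \<Rightarrow> real) \<Rightarrow> bool"
  where "almost_contact_B_metric_manifold A \<phi> \<xi> \<eta> g \<longleftrightarrow>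
    smooth_atlas A \<and> smooth_endomorphism A \<phi> \<and> smooth_vector_field A UNIV \<xi> \<and>
    smooth_one_form A \<eta> \<and> pseudo_riemannian_metric A g \<and>
    (\<forall>p. \<forall>u\<in>tangent_space A p. \<phi> p (\<phi> p u) = - u + \<eta> p u *\<^sub>R \<xi> p) \<and>
    (\<forall>p. \<eta> p (\<xi> p) = 1) \<and>
    (\<forall>p. \<forall>u\<in>tangent_space A p. \<forall>v\<in>tangent_space A p.
       g p (\<phi> p u) (\<phi> p v) = - g p u v + \<eta> p u * \<eta> p v)"

definition sasaki_like ::
    "'a::topological_space chart set \<Rightarrow> ('a \<Rightarrow> 'a tvec \<Rightarrow> 'a tvec) \<Rightarrow> ('a \<Rightarrow> 'a tvec) \<Rightarrow>
     ('a \<Rightarrow> 'a tvec \<Rightarrow> real) \<Rightarrow> ('a \<Rightarrow> 'a tvec \<Rightarrow> 'a tvec \<Rightarrow> real) \<Rightarrow> 'a connection \<Rightarrow> bool"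
  where "sasaki_like A \<phi> \<xi> \<eta> g nabla \<longleftrightarrow>
    (\<forall>U p Y. open U \<and> p \<in> U \<and> smooth_vector_field A U Y \<longrightarrow>
       (\<forall>v\<in>tangent_space A p.
          nabla p v (\<lambda>q. \<phi> q (Y q)) - \<phi> p (nabla p v Y) =
            - g p v (Y p) *\<^sub>R \<xi> p - \<eta> p (Y p) *\<^sub>R v + (2 * \<eta> p v * \<eta> p (Y p)) *\<^sub>R \<xi> p))"

section \<open>Null curves and general Frenet frames\<close>

text \<open>The derivative is one-sided at endpoints that belong to the interval \<open>I\<close>.\<close>

definition param_deriv :: "real set \<Rightarrow> (real \<Rightarrow> 'y::real_normed_vector) \<Rightarrow> real \<Rightarrow> 'y"
  where "param_deriv I f t = vector_derivative f (at t within I)"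

definition smooth_curve :: "'a::topological_space chart set \<Rightarrow> real set \<Rightarrow> (real \<Rightarrow> 'a) \<Rightarrow> bool"
  where "smooth_curve A I C \<longleftrightarrow>
    is_interval I \<and> interior I \<noteq> {} \<and> continuous_on I C \<and>
    (\<forall>c\<in>A. smooth_on {t\<in>I. C t \<in> chart_dom c} (\<lambda>t. coords c (C t)))"

definition velocity :: "'a chart set \<Rightarrow> real set \<Rightarrow> (real \<Rightarrow> 'a) \<Rightarrow> real \<Rightarrow> 'a tvec"
  where "velocity A I C t = (\<lambda>c. if c \<in> A \<and> C t \<in> chart_dom c
     then param_deriv I (\<lambda>s. coords c (C s)) t else 0)"

definition smooth_field_along ::
    "'a chart set \<Rightarrow> real set \<Rightarrow> (real \<Rightarrow> 'a) \<Rightarrow> (real \<Rightarrow> 'a tvec) \<Rightarrow> bool"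
  where "smooth_field_along A I C V \<longleftrightarrow>
    (\<forall>t\<in>I. V t \<in> tangent_space A (C t)) \<and>
    (\<forall>c\<in>A. smooth_on {t\<in>I. C t \<in> chart_dom c} (\<lambda>t. V t c))"

text \<open>Covariant derivative along \<open>C\<close>: if \<open>V\<close> has the components \<open>V\<^sup>i\<close> with respect to the coordinate
  fields \<open>E\<^sub>i\<close> of a chart, its derivative is the sum over \<open>i\<close> of \<open>(V\<^sup>i)' E\<^sub>i\<close> and \<open>V\<^sup>i\<close> times the covariant
  derivative of \<open>E\<^sub>i\<close> in the direction of the velocity.\<close>

definition cov_deriv_along ::
    "'a chart set \<Rightarrow> 'a connection \<Rightarrow> real set \<Rightarrow> (real \<Rightarrow> 'a) \<Rightarrow> (real \<Rightarrow> 'a tvec) \<Rightarrow> real \<Rightarrow> 'a tvec"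
  where "cov_deriv_along A nabla I C V t = (\<lambda>c. if c \<in> A \<and> C t \<in> chart_dom c
     then param_deriv I (\<lambda>s. V s c) t +
       (\<Sum>i\<in>UNIV. (V t c $ i) *\<^sub>R nabla (C t) (velocity A I C t) (coord_field A c i) c)
     else 0)"

definition null_curve ::
    "'a::topological_space chart set \<Rightarrow> ('a \<Rightarrow> 'a tvec \<Rightarrow> 'a tvec \<Rightarrow> real) \<Rightarrow> real set \<Rightarrow>
     (real \<Rightarrow> 'a) \<Rightarrow> bool"
  where "null_curve A g I C \<longleftrightarrow> smooth_curve A I C \<and>
    (\<forall>t\<in>I. g (C t) (velocity A I C t) (velocity A I C t) = 0 \<and> velocity A I C t \<noteq> 0)"

definition slant ::
    "'a chart set \<Rightarrow> ('a \<Rightarrow> 'a tvec \<Rightarrow> real) \<Rightarrow> real set \<Rightarrow> (real \<Rightarrow> 'a) \<Rightarrow> real \<Rightarrow> bool"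
  where "slant A \<eta> I C a \<longleftrightarrow> (\<forall>t\<in>I. \<eta> (C t) (velocity A I C t) = a)"

text \<open>A screen vector bundle is a complement of the tangent line of a null curve in its
  orthogonal bundle.\<close>

definition screen_bundle ::
    "'a chart set \<Rightarrow> ('a \<Rightarrow> 'a tvec \<Rightarrow> 'a tvec \<Rightarrow> real) \<Rightarrow> real set \<Rightarrow> (real \<Rightarrow> 'a) \<Rightarrow>
     (real \<Rightarrow> 'a tvec set) \<Rightarrow> bool"
  where "screen_bundle A g I C S \<longleftrightarrow>
    (\<forall>t\<in>I. subspace (S t) \<and> S t \<inter> span {velocity A I C t} = {0} \<and>
       {v + w | v w. v \<in> span {velocity A I C t} \<and> w \<in> S t} =
       {u \<in> tangent_space A (C t). g (C t) u (velocity A I C t) = 0})"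

definition frenet_frame ::
    "'a chart set \<Rightarrow> ('a \<Rightarrow> 'a tvec \<Rightarrow> 'a tvec \<Rightarrow> real) \<Rightarrow> real set \<Rightarrow> (real \<Rightarrow> 'a) \<Rightarrow>
     (real \<Rightarrow> 'a tvec) \<Rightarrow> (real \<Rightarrow> 'a tvec) \<Rightarrow> bool"
  where "frenet_frame A g I C N W \<longleftrightarrow>
    smooth_field_along A I C N \<and> smooth_field_along A I C W \<and>
    (\<forall>t\<in>I. g (C t) (velocity A I C t) (N t) = 1 \<and> g (C t) (W t) (W t) = 1 \<and>
       g (C t) (N t) (N t) = 0 \<and> g (C t) (N t) (W t) = 0 \<and>
       g (C t) (velocity A I C t) (W t) = 0)"

definition frenet_equations ::
    "'a chart set \<Rightarrow> 'a connection \<Rightarrow> real set \<Rightarrow> (real \<Rightarrow> 'a) \<Rightarrow> (real \<Rightarrow> 'a tvec) \<Rightarrow>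
     (real \<Rightarrow> 'a tvec) \<Rightarrow> (real \<Rightarrow> real) \<Rightarrow> (real \<Rightarrow> real) \<Rightarrow> (real \<Rightarrow> real) \<Rightarrow> bool"
  where "frenet_equations A nabla I C N W h k1 k2 \<longleftrightarrow>
    (\<forall>t\<in>I.
       cov_deriv_along A nabla I C (velocity A I C) t = h t *\<^sub>R velocity A I C t + k1 t *\<^sub>R W t \<and>
       cov_deriv_along A nabla I C N t = - h t *\<^sub>R N t + k2 t *\<^sub>R W t \<and>
       cov_deriv_along A nabla I C W t = - k2 t *\<^sub>R velocity A I C t - k1 t *\<^sub>R N t)"

text \<open>The vanishing of \<open>k1\<close> at a point does not depend on the choice of the general Frenet frame.\<close>

definition non_geodesic ::
    "'a chart set \<Rightarrow> ('a \<Rightarrow> 'a tvec \<Rightarrow> 'a tvec \<Rightarrow> real) \<Rightarrow> 'a connection \<Rightarrow> real set \<Rightarrow>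
     (real \<Rightarrow> 'a) \<Rightarrow> bool"
  where "non_geodesic A g nabla I C \<longleftrightarrow>
    (\<exists>N W h k1 k2. frenet_frame A g I C N W \<and> frenet_equations A nabla I C N W h k1 k2 \<and>
       (\<forall>t\<in>I. k1 t \<noteq> 0))"

definition distinguished_parameter :: "real set \<Rightarrow> (real \<Rightarrow> real) \<Rightarrow> bool"
  where "distinguished_parameter I h \<longleftrightarrow> (\<forall>t\<in>I. h t = 0)"

end

theory Submission
  imports Defs
begin

text \<open>Write \<open>C'\<close> for the velocity, \<open>D\<close> for the covariant derivative along the curve and \<open>F = \<phi> C'\<close>. The
Gram matrix of \<open>\<xi>\<close>, \<open>C'\<close>, \<open>F\<close> depends only on \<open>a\<close> and \<open>b\<close> and has determinant \<open>-q\<close> with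
\<open>q = a^4 + b^2\<close>. These vectors form a basis, since \<open>q\<close> is positive: otherwise the velocity would be
orthogonal to the whole tangent space (lemma \<open>q_pos\<close>). The structure equations turn the Sasaki-like
condition into the rules \<open>D \<xi> = - F\<close> and \<open>D F = \<phi> (D C') - a C' + 2 a^2 \<xi>\<close>. Differentiating the
constant functions \<open>g(C', C') = 0\<close> and \<open>g(C', \<xi>) = a\<close> and the function \<open>b = g(C', F)\<close> gives the three
products of the acceleration \<open>D C'\<close> with the basis: \<open>0\<close>, \<open>b\<close> and \<open>(b' - 2 a^3) / 2\<close>. All quantities in
the theorem are thereby rational expressions in \<open>a\<close>, \<open>b\<close>, \<open>b'\<close>, \<open>b''\<close> and \<open>sqrt q\<close>, and part (i) is a
computation in this basis.

For any Frenet frame, the Frenet equations force \<open>h = g(D C', N)\<close>, \<open>k1 = g(D C', W)\<close> and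
\<open>k2 = g(D N, W)\<close>, and \<open>N\<close> is determined by \<open>W\<close>; conversely, by metric compatibility these three
functions satisfy the Frenet equations. So existence and uniqueness reduce to exhibiting one \<open>N\<close> for each screen.

Part (ii) follows from part (i) by a change of screen. Every other unit screen vector is
\<open>\<plusminus> (W + \<mu> C')\<close>, and the change replaces \<open>h\<close> by \<open>h - \<mu> k1\<close>. The second screen is the choice
\<open>\<mu> = h / k1\<close>, which is why \<open>t\<close> becomes distinguished; its \<open>k2\<close> is
\<open>\<plusminus> (k2 - \<mu> h / 2 - \<mu>')\<close> in terms of the data of the first frame. Here \<open>k1\<close> is, up to the positive
factor \<open>1 / (2 sqrt q)\<close> and a sign, \<open>K = - 2 q + a b'\<close>, which the hypothesis of being non-geodesic
keeps away from zero.

What has to be built underneath is the calculus along a curve: the covariant derivative is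
defined in coordinates, and the Leibniz rule for combinations \<open>\<Sum> f\<^sub>i X\<^sub>i \<circ> C\<close> of restricted vector
fields (lemma \<open>cov_deriv_combination\<close>) yields everything else, including its independence of the
chart, metric compatibility and the derivative of \<open>\<phi> V\<close>.\<close>

section \<open>Smooth maps on sets with unique derivatives\<close>

text \<open>The condition under which derivatives within a set are unique. It holds for open sets and for
nondegenerate intervals, the two kinds of domains that occur, and it passes to relatively open
subsets.\<close>

definition unique_deriv_set :: "'x::euclidean_space set \<Rightarrow> bool"
  where "unique_deriv_set S \<longleftrightarrow>
    (\<forall>x\<in>S. \<forall>i\<in>Basis. \<forall>e>0. \<exists>d. 0 < \<bar>d\<bar> \<and> \<bar>d\<bar> < e \<and> x + d *\<^sub>R i \<in> S)"

lemma unique_deriv_set_open: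
  assumes "open (S :: 'x::euclidean_space set)"
  shows "unique_deriv_set S"
  unfolding unique_deriv_set_def
proof (intro ballI allI impI)
  fix x i :: 'x and e :: real
  assume x: "x \<in> S" and i: "i \<in> Basis" and e: "0 < e"
  obtain r where r: "r > 0" "ball x r \<subseteq> S" using assms x openE by blast
  define d where "d = min r e / 2"
  have "0 < d" "d < e" "d < r" using r e by (auto simp: d_def)
  moreover have "x + d *\<^sub>R i \<in> ball x r" using \<open>0 < d\<close> \<open>d < r\<close> i by (simp add: dist_norm)
  ultimately show "\<exists>d. 0 < \<bar>d\<bar> \<and> \<bar>d\<bar> < e \<and> x + d *\<^sub>R i \<in> S" using r by (intro exI[of _ d]) auto
qed

lemma unique_deriv_set_Int_open:
  assumes S: "unique_deriv_set (S :: 'x::euclidean_space set)" and T: "open T"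
  shows "unique_deriv_set (S \<inter> T)"
  unfolding unique_deriv_set_def
proof (intro ballI allI impI)
  fix x i :: 'x and e :: real
  assume x: "x \<in> S \<inter> T" and i: "i \<in> Basis" and e: "0 < e"
  obtain r where r: "r > 0" "ball x r \<subseteq> T" using T x openE by blast
  obtain d where d: "0 < \<bar>d\<bar>" "\<bar>d\<bar> < min e r" "x + d *\<^sub>R i \<in> S"
    using S x i e r unfolding unique_deriv_set_def by (metis IntD1 min_less_iff_conj)
  moreover have "x + d *\<^sub>R i \<in> ball x r" using d i by (simp add: dist_norm)
  ultimately show "\<exists>d. 0 < \<bar>d\<bar> \<and> \<bar>d\<bar> < e \<and> x + d *\<^sub>R i \<in> S \<inter> T" using r by (intro exI[of _ d]) auto
qed

lemma unique_deriv_set_interval: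
  assumes I: "is_interval (I :: real set)" "interior I \<noteq> {}"
  shows "unique_deriv_set I"
  unfolding unique_deriv_set_def
proof (intro ballI allI impI)
  fix x i :: real and e :: real
  assume x: "x \<in> I" and i: "i \<in> Basis" and e: "0 < e"
  obtain y where y: "y \<in> I" "y \<noteq> x"
  proof -
    have "\<not> I \<subseteq> {x}" using I(2) interior_mono[of I "{x}"] by auto
    then show ?thesis using that by blast
  qed
  \<comment> \<open>a short step from \<open>x\<close> towards the other point \<open>y\<close> stays in the interval\<close>
  define d where "d = (if y > x then min (e/2) (y - x) else - min (e/2) (x - y))"
  have "x + d *\<^sub>R i \<in> I"
    using i mem_is_interval_1_I[OF I(1), of x y "x+d"] mem_is_interval_1_I[OF I(1), of y x "x+d"] x y e
    by (auto simp: d_def min_def split: if_splits)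
  moreover have "0 < \<bar>d\<bar>" "\<bar>d\<bar> < e" using y e by (auto simp: d_def min_def)
  ultimately show "\<exists>d. 0 < \<bar>d\<bar> \<and> \<bar>d\<bar> < e \<and> x + d *\<^sub>R i \<in> I" by blast
qed

lemma frechet_derivative_eqI:
  assumes "unique_deriv_set S" "x \<in> S" "(f has_derivative f') (at x within S)"
  shows "frechet_derivative f (at x within S) = f'"
proof -
  have "(f has_derivative frechet_derivative f (at x within S)) (at x within S)"
    using assms(3) frechet_derivative_works differentiable_def by blast
  then show ?thesis
    using frechet_derivative_unique_within[OF _ assms(3)] assms(1,2)
    unfolding unique_deriv_set_def by blast
qed

lemma frechet_derivative_cong_eventually:
  assumes "\<forall>\<^sub>F y in at x within S. f y = g y" "f x = g x" "x \<in> S"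
  shows "frechet_derivative f (at x within S) = frechet_derivative g (at x within S)"
proof -
  have "(f has_derivative D) (at x within S) \<longleftrightarrow> (g has_derivative D) (at x within S)" for D
  proof
    show "(g has_derivative D) (at x within S)" if "(f has_derivative D) (at x within S)"
      using has_derivative_transform_eventually[OF that assms] .
    have "\<forall>\<^sub>F y in at x within S. g y = f y" using assms(1) by eventually_elim simp
    then show "(f has_derivative D) (at x within S)" if "(g has_derivative D) (at x within S)"
      using has_derivative_transform_eventually[OF that] assms(2,3) by simp
  qed
  then show ?thesis by (simp add: frechet_derivative_def)
qed

lemma frechet_derivative_cong:
  assumes "\<And>y. y \<in> S \<Longrightarrow> f y = g y" "x \<in> S"
  shows "frechet_derivative f (at x within S) = frechet_derivative g (at x within S)"
  by (rule frechet_derivative_cong_eventually) (use assms in \<open>auto simp: eventually_at_filter\<close>)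

lemma k_smooth_on_cong:
  assumes "k_smooth_on k S f" "\<And>x. x \<in> S \<Longrightarrow> f x = g x"
  shows "k_smooth_on k S g"
  using assms
proof (induction k arbitrary: f g)
  case 0
  then show ?case using continuous_on_cong[of S S f g] by simp
next
  case (Suc k)
  have "g differentiable_on S"
    using Suc.prems differentiable_transform_within[of f _ S 1 g]
    by (auto simp: differentiable_on_def)
  moreover have "k_smooth_on k S (\<lambda>x. frechet_derivative g (at x within S) v)" for v
  proof (rule Suc.IH)
    show "k_smooth_on k S (\<lambda>x. frechet_derivative f (at x within S) v)" using Suc.prems by simp
    show "frechet_derivative f (at x within S) v = frechet_derivative g (at x within S) v"
      if "x \<in> S" for x
      using frechet_derivative_cong[of S f g x] Suc.prems(2) that by simp
  qed
  ultimately show ?case by simp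
qed

lemma k_smooth_on_Suc_imp: "k_smooth_on (Suc k) S f \<Longrightarrow> k_smooth_on k S f"
proof (induction k arbitrary: f)
  case 0
  then show ?case by (simp add: differentiable_imp_continuous_on)
qed auto

lemma at_within_Int_open: "x \<in> T \<Longrightarrow> open T \<Longrightarrow> (at x within S \<inter> T) = at x within S"
  by (rule at_within_nhd[of x T]) auto

text \<open>Smoothness is local because a derivative within \<open>S\<close> at a point of an open set \<open>T\<close> is the same as
the derivative within \<open>S \<inter> T\<close>. This is what allows passing between charts, and between a curve and
its restriction to a chart domain.\<close>

lemma k_smooth_on_local:
  assumes "\<And>x. x \<in> S \<Longrightarrow> \<exists>T. open T \<and> x \<in> T \<and> k_smooth_on k (S \<inter> T) f"
  shows "k_smooth_on k S f"
  using assms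
proof (induction k arbitrary: f)
  case 0
  have "continuous (at x within S) f" if x: "x \<in> S" for x
  proof -
    obtain T where T: "open T" "x \<in> T" "continuous_on (S \<inter> T) f" using 0 x by auto
    then have "continuous (at x within S \<inter> T) f" using x continuous_on_eq_continuous_within by blast
    then show ?thesis using T at_within_Int_open[of x T S]
      by (simp add: continuous_within)
  qed
  then show ?case by (simp add: continuous_on_eq_continuous_within)
next
  case (Suc k)
  have *: "f differentiable (at x within S)" if x: "x \<in> S" for x
  proof -
    obtain T where T: "open T" "x \<in> T" "k_smooth_on (Suc k) (S \<inter> T) f" using Suc.prems x by blast
    then show ?thesis using x at_within_Int_open[of x T S]
      by (metis IntI differentiable_on_def k_smooth_on.simps(2))
  qed
  have "k_smooth_on k S (\<lambda>x. frechet_derivative f (at x within S) v)" for v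
  proof (rule Suc.IH)
    fix x assume x: "x \<in> S"
    obtain T where T: "open T" "x \<in> T" "k_smooth_on (Suc k) (S \<inter> T) f" using Suc.prems x by blast
    have "k_smooth_on k (S \<inter> T) (\<lambda>x. frechet_derivative f (at x within S) v)"
      using T(3) at_within_Int_open[OF _ T(1), of _ S]
      by (auto intro: k_smooth_on_cong)
    then show "\<exists>T. open T \<and> x \<in> T \<and>
        k_smooth_on k (S \<inter> T) (\<lambda>x. frechet_derivative f (at x within S) v)"
      using T by blast
  qed
  then show ?case using * by (simp add: differentiable_on_def)
qed

lemma k_smooth_on_Int_open:
  assumes "k_smooth_on k S f" "open T"
  shows "k_smooth_on k (S \<inter> T) f"
  using assms(1)
proof (induction k arbitrary: f)
  case 0
  then show ?case by (auto intro: continuous_on_subset)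
next
  case (Suc k)
  have "f differentiable_on (S \<inter> T)" using Suc.prems by (auto intro: differentiable_on_subset)
  moreover have "k_smooth_on k (S \<inter> T) (\<lambda>x. frechet_derivative f (at x within S \<inter> T) v)" for v
  proof (rule k_smooth_on_cong)
    show "k_smooth_on k (S \<inter> T) (\<lambda>x. frechet_derivative f (at x within S) v)"
      using Suc by auto
  qed (use assms(2) at_within_Int_open[of _ T S] in auto)
  ultimately show ?case by simp
qed

lemma k_smooth_on_const: "unique_deriv_set S \<Longrightarrow> k_smooth_on k S (\<lambda>_. c)"
proof (induction k arbitrary: c)
  case (Suc k)
  show ?case
    using Suc k_smooth_on_cong[OF Suc.IH[OF Suc.prems, of 0]]
    by (simp add: frechet_derivative_eqI[OF Suc.prems(1) _ has_derivative_const])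
qed simp

lemma k_smooth_on_add:
  assumes S: "unique_deriv_set S" and "k_smooth_on k S f" "k_smooth_on k S g"
  shows "k_smooth_on k S (\<lambda>x. f x + g x)"
  using assms(2,3)
proof (induction k arbitrary: f g)
  case 0
  then show ?case by (auto intro: continuous_on_add)
next
  case (Suc k)
  have "k_smooth_on k S (\<lambda>x. frechet_derivative (\<lambda>x. f x + g x) (at x within S) v)" for v
  proof (rule k_smooth_on_cong)
    show "k_smooth_on k S (\<lambda>x. frechet_derivative f (at x within S) v +
        frechet_derivative g (at x within S) v)"
      using Suc by auto
    show "frechet_derivative f (at x within S) v + frechet_derivative g (at x within S) v =
      frechet_derivative (\<lambda>x. f x + g x) (at x within S) v" if x: "x \<in> S" for x
    proof -
      have "((\<lambda>x. f x + g x) has_derivative (\<lambda>v. frechet_derivative f (at x within S) v +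
        frechet_derivative g (at x within S) v)) (at x within S)"
        using Suc.prems x by (intro has_derivative_add) (auto simp: differentiable_on_def frechet_derivative_works[symmetric])
      from frechet_derivative_eqI[OF S x this] show ?thesis by simp
    qed
  qed
  then show ?case using Suc.prems by (simp add: differentiable_on_add)
qed

lemma k_smooth_on_sum:
  assumes S: "unique_deriv_set S" and "finite J" "\<And>i. i \<in> J \<Longrightarrow> k_smooth_on k S (f i)"
  shows "k_smooth_on k S (\<lambda>x. \<Sum>i\<in>J. f i x)"
  using assms(2,3)
  by (induction J rule: finite_induct) (auto intro: k_smooth_on_const k_smooth_on_add S)

text \<open>Each summand of the product rule keeps one factor undifferentiated; the induction hypothesis applies
to it after giving up one order of its smoothness.\<close>

lemma k_smooth_on_bilinear:
  assumes bil: "bounded_bilinear m" and S: "unique_deriv_set S"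
    and "k_smooth_on k S f" "k_smooth_on k S g"
  shows "k_smooth_on k S (\<lambda>x. m (f x) (g x))"
  using assms(3,4)
proof (induction k arbitrary: f g)
  case 0
  then show ?case using bounded_bilinear.continuous_on[OF bil] by auto
next
  case (Suc k)
  have d: "((\<lambda>x. m (f x) (g x)) has_derivative (\<lambda>v. m (f x) (frechet_derivative g (at x within S) v) +
        m (frechet_derivative f (at x within S) v) (g x))) (at x within S)" if x: "x \<in> S" for x
    using Suc.prems x
    by (intro bounded_bilinear.FDERIV[OF bil]) (auto simp: differentiable_on_def frechet_derivative_works[symmetric])
  have "k_smooth_on k S (\<lambda>x. frechet_derivative (\<lambda>x. m (f x) (g x)) (at x within S) v)" for v
  proof (rule k_smooth_on_cong)
    show "k_smooth_on k S (\<lambda>x. m (f x) (frechet_derivative g (at x within S) v) +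
        m (frechet_derivative f (at x within S) v) (g x))"
      using Suc.prems k_smooth_on_Suc_imp[OF Suc.prems(1)] k_smooth_on_Suc_imp[OF Suc.prems(2)]
      by (intro k_smooth_on_add[OF S] Suc.IH) auto
  qed (use frechet_derivative_eqI[OF S _ d] in auto)
  then show ?case using d by (auto simp: differentiable_on_def differentiable_def)
qed

lemma k_smooth_on_linear:
  assumes lin: "bounded_linear L" and S: "unique_deriv_set S" and "k_smooth_on k S f"
  shows "k_smooth_on k S (\<lambda>x. L (f x))"
  using assms(3)
proof (induction k arbitrary: f)
  case 0
  then show ?case using bounded_linear.continuous_on[OF lin] by auto
next
  case (Suc k)
  have d: "((\<lambda>x. L (f x)) has_derivative (\<lambda>v. L (frechet_derivative f (at x within S) v)))
      (at x within S)" if x: "x \<in> S" for x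
    using Suc.prems x
    by (intro bounded_linear.has_derivative[OF lin]) (auto simp: differentiable_on_def frechet_derivative_works[symmetric])
  have "k_smooth_on k S (\<lambda>x. frechet_derivative (\<lambda>x. L (f x)) (at x within S) v)" for v
    by (rule k_smooth_on_cong[OF Suc.IH]) (use Suc.prems frechet_derivative_eqI[OF S _ d] in auto)
  then show ?case using d by (auto simp: differentiable_on_def differentiable_def)
qed

text \<open>The chain rule has to be expanded over a basis: the hypothesis is about the functions
\<open>y \<mapsto> D g(y) i\<close> for a fixed direction \<open>i\<close>, whereas the direction \<open>D f(x) v\<close> in which \<open>g\<close> is
differentiated moves with \<open>x\<close>.\<close>

lemma k_smooth_on_compose:
  fixes f :: "'x::euclidean_space \<Rightarrow> 'y::euclidean_space"
  assumes S: "unique_deriv_set S" and T: "open T" "f ` S \<subseteq> T"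
    and "k_smooth_on k S f" "k_smooth_on k T g"
  shows "k_smooth_on k S (\<lambda>x. g (f x))"
  using assms(4,5)
proof (induction k arbitrary: g)
  case 0
  then show ?case using T continuous_on_compose2[of T g S f] by auto
next
  case (Suc k)
  have d: "((\<lambda>x. g (f x)) has_derivative
      (\<lambda>v. \<Sum>i\<in>Basis. (frechet_derivative f (at x within S) v \<bullet> i) *\<^sub>R
          frechet_derivative g (at (f x) within T) i)) (at x within S)" (is "(_ has_derivative ?D) _")
    if x: "x \<in> S" for x
  proof -
    have g: "(g has_derivative frechet_derivative g (at (f x) within T)) (at (f x) within f ` S)"
      using Suc.prems x T has_derivative_subset
      by (metis differentiable_on_def frechet_derivative_works image_subset_iff k_smooth_on.simps(2))
    have f: "(f has_derivative frechet_derivative f (at x within S)) (at x within S)"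
      using Suc.prems x by (auto simp: differentiable_on_def frechet_derivative_works[symmetric])
    have "?D = frechet_derivative g (at (f x) within T) \<circ> frechet_derivative f (at x within S)"
    proof
      fix v
      interpret linear "frechet_derivative g (at (f x) within T)" using has_derivative_linear[OF g] .
      have "?D v = frechet_derivative g (at (f x) within T)
          (\<Sum>i\<in>Basis. (frechet_derivative f (at x within S) v \<bullet> i) *\<^sub>R i)"
        by (simp only: sum scale)
      then show "?D v =
          (frechet_derivative g (at (f x) within T) \<circ> frechet_derivative f (at x within S)) v"
        by (simp add: euclidean_representation)
    qed
    then show ?thesis using diff_chain_within[OF f g] by (simp add: o_def)
  qed
  have "k_smooth_on k S (\<lambda>x. frechet_derivative (\<lambda>x. g (f x)) (at x within S) v)" for v
  proof (rule k_smooth_on_cong)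
    have "k_smooth_on k S f" using Suc.prems k_smooth_on_Suc_imp by blast
    moreover have "k_smooth_on k S (\<lambda>x. frechet_derivative f (at x within S) v \<bullet> i)" for i
      using Suc.prems by (intro k_smooth_on_linear[OF bounded_linear_inner_left S]) auto
    ultimately show "k_smooth_on k S (\<lambda>x. \<Sum>i\<in>Basis. (frechet_derivative f (at x within S) v \<bullet> i) *\<^sub>R
          frechet_derivative g (at (f x) within T) i)"
      using Suc.prems
      by (intro k_smooth_on_sum[OF S] k_smooth_on_bilinear[OF bounded_bilinear_scaleR S] Suc.IH) auto
  qed (use frechet_derivative_eqI[OF S _ d] in auto)
  then show ?case using d by (auto simp: differentiable_on_def differentiable_def)
qed

text \<open>Real powers with an arbitrary exponent are closed under differentiation, up to constants, so one
induction covers both reciprocals and square roots.\<close>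

lemma k_smooth_on_powr: "k_smooth_on k {0<..} (\<lambda>x::real. x powr r)"
proof (induction k arbitrary: r)
  case 0
  show ?case by (auto intro!: continuous_intros)
next
  case (Suc k)
  have S: "unique_deriv_set {0::real<..}" by (simp add: unique_deriv_set_open)
  have d: "((\<lambda>x. x powr r) has_derivative (\<lambda>v. r * x powr (r - 1) * v)) (at x within {0<..})"
    if "x \<in> {0<..}" for x
    using that by (auto intro!: derivative_eq_intros simp: powr_diff field_simps)
  have "k_smooth_on k {0<..} (\<lambda>x. frechet_derivative (\<lambda>x. x powr r) (at x within {0<..}) v)" for v
  proof (rule k_smooth_on_cong)
    show "k_smooth_on k {0<..} (\<lambda>x. (r * v) *\<^sub>R x powr (r - 1))"
      by (intro k_smooth_on_linear[OF bounded_linear_scaleR_right S] Suc.IH)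
  qed (use frechet_derivative_eqI[OF S _ d] in auto)
  then show ?case using d by (auto simp: differentiable_on_def differentiable_def)
qed

lemma smooth_on_cong: "smooth_on S f \<Longrightarrow> (\<And>x. x \<in> S \<Longrightarrow> f x = g x) \<Longrightarrow> smooth_on S g"
  unfolding smooth_on_def using k_smooth_on_cong by blast

lemma smooth_on_local:
  assumes "\<And>x. x \<in> S \<Longrightarrow> \<exists>T. open T \<and> x \<in> T \<and> smooth_on (S \<inter> T) f"
  shows "smooth_on S f"
  unfolding smooth_on_def by (meson assms k_smooth_on_local smooth_on_def)

lemma smooth_on_Int_open: "smooth_on S f \<Longrightarrow> open T \<Longrightarrow> smooth_on (S \<inter> T) f"
  unfolding smooth_on_def using k_smooth_on_Int_open by blast

lemma smooth_on_open_subset: "smooth_on S f \<Longrightarrow> open T \<Longrightarrow> T \<subseteq> S \<Longrightarrow> smooth_on T f"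
  using smooth_on_Int_open[of S f T] by (simp add: Int_absorb1)

lemma smooth_on_const: "unique_deriv_set S \<Longrightarrow> smooth_on S (\<lambda>_. c)"
  unfolding smooth_on_def using k_smooth_on_const by blast

lemma smooth_on_add:
  "unique_deriv_set S \<Longrightarrow> smooth_on S f \<Longrightarrow> smooth_on S g \<Longrightarrow> smooth_on S (\<lambda>x. f x + g x)"
  unfolding smooth_on_def using k_smooth_on_add by blast

lemma smooth_on_sum:
  assumes "unique_deriv_set S" "finite J" "\<And>i. i \<in> J \<Longrightarrow> smooth_on S (f i)"
  shows "smooth_on S (\<lambda>x. \<Sum>i\<in>J. f i x)"
  using assms unfolding smooth_on_def by (auto intro!: k_smooth_on_sum)

lemma smooth_on_scaleR:
  "unique_deriv_set S \<Longrightarrow> smooth_on S f \<Longrightarrow> smooth_on S g \<Longrightarrow> smooth_on S (\<lambda>x. f x *\<^sub>R g x)"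
  unfolding smooth_on_def using k_smooth_on_bilinear[OF bounded_bilinear_scaleR] by blast

lemma smooth_on_mult:
  fixes f g :: "'x::euclidean_space \<Rightarrow> real"
  shows "unique_deriv_set S \<Longrightarrow> smooth_on S f \<Longrightarrow> smooth_on S g \<Longrightarrow> smooth_on S (\<lambda>x. f x * g x)"
  unfolding smooth_on_def using k_smooth_on_bilinear[OF bounded_bilinear_mult] by blast

lemma smooth_on_linear:
  "bounded_linear L \<Longrightarrow> unique_deriv_set S \<Longrightarrow> smooth_on S f \<Longrightarrow> smooth_on S (\<lambda>x. L (f x))"
  unfolding smooth_on_def using k_smooth_on_linear by blast

lemma smooth_on_compose:
  fixes f :: "'x::euclidean_space \<Rightarrow> 'y::euclidean_space"
  shows "unique_deriv_set S \<Longrightarrow> open T \<Longrightarrow> f ` S \<subseteq> T \<Longrightarrow> smooth_on S f \<Longrightarrow> smooth_on T g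
    \<Longrightarrow> smooth_on S (\<lambda>x. g (f x))"
  unfolding smooth_on_def using k_smooth_on_compose by blast

lemma smooth_on_powr:
  fixes f :: "'x::euclidean_space \<Rightarrow> real"
  assumes "unique_deriv_set S" "smooth_on S f" "\<And>x. x \<in> S \<Longrightarrow> f x > 0"
  shows "smooth_on S (\<lambda>x. f x powr r)"
  using smooth_on_compose[OF assms(1) open_greaterThan[of 0] _ assms(2), of "\<lambda>x. x powr r"] assms(3)
    k_smooth_on_powr by (auto simp: smooth_on_def)

lemma smooth_on_divide:
  fixes f g :: "'x::euclidean_space \<Rightarrow> real"
  assumes S: "unique_deriv_set S" and f: "smooth_on S f" and g: "smooth_on S g" "\<And>x. x \<in> S \<Longrightarrow> g x \<noteq> 0"
  shows "smooth_on S (\<lambda>x. f x / g x)"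
proof (rule smooth_on_cong)
  \<comment> \<open>\<open>powr\<close> is smooth on positive bases only, whence the square in \<open>1 / g = g / g^2\<close>\<close>
  show "smooth_on S (\<lambda>x. f x * (g x * (g x * g x) powr (-1)))"
    by (intro smooth_on_mult smooth_on_powr S f g(1)) (use g(2) in \<open>simp add: zero_less_mult_iff linorder_neq_iff disj_commute\<close>)
  show "f x * (g x * (g x * g x) powr (-1)) = f x / g x" if "x \<in> S" for x
    using g(2)[OF that] by (simp add: powr_minus_divide)
qed

lemma smooth_on_sqrt:
  fixes f :: "'x::euclidean_space \<Rightarrow> real"
  assumes "unique_deriv_set S" "smooth_on S f" "\<And>x. x \<in> S \<Longrightarrow> f x > 0"
  shows "smooth_on S (\<lambda>x. sqrt (f x))"
  by (rule smooth_on_cong[OF smooth_on_powr[OF assms, where r="1/2"]])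
    (use assms(3) in \<open>auto simp: powr_half_sqrt less_imp_le\<close>)

lemma smooth_on_frechet_derivative:
  "smooth_on S f \<Longrightarrow> smooth_on S (\<lambda>x. frechet_derivative f (at x within S) v)"
  unfolding smooth_on_def by (metis k_smooth_on.simps(2))

lemma smooth_on_imp_differentiable:
  "smooth_on S f \<Longrightarrow> x \<in> S \<Longrightarrow> f differentiable (at x within S)"
  unfolding smooth_on_def by (metis differentiable_on_def k_smooth_on.simps(2))

section \<open>Tangent spaces and smooth fields\<close>

locale manifold =
  fixes A :: "'a::{t2_space,second_countable_topology} chart set"
  assumes atlas: "smooth_atlas A"
begin

lemma open_chart_dom: "c \<in> A \<Longrightarrow> open (chart_dom c)"
  using atlas unfolding smooth_atlas_def by blast

lemma chart_at:
  obtains c where "c \<in> A" "p \<in> chart_dom c"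
  using atlas unfolding smooth_atlas_def by blast

lemma chart_homeomorphism:
  "c \<in> A \<Longrightarrow> homeomorphism (chart_dom c) (coords c ` chart_dom c) (coords c) (chart_inv c)"
  using atlas unfolding smooth_atlas_def by blast

lemma chart_inv_coords [simp]: "c \<in> A \<Longrightarrow> p \<in> chart_dom c \<Longrightarrow> chart_inv c (coords c p) = p"
  using homeomorphism_apply1[OF chart_homeomorphism] by blast

text \<open>Inside the chart, the image is the preimage under the continuous inverse chart.\<close>

lemma open_coords_image:
  assumes c: "c \<in> A" and U: "open U"
  shows "open (coords c ` (chart_dom c \<inter> U))"
proof -
  have "coords c ` (chart_dom c \<inter> U) = coords c ` chart_dom c \<inter> chart_inv c -` U"
    using c by (auto simp: image_iff)
  moreover have "open (coords c ` chart_dom c)" using atlas c unfolding smooth_atlas_def by blast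
  ultimately show ?thesis
    using continuous_open_preimage[OF homeomorphism_cont2[OF chart_homeomorphism[OF c]] _ U] by simp
qed

lemma transition_smooth:
  "c \<in> A \<Longrightarrow> d \<in> A \<Longrightarrow>
    smooth_on (coords c ` (chart_dom c \<inter> chart_dom d)) (\<lambda>x. coords d (chart_inv c x))"
  using atlas unfolding smooth_atlas_def o_def by blast

lemma jacobian_has_derivative:
  assumes "c \<in> A" "d \<in> A" "p \<in> chart_dom c" "p \<in> chart_dom d"
  shows "((\<lambda>x. coords d (chart_inv c x)) has_derivative jacobian c d p) (at (coords c p))"
proof -
  have "coords c p \<in> coords c ` (chart_dom c \<inter> chart_dom d)" using assms by blast
  moreover have "open (coords c ` (chart_dom c \<inter> chart_dom d))"
    using assms open_coords_image open_chart_dom by blast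
  ultimately show ?thesis
    using smooth_on_imp_differentiable[OF transition_smooth[OF assms(1,2)], of "coords c p"]
      at_within_open[of "coords c p" "coords c ` (chart_dom c \<inter> chart_dom d)"]
    by (simp add: frechet_derivative_works[symmetric] jacobian_def o_def)
qed

lemma jacobian_linear:
  "c \<in> A \<Longrightarrow> d \<in> A \<Longrightarrow> p \<in> chart_dom c \<Longrightarrow> p \<in> chart_dom d \<Longrightarrow> linear (jacobian c d p)"
  using jacobian_has_derivative has_derivative_linear by blast

lemma eventually_in_coords_image:
  assumes "c \<in> A" "open U" "p \<in> chart_dom c \<inter> U"
  shows "\<forall>\<^sub>F x in at (coords c p). x \<in> coords c ` (chart_dom c \<inter> U)"
  using assms by (intro eventually_at_in_open' open_coords_image) auto

lemma jacobian_self: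
  assumes c: "c \<in> A" and p: "p \<in> chart_dom c"
  shows "jacobian c c p = (\<lambda>x. x)"
proof -
  have "\<forall>\<^sub>F x in at (coords c p). x = coords c (chart_inv c x)"
    using eventually_in_coords_image[of c UNIV p] c p by (auto elim!: eventually_mono)
  then have "((\<lambda>x. coords c (chart_inv c x)) has_derivative (\<lambda>x. x)) (at (coords c p))"
    by (rule has_derivative_transform_eventually[OF has_derivative_ident]) (use c p in simp_all)
  then show ?thesis using jacobian_has_derivative[OF c c p p] has_derivative_unique by blast
qed

text \<open>The cocycle rule is what makes the coordinate fields tangent vectors, that is, consistent across
all charts.\<close>

lemma jacobian_compose:
  assumes A: "c \<in> A" "d \<in> A" "e \<in> A" and p: "p \<in> chart_dom c" "p \<in> chart_dom d" "p \<in> chart_dom e"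
  shows "jacobian c e p x = jacobian d e p (jacobian c d p x)"
proof -
  have "((\<lambda>x. coords e (chart_inv d x)) has_derivative jacobian d e p)
      (at (coords d (chart_inv c (coords c p))))"
    using jacobian_has_derivative[OF A(2,3) p(2,3)] A p by simp
  from diff_chain_at[OF jacobian_has_derivative[OF A(1,2) p(1,2)] this]
  have "((\<lambda>x. coords e (chart_inv d (coords d (chart_inv c x)))) has_derivative
      jacobian d e p \<circ> jacobian c d p) (at (coords c p))" by (simp add: o_def)
  moreover have "\<forall>\<^sub>F x in at (coords c p).
      coords e (chart_inv d (coords d (chart_inv c x))) = coords e (chart_inv c x)"
    using eventually_in_coords_image[of c "chart_dom d" p] A p open_chart_dom
    by (auto elim!: eventually_mono)
  ultimately have "((\<lambda>x. coords e (chart_inv c x)) has_derivative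
      jacobian d e p \<circ> jacobian c d p) (at (coords c p))"
    by (rule has_derivative_transform_eventually) (use A p in simp_all)
  then have "jacobian c e p = jacobian d e p \<circ> jacobian c d p"
    using jacobian_has_derivative[OF A(1,3) p(1,3)] has_derivative_unique by blast
  then show ?thesis by simp
qed

lemma tangentD:
  "v \<in> tangent_space A p \<Longrightarrow> c \<in> A \<Longrightarrow> d \<in> A \<Longrightarrow> p \<in> chart_dom c \<Longrightarrow> p \<in> chart_dom d \<Longrightarrow>
    v d = jacobian c d p (v c)"
  unfolding tangent_space_def by blast

lemma tangent_outside:
  "v \<in> tangent_space A p \<Longrightarrow> \<not> (c \<in> A \<and> p \<in> chart_dom c) \<Longrightarrow> v c = 0"
  unfolding tangent_space_def by blast

text \<open>The transformation rule gives the coordinates in all other charts, so equations between tangent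
vectors can be checked in one convenient chart.\<close>

lemma tangent_eqI:
  assumes "u \<in> tangent_space A p" "v \<in> tangent_space A p" "c \<in> A" "p \<in> chart_dom c" "u c = v c"
  shows "u = v"
proof
  fix d show "u d = v d"
    by (cases "d \<in> A \<and> p \<in> chart_dom d") (metis assms tangentD, metis assms(1,2) tangent_outside)
qed

lemma subspace_tangent: "subspace (tangent_space A p)"
proof (rule subspaceI)
  show "0 \<in> tangent_space A p"
    by (simp add: tangent_space_def linear_0[OF jacobian_linear])
next
  fix u v assume T: "u \<in> tangent_space A p" "v \<in> tangent_space A p"
  have "(u + v) d = jacobian c d p ((u + v) c)"
    if "c \<in> A" "d \<in> A" "p \<in> chart_dom c" "p \<in> chart_dom d" for c d
    using tangentD[OF T(1) that] tangentD[OF T(2) that] linear_add[OF jacobian_linear[OF that]] by simp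
  moreover have "(u + v) c = 0" if "\<not> (c \<in> A \<and> p \<in> chart_dom c)" for c
    using tangent_outside[OF T(1) that] tangent_outside[OF T(2) that] by simp
  ultimately show "u + v \<in> tangent_space A p" unfolding tangent_space_def by blast
next
  fix r v assume T: "v \<in> tangent_space A p"
  have "(r *\<^sub>R v) d = jacobian c d p ((r *\<^sub>R v) c)"
    if "c \<in> A" "d \<in> A" "p \<in> chart_dom c" "p \<in> chart_dom d" for c d
    using tangentD[OF T that] linear_scale[OF jacobian_linear[OF that]] by (simp add: scaleR_fun_def)
  moreover have "(r *\<^sub>R v) c = 0" if "\<not> (c \<in> A \<and> p \<in> chart_dom c)" for c
    using tangent_outside[OF T that] by (simp add: scaleR_fun_def)
  ultimately show "r *\<^sub>R v \<in> tangent_space A p" unfolding tangent_space_def by blast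
qed

lemmas tangent_add = subspace_add[OF subspace_tangent]
lemmas tangent_scaleR = subspace_scale[OF subspace_tangent]
lemmas tangent_zero = subspace_0[OF subspace_tangent]
lemmas tangent_neg = subspace_neg[OF subspace_tangent]
lemmas tangent_diff = subspace_diff[OF subspace_tangent]
lemmas tangent_sum = subspace_sum[OF subspace_tangent]

lemmas tangent_intros = tangent_add tangent_scaleR tangent_zero tangent_neg tangent_diff tangent_sum

lemma scaleR_tvec_apply: "(r *\<^sub>R (v :: 'a tvec)) c = r *\<^sub>R v c"
  by (simp add: scaleR_fun_def)

lemma sum_tvec_apply: "(\<Sum>i\<in>J. f i) c = (\<Sum>i\<in>J. (f i :: 'a tvec) c)"
  by (induction J rule: infinite_finite_induct) auto

lemma coord_field_tangent:
  assumes "c \<in> A" "p \<in> chart_dom c"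
  shows "coord_field A c i p \<in> tangent_space A p"
  using assms by (auto simp: tangent_space_def coord_field_def intro: jacobian_compose)

lemma coord_field_self: "c \<in> A \<Longrightarrow> p \<in> chart_dom c \<Longrightarrow> coord_field A c i p c = axis i 1"
  by (simp add: coord_field_def jacobian_self)

lemma vec_sum_axis: "(\<Sum>i\<in>UNIV. (x $ i) *\<^sub>R axis i 1) = (x :: real^3)"
  using basis_expansion[of x] by (simp add: scalar_mult_eq_scaleR)

lemma tangent_expand:
  assumes v: "v \<in> tangent_space A p" and c: "c \<in> A" "p \<in> chart_dom c"
  shows "v = (\<Sum>i\<in>UNIV. (v c $ i) *\<^sub>R coord_field A c i p)"
proof (rule tangent_eqI[OF v _ c])
  show "(\<Sum>i\<in>UNIV. (v c $ i) *\<^sub>R coord_field A c i p) \<in> tangent_space A p"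
    using c coord_field_tangent by (intro tangent_sum tangent_scaleR) auto
  show "v c = (\<Sum>i\<in>UNIV. (v c $ i) *\<^sub>R coord_field A c i p) c"
    using c by (simp add: sum_tvec_apply scaleR_fun_def coord_field_self vec_sum_axis)
qed

text \<open>Tangent spaces have dimension three: a linearly independent triple gives an injective linear
endomorphism of \<open>real^3\<close> through the coordinates of one chart, which is then surjective.\<close>

lemma tangent_eq_span3:
  assumes T: "x \<in> tangent_space A p" "y \<in> tangent_space A p" "z \<in> tangent_space A p"
    and indep: "\<And>\<alpha> \<beta> \<gamma>. \<alpha> *\<^sub>R x + \<beta> *\<^sub>R y + \<gamma> *\<^sub>R z = 0 \<Longrightarrow> \<alpha> = 0 \<and> \<beta> = 0 \<and> \<gamma> = 0"
    and v: "v \<in> tangent_space A p"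
  obtains \<alpha> \<beta> \<gamma> where "v = \<alpha> *\<^sub>R x + \<beta> *\<^sub>R y + \<gamma> *\<^sub>R z"
proof -
  obtain c where c: "c \<in> A" "p \<in> chart_dom c" by (rule chart_at)
  define L :: "real^3 \<Rightarrow> real^3" where "L w = (w $ 1) *\<^sub>R x c + (w $ 2) *\<^sub>R y c + (w $ 3) *\<^sub>R z c" for w
  have lin: "linear L" by (rule linearI) (simp_all add: L_def algebra_simps)
  have "w = 0" if "L w = 0" for w
  proof -
    have "(w $ 1) *\<^sub>R x + (w $ 2) *\<^sub>R y + (w $ 3) *\<^sub>R z = 0"
      by (rule tangent_eqI[OF _ _ c]) (use T that in \<open>auto simp: L_def scaleR_tvec_apply intro!: tangent_intros\<close>)
    then show "w = 0" using indep by (simp add: vec_eq_iff forall_3)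
  qed
  then have "inj L" using linear_injective_0[OF lin] by blast
  then have "surj L" using linear_injective_imp_surjective[OF lin] by simp
  then obtain w where w: "v c = L w" by (metis surjD)
  have "v = (w $ 1) *\<^sub>R x + (w $ 2) *\<^sub>R y + (w $ 3) *\<^sub>R z"
    by (rule tangent_eqI[OF v _ c]) (use T w in \<open>auto simp: L_def scaleR_tvec_apply intro!: tangent_intros\<close>)
  then show ?thesis by (rule that)
qed

lemma jacobian_smooth:
  assumes A: "c \<in> A" "d \<in> A" and U: "open U" "U \<subseteq> chart_dom c \<inter> chart_dom d"
  shows "smooth_on (coords d ` U) (\<lambda>x. jacobian c d (chart_inv d x) v)"
proof -
  let ?S = "coords c ` (chart_dom c \<inter> chart_dom d)"
  have S: "open ?S" using A open_coords_image open_chart_dom by blast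
  have oU: "open (coords d ` U)"
    using open_coords_image[OF A(2) U(1)] U(2) by (simp add: Int_absorb1)
  have D: "smooth_on ?S (\<lambda>y. frechet_derivative (coords d \<circ> chart_inv c) (at y) v)"
    using smooth_on_frechet_derivative[OF transition_smooth[OF A], of v]
    by (rule smooth_on_cong) (use S at_within_open[OF _ S] in \<open>simp add: o_def\<close>)
  have "smooth_on (coords d ` U) (\<lambda>x. coords c (chart_inv d x))"
    using smooth_on_open_subset[OF transition_smooth[OF A(2,1)] oU] U by blast
  moreover have "(\<lambda>x. coords c (chart_inv d x)) ` coords d ` U \<subseteq> ?S"
  proof -
    have "(\<lambda>x. coords c (chart_inv d x)) ` coords d ` U = coords c ` U"
      unfolding image_image by (rule image_cong) (use U(2) A(2) in auto)
    then show ?thesis using U(2) by (simp add: image_mono)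
  qed
  ultimately show ?thesis
    unfolding jacobian_def using smooth_on_compose[OF unique_deriv_set_open[OF oU] S _ _ D] by blast
qed

text \<open>The definition grants smooth coordinates only in some chart around each point; the transformation
rule for tangent vectors transports this to every chart.\<close>

lemma smooth_vector_field_in_chart:
  assumes X: "smooth_vector_field A U X" and U: "open U" and d: "d \<in> A"
  shows "smooth_on (coords d ` (chart_dom d \<inter> U)) (\<lambda>x. X (chart_inv d x) d)"
proof (rule smooth_on_local)
  fix x assume "x \<in> coords d ` (chart_dom d \<inter> U)"
  then obtain p where p: "p \<in> chart_dom d" "p \<in> U" "x = coords d p" by blast
  obtain c where c: "c \<in> A" "p \<in> chart_dom c"
    "smooth_on (coords c ` (chart_dom c \<inter> U)) (\<lambda>x. X (chart_inv c x) c)"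
    using X p(2) unfolding smooth_vector_field_def by blast
  define V where "V = U \<inter> chart_dom c \<inter> chart_dom d"
  have V: "open V" "p \<in> V" using U open_chart_dom[OF c(1)] open_chart_dom[OF d] c p by (simp_all add: V_def open_Int)
  have oV: "open (coords d ` V)"
    using open_coords_image[OF d V(1)] by (simp add: V_def Int_commute Int_left_commute)
  have u: "unique_deriv_set (coords d ` V)" using oV by (rule unique_deriv_set_open)
  have "smooth_on (coords d ` V) (\<lambda>x. coords c (chart_inv d x))"
    using smooth_on_open_subset[OF transition_smooth[OF d c(1)] oV] by (auto simp: V_def)
  then have "smooth_on (coords d ` V) (\<lambda>x. X (chart_inv c (coords c (chart_inv d x))) c)"
    using c d U V_def by (intro smooth_on_compose[OF u open_coords_image _ _ c(3)]) auto
  then have X': "smooth_on (coords d ` V) (\<lambda>x. X (chart_inv d x) c)"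
    by (rule smooth_on_cong) (use c d in \<open>auto simp: V_def\<close>)
  have "smooth_on (coords d ` V)
    (\<lambda>x. \<Sum>i\<in>UNIV. (X (chart_inv d x) c $ i) *\<^sub>R jacobian c d (chart_inv d x) (axis i 1))"
    using X' c(1) d V(1)
    by (intro smooth_on_sum[OF u] smooth_on_scaleR[OF u] jacobian_smooth
        smooth_on_linear[OF bounded_linear_vec_nth u]) (auto simp: V_def)
  then have *: "smooth_on (coords d ` V) (\<lambda>x. X (chart_inv d x) d)"
  proof (rule smooth_on_cong)
    fix x assume "x \<in> coords d ` V"
    then obtain q where q: "q \<in> V" "chart_inv d x = q" using d by (auto simp: V_def)
    then have qq: "q \<in> U" "q \<in> chart_dom c" "q \<in> chart_dom d" by (auto simp: V_def)
    interpret linear "jacobian c d q" using jacobian_linear qq c(1) d by blast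
    have "X q d = jacobian c d q (X q c)"
      using X qq c(1) d tangentD unfolding smooth_vector_field_def by blast
    also have "\<dots> = (\<Sum>i\<in>UNIV. (X q c $ i) *\<^sub>R jacobian c d q (axis i 1))"
      by (subst vec_sum_axis[symmetric]) (simp only: sum scale)
    finally show "(\<Sum>i\<in>UNIV. (X (chart_inv d x) c $ i) *\<^sub>R jacobian c d (chart_inv d x) (axis i 1))
      = X (chart_inv d x) d" using q by simp
  qed
  moreover have "coords d ` (chart_dom d \<inter> U) \<inter> coords d ` V = coords d ` V"
    by (auto simp: V_def)
  ultimately show "\<exists>T. open T \<and> x \<in> T \<and>
      smooth_on (coords d ` (chart_dom d \<inter> U) \<inter> T) (\<lambda>x. X (chart_inv d x) d)"
    using oV V p by (intro exI[of _ "coords d ` V"]) auto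
qed

lemma smooth_function_in_chart:
  assumes f: "smooth_function A U f" and U: "open U" and d: "d \<in> A"
  shows "smooth_on (coords d ` (chart_dom d \<inter> U)) (\<lambda>x. f (chart_inv d x))"
proof (rule smooth_on_local)
  fix x assume "x \<in> coords d ` (chart_dom d \<inter> U)"
  then obtain p where p: "p \<in> chart_dom d" "p \<in> U" "x = coords d p" by blast
  obtain c where c: "c \<in> A" "p \<in> chart_dom c"
    "smooth_on (coords c ` (chart_dom c \<inter> U)) (\<lambda>x. f (chart_inv c x))"
    using f p(2) unfolding smooth_function_def by blast
  define V where "V = U \<inter> chart_dom c \<inter> chart_dom d"
  have V: "open V" "p \<in> V" using U open_chart_dom[OF c(1)] open_chart_dom[OF d] c p by (simp_all add: V_def open_Int)
  have oV: "open (coords d ` V)"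
    using open_coords_image[OF d V(1)] by (simp add: V_def Int_commute Int_left_commute)
  have u: "unique_deriv_set (coords d ` V)" using oV by (rule unique_deriv_set_open)
  have "smooth_on (coords d ` V) (\<lambda>x. coords c (chart_inv d x))"
    using smooth_on_open_subset[OF transition_smooth[OF d c(1)] oV] by (auto simp: V_def)
  then have "smooth_on (coords d ` V) (\<lambda>x. f (chart_inv c (coords c (chart_inv d x))))"
    using c d U V_def by (intro smooth_on_compose[OF u open_coords_image _ _ c(3)]) auto
  then have *: "smooth_on (coords d ` V) (\<lambda>x. f (chart_inv d x))"
    by (rule smooth_on_cong) (use c d in \<open>auto simp: V_def\<close>)
  moreover have "coords d ` (chart_dom d \<inter> U) \<inter> coords d ` V = coords d ` V"
    by (auto simp: V_def)
  ultimately show "\<exists>T. open T \<and> x \<in> T \<and>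
      smooth_on (coords d ` (chart_dom d \<inter> U) \<inter> T) (\<lambda>x. f (chart_inv d x))"
    using oV V p by (intro exI[of _ "coords d ` V"]) auto
qed

lemma smooth_vector_fieldI:
  assumes "c \<in> A" "U \<subseteq> chart_dom c" "\<And>q. q \<in> U \<Longrightarrow> X q \<in> tangent_space A q"
    "smooth_on (coords c ` U) (\<lambda>x. X (chart_inv c x) c)"
  shows "smooth_vector_field A U X"
  unfolding smooth_vector_field_def using assms by (auto simp: Int_absorb1 intro!: bexI[of _ c])

lemma smooth_functionI:
  assumes "c \<in> A" "U \<subseteq> chart_dom c" "smooth_on (coords c ` U) (\<lambda>x. f (chart_inv c x))"
  shows "smooth_function A U f"
  unfolding smooth_function_def using assms by (auto simp: Int_absorb1 intro!: bexI[of _ c])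

lemma smooth_vector_field_subset:
  assumes "smooth_vector_field A U X" "open U" "open V" "V \<subseteq> U"
  shows "smooth_vector_field A V X"
  unfolding smooth_vector_field_def
proof (intro conjI ballI)
  fix p assume p: "p \<in> V"
  then show "X p \<in> tangent_space A p" using assms unfolding smooth_vector_field_def by blast
  obtain c where c: "c \<in> A" "p \<in> chart_dom c" by (rule chart_at)
  have "smooth_on (coords c ` (chart_dom c \<inter> V)) (\<lambda>x. X (chart_inv c x) c)"
    using smooth_on_open_subset[OF smooth_vector_field_in_chart[OF assms(1,2) c(1)]
        open_coords_image[OF c(1) assms(3)]] assms(4) by blast
  then show "\<exists>c\<in>A. p \<in> chart_dom c \<and>
      smooth_on (coords c ` (chart_dom c \<inter> V)) (\<lambda>x. X (chart_inv c x) c)" using c by blast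
qed

text \<open>In its own chart a coordinate field is constant.\<close>

lemma coord_field_smooth:
  assumes c: "c \<in> A" and U: "open U" "U \<subseteq> chart_dom c"
  shows "smooth_vector_field A U (coord_field A c i)"
proof (rule smooth_vector_fieldI[OF c U(2)])
  have "open (coords c ` U)" using open_coords_image[OF c U(1)] U(2) by (simp add: Int_absorb1)
  then have "smooth_on (coords c ` U) (\<lambda>x. axis i 1 :: real^3)"
    by (intro smooth_on_const unique_deriv_set_open)
  then show "smooth_on (coords c ` U) (\<lambda>x. coord_field A c i (chart_inv c x) c)"
    by (rule smooth_on_cong) (use c U in \<open>auto simp: subset_iff coord_field_self\<close>)
qed (use U coord_field_tangent[OF c] in blast)

lemma component_smooth:
  assumes X: "smooth_vector_field A U X" and c: "c \<in> A" and U: "open U" "U \<subseteq> chart_dom c"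
  shows "smooth_function A U (\<lambda>q. X q c $ i)"
proof (rule smooth_functionI[OF c U(2)])
  have "open (coords c ` U)" using open_coords_image[OF c U(1)] U(2) by (simp add: Int_absorb1)
  then show "smooth_on (coords c ` U) (\<lambda>x. X (chart_inv c x) c $ i)"
    using smooth_vector_field_in_chart[OF X U(1) c] U(2)
    by (intro smooth_on_linear[OF bounded_linear_vec_nth] unique_deriv_set_open)
      (simp_all add: Int_absorb1)
qed

lemma smooth_vector_field_scaleR:
  assumes f: "smooth_function A U f" and X: "smooth_vector_field A U X" and U: "open U"
  shows "smooth_vector_field A U (\<lambda>q. f q *\<^sub>R X q)"
  unfolding smooth_vector_field_def
proof (intro conjI ballI)
  fix p assume p: "p \<in> U"
  then show "f p *\<^sub>R X p \<in> tangent_space A p"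
    using X tangent_scaleR unfolding smooth_vector_field_def by blast
  obtain c where c: "c \<in> A" "p \<in> chart_dom c" by (rule chart_at)
  have "smooth_on (coords c ` (chart_dom c \<inter> U)) (\<lambda>x. (f (chart_inv c x) *\<^sub>R X (chart_inv c x)) c)"
    using c(1) U unfolding scaleR_fun_def
    by (intro smooth_on_scaleR unique_deriv_set_open open_coords_image
        smooth_function_in_chart[OF f] smooth_vector_field_in_chart[OF X]) auto
  then show "\<exists>c\<in>A. p \<in> chart_dom c \<and>
      smooth_on (coords c ` (chart_dom c \<inter> U)) (\<lambda>x. (f (chart_inv c x) *\<^sub>R X (chart_inv c x)) c)"
    using c by blast
qed

lemma smooth_vector_field_add:
  assumes X: "smooth_vector_field A U X" and Y: "smooth_vector_field A U Y" and U: "open U"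
  shows "smooth_vector_field A U (\<lambda>q. X q + Y q)"
  unfolding smooth_vector_field_def
proof (intro conjI ballI)
  fix p assume p: "p \<in> U"
  then show "X p + Y p \<in> tangent_space A p"
    using X Y tangent_add unfolding smooth_vector_field_def by blast
  obtain c where c: "c \<in> A" "p \<in> chart_dom c" by (rule chart_at)
  have "smooth_on (coords c ` (chart_dom c \<inter> U)) (\<lambda>x. (X (chart_inv c x) + Y (chart_inv c x)) c)"
    using c(1) U unfolding plus_fun_apply
    by (intro smooth_on_add unique_deriv_set_open open_coords_image
        smooth_vector_field_in_chart[OF X] smooth_vector_field_in_chart[OF Y]) auto
  then show "\<exists>c\<in>A. p \<in> chart_dom c \<and>
      smooth_on (coords c ` (chart_dom c \<inter> U)) (\<lambda>x. (X (chart_inv c x) + Y (chart_inv c x)) c)"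
    using c by blast
qed

end

section \<open>Smooth curves and fields along them\<close>

text \<open>The condition that makes derivatives unique also makes \<open>t\<close> a limit point of \<open>S\<close>.\<close>

lemma at_within_unique_deriv_set:
  fixes t :: real
  assumes "unique_deriv_set S" "t \<in> S"
  shows "at t within S \<noteq> bot"
proof -
  have "\<exists>x\<in>S. x \<noteq> t \<and> dist x t < e" if "e > 0" for e
  proof -
    obtain d where "0 < \<bar>d\<bar>" "\<bar>d\<bar> < e" "t + d *\<^sub>R 1 \<in> S"
      using assms(1)[unfolded unique_deriv_set_def, rule_format, OF assms(2), of 1 e] \<open>e > 0\<close> by auto
    then show ?thesis by (intro bexI[of _ "t + d"]) (auto simp: dist_real_def)
  qed
  then show ?thesis by (simp add: trivial_limit_within islimpt_approachable)
qed

lemma smooth_on_has_vector_derivative: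
  fixes t :: real
  assumes "smooth_on S f" "t \<in> S"
  shows "(f has_vector_derivative frechet_derivative f (at t within S) 1) (at t within S)"
proof -
  let ?D = "frechet_derivative f (at t within S)"
  have D: "(f has_derivative ?D) (at t within S)"
    using smooth_on_imp_differentiable[OF assms] by (simp add: frechet_derivative_works)
  interpret linear ?D using has_derivative_linear[OF D] .
  have "?D = (\<lambda>h. h *\<^sub>R ?D 1)"
  proof
    show "?D h = h *\<^sub>R ?D 1" for h using scale[of h 1] by simp
  qed
  then show ?thesis using D unfolding has_vector_derivative_def by metis
qed

locale curve_in_manifold = manifold A
  for A :: "'a::{t2_space,second_countable_topology} chart set" +
  fixes I :: "real set" and C :: "real \<Rightarrow> 'a"
  assumes curve: "smooth_curve A I C"
begin

abbreviation vel :: "real \<Rightarrow> 'a tvec" where "vel \<equiv> velocity A I C"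

lemma unique_deriv_I: "unique_deriv_set I"
  using curve unfolding smooth_curve_def by (simp add: unique_deriv_set_interval)

lemma param_deriv_eqI:
  "t \<in> I \<Longrightarrow> (f has_vector_derivative f') (at t within I) \<Longrightarrow> param_deriv I f t = f'"
  unfolding param_deriv_def
  using vector_derivative_within at_within_unique_deriv_set[OF unique_deriv_I] by blast

text \<open>Relatively open subsets of the interval are cut out by open sets, so derivatives within them agree
with derivatives within the interval, including the one-sided ones at endpoints.\<close>

lemma preimage_open:
  assumes "open U"
  obtains T where "open T" "{t \<in> I. C t \<in> U} = I \<inter> T"
proof -
  have "continuous_on I C" using curve unfolding smooth_curve_def by blast
  then obtain T where "open T" "T \<inter> I = C -` U \<inter> I"
    using assms unfolding continuous_on_open_invariant by blast
  then show ?thesis using that[of T] by blast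
qed

lemma unique_deriv_preimage: "open U \<Longrightarrow> unique_deriv_set {t \<in> I. C t \<in> U}"
  using preimage_open[of U] unique_deriv_set_Int_open[OF unique_deriv_I] by metis

lemma at_within_preimage:
  assumes "open U" "t \<in> I" "C t \<in> U"
  shows "(at t within {t \<in> I. C t \<in> U}) = at t within I"
proof -
  obtain T where T: "open T" "{t \<in> I. C t \<in> U} = I \<inter> T" using preimage_open[OF assms(1)] .
  moreover have "t \<in> T" using T assms by blast
  ultimately show ?thesis using at_within_Int_open by metis
qed

lemma eventually_in_preimage:
  assumes "open U" "t \<in> I" "C t \<in> U"
  shows "\<forall>\<^sub>F s in at t within I. s \<in> I \<and> C s \<in> U"
proof -
  obtain T where T: "open T" "{t \<in> I. C t \<in> U} = I \<inter> T" using preimage_open[OF assms(1)] .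
  moreover have "t \<in> T" using T assms by blast
  ultimately show ?thesis unfolding eventually_at_topological by blast
qed

lemma has_vector_derivative_near:
  assumes "(f has_vector_derivative f') (at t within I)" "open U" "t \<in> I" "C t \<in> U"
    "\<And>s. s \<in> I \<Longrightarrow> C s \<in> U \<Longrightarrow> f s = g s"
  shows "(g has_vector_derivative f') (at t within I)"
proof -
  have "\<forall>\<^sub>F s in at t within I. f s = g s"
    using eventually_in_preimage[OF assms(2-4)] by eventually_elim (use assms(5) in blast)
  then show ?thesis
    using assms(1) has_derivative_transform_eventually[of f _ t I g] assms(3-5)
    unfolding has_vector_derivative_def by blast
qed

lemma smooth_on_I_local:
  assumes "\<And>c. c \<in> A \<Longrightarrow> smooth_on {t \<in> I. C t \<in> chart_dom c} f"
  shows "smooth_on I f"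
proof (rule smooth_on_local)
  fix t assume t: "t \<in> I"
  obtain c where c: "c \<in> A" "C t \<in> chart_dom c" by (rule chart_at)
  obtain T where T: "open T" "{t \<in> I. C t \<in> chart_dom c} = I \<inter> T"
    using preimage_open[OF open_chart_dom[OF c(1)]] .
  then show "\<exists>T. open T \<and> t \<in> T \<and> smooth_on (I \<inter> T) f"
    using assms[OF c(1)] c t by (intro exI[of _ T]) auto
qed

lemma smooth_on_I_preimage:
  assumes "smooth_on I f" "open U"
  shows "smooth_on {t \<in> I. C t \<in> U} f"
  using preimage_open[OF assms(2)] smooth_on_Int_open[OF assms(1)] by metis

lemma smooth_on_preimage_local:
  assumes U: "open U"
    and "\<And>c. c \<in> A \<Longrightarrow> smooth_on {t \<in> I. C t \<in> chart_dom c \<inter> U} f"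
  shows "smooth_on {t \<in> I. C t \<in> U} f"
proof (rule smooth_on_local)
  fix t assume t: "t \<in> {t \<in> I. C t \<in> U}"
  obtain c where c: "c \<in> A" "C t \<in> chart_dom c" by (rule chart_at)
  obtain T where T: "open T" "{t \<in> I. C t \<in> chart_dom c} = I \<inter> T"
    using preimage_open[OF open_chart_dom[OF c(1)]] .
  then have "{t \<in> I. C t \<in> U} \<inter> T = {t \<in> I. C t \<in> chart_dom c \<inter> U}" by blast
  then show "\<exists>T. open T \<and> t \<in> T \<and> smooth_on ({t \<in> I. C t \<in> U} \<inter> T) f"
    using assms(2)[OF c(1)] c t T by (intro exI[of _ T]) auto
qed

lemma curve_coords_smooth:
  "c \<in> A \<Longrightarrow> smooth_on {t \<in> I. C t \<in> chart_dom c} (\<lambda>t. coords c (C t))"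
  using curve unfolding smooth_curve_def by blast

lemma has_param_deriv:
  assumes "smooth_on {t \<in> I. C t \<in> U} f" "open U" "t \<in> I" "C t \<in> U"
  shows "(f has_vector_derivative param_deriv I f t) (at t within I)"
proof -
  have "(f has_vector_derivative frechet_derivative f (at t within {t \<in> I. C t \<in> U}) 1) (at t within I)"
    using smooth_on_has_vector_derivative[OF assms(1), of t] at_within_preimage[OF assms(2-4)] assms(3,4)
    by simp
  from this param_deriv_eqI[OF assms(3) this] show ?thesis by simp
qed

lemma param_deriv_smooth:
  assumes "smooth_on {t \<in> I. C t \<in> U} f" "open U"
  shows "smooth_on {t \<in> I. C t \<in> U} (param_deriv I f)"
proof (rule smooth_on_cong[OF smooth_on_frechet_derivative[OF assms(1), of 1]])
  fix t assume t: "t \<in> {t \<in> I. C t \<in> U}"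
  then have "(f has_vector_derivative frechet_derivative f (at t within {t \<in> I. C t \<in> U}) 1) (at t within I)"
    using smooth_on_has_vector_derivative[OF assms(1), of t] at_within_preimage[OF assms(2), of t] by simp
  then show "frechet_derivative f (at t within {t \<in> I. C t \<in> U}) 1 = param_deriv I f t"
    by (intro param_deriv_eqI[symmetric]) (use t in simp)
qed

lemma has_param_deriv_I:
  "smooth_on I f \<Longrightarrow> t \<in> I \<Longrightarrow> (f has_vector_derivative param_deriv I f t) (at t within I)"
  using has_param_deriv[of UNIV] by simp

lemma param_deriv_smooth_I: "smooth_on I f \<Longrightarrow> smooth_on I (param_deriv I f)"
  using param_deriv_smooth[of UNIV] by simp

lemma velocity_has_vector_derivative:
  assumes "t \<in> I" "c \<in> A" "C t \<in> chart_dom c"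
  shows "((\<lambda>s. coords c (C s)) has_vector_derivative vel t c) (at t within I)"
  using has_param_deriv[OF curve_coords_smooth open_chart_dom] assms by (simp add: velocity_def)

lemma velocity_tangent:
  assumes t: "t \<in> I"
  shows "vel t \<in> tangent_space A (C t)"
proof -
  have "vel t d = jacobian c d (C t) (vel t c)"
    if cd: "c \<in> A" "d \<in> A" "C t \<in> chart_dom c" "C t \<in> chart_dom d" for c d
  proof -
    have "((\<lambda>s. coords d (chart_inv c (coords c (C s)))) has_vector_derivative
        jacobian c d (C t) (vel t c)) (at t within I)"
      using vector_derivative_diff_chain_within[OF velocity_has_vector_derivative[OF t cd(1,3)]
          has_derivative_at_withinI[OF jacobian_has_derivative[OF cd]]] by (simp add: o_def)
    then have "((\<lambda>s. coords d (C s)) has_vector_derivative jacobian c d (C t) (vel t c)) (at t within I)"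
      by (rule has_vector_derivative_near[OF _ open_chart_dom[OF cd(1)] t cd(3)]) (use cd(1) in simp)
    from param_deriv_eqI[OF t this] show ?thesis
      using cd by (simp add: velocity_def)
  qed
  moreover have "vel t c = 0" if "\<not> (c \<in> A \<and> C t \<in> chart_dom c)" for c
    using that unfolding velocity_def by argo
  ultimately show ?thesis unfolding tangent_space_def by blast
qed

lemma velocity_smooth: "smooth_field_along A I C vel"
  unfolding smooth_field_along_def
proof (intro conjI ballI)
  fix c assume c: "c \<in> A"
  show "smooth_on {t \<in> I. C t \<in> chart_dom c} (\<lambda>t. vel t c)"
    by (rule smooth_on_cong[OF param_deriv_smooth[OF curve_coords_smooth[OF c] open_chart_dom[OF c]]])
      (use c in \<open>simp add: velocity_def\<close>)
qed (rule velocity_tangent)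

lemma vector_field_along_smooth:
  assumes X: "smooth_vector_field A U X" and U: "open U" and d: "d \<in> A"
  shows "smooth_on {t \<in> I. C t \<in> chart_dom d \<inter> U} (\<lambda>t. X (C t) d)"
proof (rule smooth_on_cong)
  have o: "open (chart_dom d \<inter> U)" using U open_chart_dom[OF d] by blast
  obtain T where T: "open T" "{t \<in> I. C t \<in> U} = I \<inter> T" using preimage_open[OF U] .
  then have "{t \<in> I. C t \<in> chart_dom d \<inter> U} = {t \<in> I. C t \<in> chart_dom d} \<inter> T" by blast
  then have "smooth_on {t \<in> I. C t \<in> chart_dom d \<inter> U} (\<lambda>t. coords d (C t))"
    using smooth_on_Int_open[OF curve_coords_smooth[OF d] T(1)] by simp
  then show "smooth_on {t \<in> I. C t \<in> chart_dom d \<inter> U} (\<lambda>t. X (chart_inv d (coords d (C t))) d)"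
    by (intro smooth_on_compose[OF unique_deriv_preimage[OF o] open_coords_image[OF d U] _ _
          smooth_vector_field_in_chart[OF X U d]]) blast+
qed (use d in simp)

lemma function_along_smooth:
  assumes f: "smooth_function A U f" and U: "open U"
  shows "smooth_on {t \<in> I. C t \<in> U} (\<lambda>t. f (C t))"
proof (rule smooth_on_preimage_local[OF U], rule smooth_on_cong)
  fix d assume d: "d \<in> A"
  have o: "open (chart_dom d \<inter> U)" using U open_chart_dom[OF d] by blast
  obtain T where T: "open T" "{t \<in> I. C t \<in> U} = I \<inter> T" using preimage_open[OF U] .
  then have "{t \<in> I. C t \<in> chart_dom d \<inter> U} = {t \<in> I. C t \<in> chart_dom d} \<inter> T" by blast
  then have "smooth_on {t \<in> I. C t \<in> chart_dom d \<inter> U} (\<lambda>t. coords d (C t))"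
    using smooth_on_Int_open[OF curve_coords_smooth[OF d] T(1)] by simp
  then show "smooth_on {t \<in> I. C t \<in> chart_dom d \<inter> U} (\<lambda>t. f (chart_inv d (coords d (C t))))"
    by (intro smooth_on_compose[OF unique_deriv_preimage[OF o] open_coords_image[OF d U] _ _
          smooth_function_in_chart[OF f U d]]) blast+
qed simp

text \<open>The directional derivative is computed in an arbitrarily chosen chart around the point; the chain
rule is applied in that very chart.\<close>

lemma function_along_derivative:
  assumes f: "smooth_function A U f" and U: "open U" and t: "t \<in> I" "C t \<in> U"
  shows "((\<lambda>s. f (C s)) has_vector_derivative dir_deriv A (C t) (vel t) f) (at t within I)"
proof -
  define c where "c = (SOME c. c \<in> A \<and> C t \<in> chart_dom c)"
  have c: "c \<in> A" "C t \<in> chart_dom c"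
    using chart_at[of "C t"] someI_ex[of "\<lambda>c. c \<in> A \<and> C t \<in> chart_dom c"] unfolding c_def by blast+
  let ?S = "coords c ` (chart_dom c \<inter> U)"
  have S: "open ?S" "coords c (C t) \<in> ?S" using open_coords_image[OF c(1) U] c t by blast+
  have "((\<lambda>x. f (chart_inv c x)) has_derivative
      frechet_derivative (\<lambda>x. f (chart_inv c x)) (at (coords c (C t)))) (at (coords c (C t)))"
    using smooth_on_imp_differentiable[OF smooth_function_in_chart[OF f U c(1)] S(2)]
      at_within_open[OF S(2,1)] by (simp add: frechet_derivative_works)
  from vector_derivative_diff_chain_within[OF velocity_has_vector_derivative[OF t(1) c] has_derivative_at_withinI[OF this]]
  have "((\<lambda>s. f (chart_inv c (coords c (C s)))) has_vector_derivative
      dir_deriv A (C t) (vel t) f) (at t within I)"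
    by (simp add: o_def dir_deriv_def Let_def c_def)
  then show ?thesis
    by (rule has_vector_derivative_near[OF _ open_chart_dom[OF c(1)] t(1) c(2)]) (use c(1) in simp)
qed

lemma field_tangent: "smooth_field_along A I C V \<Longrightarrow> t \<in> I \<Longrightarrow> V t \<in> tangent_space A (C t)"
  unfolding smooth_field_along_def by blast

lemma field_smooth:
  "smooth_field_along A I C V \<Longrightarrow> c \<in> A \<Longrightarrow> smooth_on {t \<in> I. C t \<in> chart_dom c} (\<lambda>t. V t c)"
  unfolding smooth_field_along_def by blast

lemma field_component_smooth:
  assumes "smooth_field_along A I C V" "c \<in> A"
  shows "smooth_on {t \<in> I. C t \<in> chart_dom c} (\<lambda>t. V t c $ i)"
  by (rule smooth_on_linear[OF bounded_linear_vec_nth unique_deriv_preimage[OF open_chart_dom]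
        field_smooth]) (use assms in auto)

lemma field_derivative:
  assumes "smooth_field_along A I C V" "c \<in> A" "t \<in> I" "C t \<in> chart_dom c"
  shows "((\<lambda>s. V s c) has_vector_derivative param_deriv I (\<lambda>s. V s c) t) (at t within I)"
  using has_param_deriv[OF field_smooth open_chart_dom] assms by blast

lemma field_component_derivative:
  assumes "smooth_field_along A I C V" "c \<in> A" "t \<in> I" "C t \<in> chart_dom c"
  shows "((\<lambda>s. V s c $ i) has_vector_derivative param_deriv I (\<lambda>s. V s c) t $ i) (at t within I)"
  using bounded_linear.has_vector_derivative[OF bounded_linear_vec_nth field_derivative[OF assms]] .

lemma field_along_scaleR:
  assumes f: "smooth_on I f" and V: "smooth_field_along A I C V"
  shows "smooth_field_along A I C (\<lambda>t. f t *\<^sub>R V t)"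
proof -
  have "smooth_on {t \<in> I. C t \<in> chart_dom c} (\<lambda>t. (f t *\<^sub>R V t) c)" if "c \<in> A" for c
    unfolding scaleR_tvec_apply
    by (intro smooth_on_scaleR unique_deriv_preimage smooth_on_I_preimage[OF f] field_smooth[OF V]
        open_chart_dom that)
  then show ?thesis
    unfolding smooth_field_along_def using tangent_scaleR field_tangent[OF V] by blast
qed

lemma field_along_add:
  assumes V: "smooth_field_along A I C V" and W: "smooth_field_along A I C W"
  shows "smooth_field_along A I C (\<lambda>t. V t + W t)"
proof -
  have "smooth_on {t \<in> I. C t \<in> chart_dom c} (\<lambda>t. (V t + W t) c)" if "c \<in> A" for c
    unfolding plus_fun_apply
    by (intro smooth_on_add unique_deriv_preimage field_smooth[OF V] field_smooth[OF W]
        open_chart_dom that)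
  then show ?thesis
    unfolding smooth_field_along_def using tangent_add field_tangent[OF V] field_tangent[OF W] by blast
qed

lemma field_along_cong:
  assumes "smooth_field_along A I C V" "\<And>t. t \<in> I \<Longrightarrow> V t = W t"
  shows "smooth_field_along A I C W"
  unfolding smooth_field_along_def
proof (intro conjI ballI)
  show "W t \<in> tangent_space A (C t)" if "t \<in> I" for t
    using field_tangent[OF assms(1) that] assms(2)[OF that] by simp
  show "smooth_on {t \<in> I. C t \<in> chart_dom c} (\<lambda>t. W t c)" if "c \<in> A" for c
    by (rule smooth_on_cong[OF field_smooth[OF assms(1) that]]) (simp add: assms(2))
qed

lemma vector_field_along:
  assumes "smooth_vector_field A UNIV X"
  shows "smooth_field_along A I C (\<lambda>t. X (C t))"
  unfolding smooth_field_along_def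
  using vector_field_along_smooth[OF assms] assms unfolding smooth_vector_field_def by simp

text \<open>The vector fields need not be coordinate fields: for \<open>\<phi> V\<close> they are the images of the coordinate
fields under \<open>\<phi>\<close>.\<close>

lemma smooth_field_alongI:
  assumes T: "\<And>t. t \<in> I \<Longrightarrow> V t \<in> tangent_space A (C t)"
    and V: "\<And>c t. c \<in> A \<Longrightarrow> t \<in> I \<Longrightarrow> C t \<in> chart_dom c \<Longrightarrow>
      V t = (\<Sum>i\<in>UNIV. f c i t *\<^sub>R X c i (C t))"
    and f: "\<And>c i. c \<in> A \<Longrightarrow> smooth_on {t \<in> I. C t \<in> chart_dom c} (f c (i::3))"
    and X: "\<And>c i. c \<in> A \<Longrightarrow> smooth_vector_field A (chart_dom c) (X c i)"
  shows "smooth_field_along A I C V"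
  unfolding smooth_field_along_def
proof (intro conjI ballI T)
  fix c assume c: "c \<in> A"
  note o = open_chart_dom[OF c]
  note u = unique_deriv_preimage[OF o]
  have "smooth_on {t \<in> I. C t \<in> chart_dom c} (\<lambda>t. \<Sum>i\<in>UNIV. f c i t *\<^sub>R X c i (C t) c)"
    using vector_field_along_smooth[OF X[OF c] o c]
    by (intro smooth_on_sum[OF u] smooth_on_scaleR[OF u] f c) simp_all
  then show "smooth_on {t \<in> I. C t \<in> chart_dom c} (\<lambda>t. V t c)"
    by (rule smooth_on_cong) (simp add: V[OF c] sum_tvec_apply scaleR_tvec_apply)
qed

lemma field_expand:
  assumes "smooth_field_along A I C V" "c \<in> A" "t \<in> I" "C t \<in> chart_dom c"
  shows "V t = (\<Sum>i\<in>UNIV. (V t c $ i) *\<^sub>R coord_field A c i (C t))"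
  using tangent_expand[OF field_tangent] assms by blast

end

section \<open>The covariant derivative along a curve\<close>

locale curve_with_connection = curve_in_manifold A I C
  for A :: "'a::{t2_space,second_countable_topology} chart set" and I C +
  fixes nabla :: "'a connection"
  assumes connection: "affine_connection A nabla"
begin

abbreviation D :: "(real \<Rightarrow> 'a tvec) \<Rightarrow> real \<Rightarrow> 'a tvec"
  where "D \<equiv> cov_deriv_along A nabla I C"

lemma
  assumes "smooth_vector_field A U Y" "open U" "p \<in> U" "v \<in> tangent_space A p"
  shows nabla_tangent: "nabla p v Y \<in> tangent_space A p"
    and nabla_add: "smooth_vector_field A U Z \<Longrightarrow>
      nabla p v (\<lambda>q. Y q + Z q) = nabla p v Y + nabla p v Z"
    and nabla_scaleR: "smooth_function A U f \<Longrightarrow>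
      nabla p v (\<lambda>q. f q *\<^sub>R Y q) = dir_deriv A p v f *\<^sub>R Y p + f p *\<^sub>R nabla p v Y"
    and nabla_cong: "(\<And>q. q \<in> U \<Longrightarrow> Z q = Y q) \<Longrightarrow> nabla p v Z = nabla p v Y"
proof -
  have "open U \<and> p \<in> U \<and> smooth_vector_field A U Y" using assms by simp
  note * = connection[unfolded affine_connection_def, THEN conjunct1, THEN spec, THEN spec, THEN spec,
      THEN mp, OF this]
  show "nabla p v Y \<in> tangent_space A p"
    using *[THEN conjunct1] assms(4) by blast
  show "nabla p v (\<lambda>q. Y q + Z q) = nabla p v Y + nabla p v Z" if "smooth_vector_field A U Z"
    using *[THEN conjunct2, THEN conjunct2, THEN conjunct1] assms(4) that by blast
  show "nabla p v (\<lambda>q. f q *\<^sub>R Y q) = dir_deriv A p v f *\<^sub>R Y p + f p *\<^sub>R nabla p v Y"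
    if "smooth_function A U f"
    using *[THEN conjunct2, THEN conjunct2, THEN conjunct2, THEN conjunct1] assms(4) that by blast
  show "nabla p v Z = nabla p v Y" if "\<And>q. q \<in> U \<Longrightarrow> Z q = Y q"
    using *[THEN conjunct2, THEN conjunct2, THEN conjunct2, THEN conjunct2] assms(4) that by blast
qed

text \<open>The coordinate formula for the covariant derivative: first localize the field to the chart domain,
where it is a combination of coordinate fields, then use additivity and the Leibniz rule.\<close>

lemma nabla_expand:
  assumes X: "smooth_vector_field A U X" and U: "open U" and p: "p \<in> U"
    and c: "c \<in> A" "p \<in> chart_dom c" and v: "v \<in> tangent_space A p"
  shows "nabla p v X = (\<Sum>i\<in>UNIV. dir_deriv A p v (\<lambda>q. X q c $ i) *\<^sub>R coord_field A c i p
    + (X p c $ i) *\<^sub>R nabla p v (coord_field A c i))"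
proof -
  let ?E = "coord_field A c" and ?x = "\<lambda>i q. X q c $ i"
  define V where "V = U \<inter> chart_dom c"
  have V: "open V" "p \<in> V" "V \<subseteq> chart_dom c" using U p c open_chart_dom[OF c(1)] by (auto simp: V_def)
  have XV: "smooth_vector_field A V X"
    using smooth_vector_field_subset[OF X U V(1)] by (simp add: V_def)
  note E = coord_field_smooth[OF c(1) V(1,3)] and x = component_smooth[OF XV c(1) V(1,3)]
  note xE = smooth_vector_field_scaleR[OF x E V(1)]
  have "X q = ?x 1 q *\<^sub>R ?E 1 q + ?x 2 q *\<^sub>R ?E 2 q + ?x 3 q *\<^sub>R ?E 3 q" if "q \<in> V" for q
    using tangent_expand[of "X q" q c] XV that V(3) c(1) unfolding smooth_vector_field_def sum_3 by blast
  then have "nabla p v X = nabla p v (\<lambda>q. ?x 1 q *\<^sub>R ?E 1 q + ?x 2 q *\<^sub>R ?E 2 q + ?x 3 q *\<^sub>R ?E 3 q)"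
    by (intro nabla_cong[OF _ V(1,2) v] smooth_vector_field_add xE V(1))
  also have "\<dots> = nabla p v (\<lambda>q. ?x 1 q *\<^sub>R ?E 1 q) + nabla p v (\<lambda>q. ?x 2 q *\<^sub>R ?E 2 q)
      + nabla p v (\<lambda>q. ?x 3 q *\<^sub>R ?E 3 q)"
    by (simp add: nabla_add[OF _ V(1,2) v] smooth_vector_field_add xE V(1))
  also have "\<dots> = (\<Sum>i\<in>UNIV. dir_deriv A p v (?x i) *\<^sub>R ?E i p + ?x i p *\<^sub>R nabla p v (?E i))"
    unfolding sum_3 by (simp only: nabla_scaleR[OF E V(1,2) v x])
  finally show ?thesis .
qed

lemma cov_deriv_outside: "\<not> (c \<in> A \<and> C t \<in> chart_dom c) \<Longrightarrow> D V t c = 0"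
  unfolding cov_deriv_along_def by argo

text \<open>The vector fields \<open>X\<^sub>i\<close> and the set \<open>U\<close> are unrelated to the chart in which the left-hand side is
evaluated. With coordinate fields for \<open>X\<^sub>i\<close> this shows that the covariant derivative along the
curve is a tangent vector, the same in all charts; with \<open>\<phi>\<close> of coordinate fields it computes the
derivative of \<open>\<phi> V\<close>.\<close>

lemma cov_deriv_combination:
  fixes X :: "3 \<Rightarrow> 'a \<Rightarrow> 'a tvec"
  assumes t: "t \<in> I" and U: "open U" "C t \<in> U"
    and X: "\<And>i. smooth_vector_field A U (X i)"
    and f: "\<And>i. (f i has_vector_derivative f' i) (at t within I)"
    and V: "\<And>s. s \<in> I \<Longrightarrow> C s \<in> U \<Longrightarrow> V s = (\<Sum>i\<in>UNIV. f i s *\<^sub>R X i (C s))"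
  shows "D V t = (\<Sum>i\<in>UNIV. f' i *\<^sub>R X i (C t) + f i t *\<^sub>R nabla (C t) (vel t) (X i))"
    (is "_ = ?R")
proof
  fix c
  note v = velocity_tangent[OF t]
  have XT: "X i (C t) \<in> tangent_space A (C t)" for i
    using X U(2) unfolding smooth_vector_field_def by blast
  have R: "?R \<in> tangent_space A (C t)"
    by (intro tangent_intros XT nabla_tangent[OF X U v])
  show "D V t c = ?R c"
  proof (cases "c \<in> A \<and> C t \<in> chart_dom c")
    case False
    then show ?thesis using tangent_outside[OF R False] cov_deriv_outside by simp
  next
    case True
    then have c: "c \<in> A" "C t \<in> chart_dom c" by auto
    let ?E = "coord_field A c" and ?n = "nabla (C t) (vel t)"
    define V' where "V' = U \<inter> chart_dom c"
    have V': "open V'" "C t \<in> V'" "V' \<subseteq> chart_dom c" "V' \<subseteq> U"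
      using U c open_chart_dom[OF c(1)] by (auto simp: V'_def)
    have XV: "smooth_vector_field A V' (X i)" for i
      using smooth_vector_field_subset[OF X U(1) V'(1,4)] .
    define x' where "x' i = (\<Sum>j\<in>UNIV. dir_deriv A (C t) (vel t) (\<lambda>q. X i q c $ j) *\<^sub>R axis j 1 :: real^3)" for i
    have "((\<lambda>s. \<Sum>j\<in>UNIV. (X i (C s) c $ j) *\<^sub>R axis j 1) has_vector_derivative x' i) (at t within I)" for i
      unfolding x'_def
      by (intro has_vector_derivative_sum bounded_linear.has_vector_derivative[OF bounded_linear_scaleR_left]
          function_along_derivative[OF component_smooth[OF XV c(1) V'(1,3)] V'(1) t V'(2)])
    then have x: "((\<lambda>s. X i (C s) c) has_vector_derivative x' i) (at t within I)" for i
      by (simp only: vec_sum_axis)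
    have "((\<lambda>s. \<Sum>i\<in>UNIV. f i s *\<^sub>R X i (C s) c) has_vector_derivative
        (\<Sum>i\<in>UNIV. f i t *\<^sub>R x' i + f' i *\<^sub>R X i (C t) c)) (at t within I)"
      by (intro has_vector_derivative_sum has_vector_derivative_scaleR[OF _ x]) 
        (use f in \<open>simp add: has_real_derivative_iff_has_vector_derivative\<close>)
    then have "((\<lambda>s. V s c) has_vector_derivative
        (\<Sum>i\<in>UNIV. f i t *\<^sub>R x' i + f' i *\<^sub>R X i (C t) c)) (at t within I)"
      by (rule has_vector_derivative_near[OF _ U(1) t U(2)])
        (simp add: V sum_tvec_apply scaleR_tvec_apply)
    from param_deriv_eqI[OF t this]
    have "D V t c = (\<Sum>i\<in>UNIV. f i t *\<^sub>R x' i + f' i *\<^sub>R X i (C t) c)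
        + (\<Sum>j\<in>UNIV. (V t c $ j) *\<^sub>R ?n (?E j) c)"
      using c by (simp add: cov_deriv_along_def)
    also have "(\<Sum>j\<in>UNIV. (V t c $ j) *\<^sub>R ?n (?E j) c)
        = (\<Sum>i\<in>UNIV. f i t *\<^sub>R (\<Sum>j\<in>UNIV. (X i (C t) c $ j) *\<^sub>R ?n (?E j) c))"
      using V[OF t U(2)]
      by (simp add: sum_tvec_apply scaleR_tvec_apply sum_3 algebra_simps)
    also have "(\<Sum>i\<in>UNIV. f i t *\<^sub>R x' i + f' i *\<^sub>R X i (C t) c) + \<dots> = ?R c"
    proof -
      have "?n (X i) c = x' i + (\<Sum>j\<in>UNIV. (X i (C t) c $ j) *\<^sub>R ?n (?E j) c)" for i
        using nabla_expand[OF XV V'(1,2) c v, of i] c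
        by (simp add: x'_def sum_tvec_apply scaleR_tvec_apply coord_field_self sum.distrib)
      then show ?thesis
        by (simp add: sum_tvec_apply scaleR_tvec_apply sum.distrib scaleR_add_right algebra_simps)
    qed
    finally show ?thesis .
  qed
qed

text \<open>Unlike the definition, this is an equation between tangent vectors: the chart \<open>c\<close> is fixed, while
both sides can be evaluated in every other chart.\<close>

lemma cov_deriv_expand:
  assumes V: "smooth_field_along A I C V" and c: "c \<in> A" and t: "t \<in> I" "C t \<in> chart_dom c"
  shows "D V t = (\<Sum>i\<in>UNIV. (param_deriv I (\<lambda>s. V s c) t $ i) *\<^sub>R coord_field A c i (C t)
    + (V t c $ i) *\<^sub>R nabla (C t) (vel t) (coord_field A c i))"
  by (rule cov_deriv_combination[OF t(1) open_chart_dom[OF c] t(2)])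
    (use field_expand[OF V c] field_component_derivative[OF V c t]
      coord_field_smooth[OF c open_chart_dom[OF c]] in auto)

lemma cov_deriv_tangent:
  assumes V: "smooth_field_along A I C V" and t: "t \<in> I"
  shows "D V t \<in> tangent_space A (C t)"
proof -
  obtain c where c: "c \<in> A" "C t \<in> chart_dom c" by (rule chart_at)
  note E = coord_field_smooth[OF c(1) open_chart_dom[OF c(1)] order_refl]
  show ?thesis
    unfolding cov_deriv_expand[OF V c(1) t c(2)]
    by (intro tangent_intros coord_field_tangent c
        nabla_tangent[OF E open_chart_dom[OF c(1)] c(2) velocity_tangent[OF t]])
qed

lemma cov_deriv_add:
  assumes V: "smooth_field_along A I C V" and W: "smooth_field_along A I C W" and t: "t \<in> I"
  shows "D (\<lambda>s. V s + W s) t = D V t + D W t"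
proof
  fix c
  show "D (\<lambda>s. V s + W s) t c = (D V t + D W t) c"
  proof (cases "c \<in> A \<and> C t \<in> chart_dom c")
    case True
    then have "param_deriv I (\<lambda>s. (V s + W s) c) t = param_deriv I (\<lambda>s. V s c) t + param_deriv I (\<lambda>s. W s c) t"
      using param_deriv_eqI[OF t has_vector_derivative_add[OF field_derivative[OF V _ t]
          field_derivative[OF W _ t]]] by simp
    then show ?thesis using True by (simp add: cov_deriv_along_def scaleR_add_left sum.distrib)
  qed (simp add: cov_deriv_outside)
qed

lemma cov_deriv_scaleR:
  assumes V: "smooth_field_along A I C V" and t: "t \<in> I"
    and f: "(f has_vector_derivative f') (at t within I)"
  shows "D (\<lambda>s. f s *\<^sub>R V s) t = f' *\<^sub>R V t + f t *\<^sub>R D V t"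
proof
  fix c
  show "D (\<lambda>s. f s *\<^sub>R V s) t c = (f' *\<^sub>R V t + f t *\<^sub>R D V t) c"
  proof (cases "c \<in> A \<and> C t \<in> chart_dom c")
    case True
    then have "((\<lambda>s. f s *\<^sub>R V s c) has_vector_derivative
        (f t *\<^sub>R param_deriv I (\<lambda>s. V s c) t + f' *\<^sub>R V t c)) (at t within I)"
      using has_vector_derivative_scaleR[OF _ field_derivative[OF V _ t]] f
      by (simp add: has_real_derivative_iff_has_vector_derivative)
    from param_deriv_eqI[OF t this]
    have "param_deriv I (\<lambda>s. (f s *\<^sub>R V s) c) t = f t *\<^sub>R param_deriv I (\<lambda>s. V s c) t + f' *\<^sub>R V t c"
      by (simp add: scaleR_tvec_apply)
    then show ?thesis using True
      by (simp add: cov_deriv_along_def scaleR_tvec_apply scaleR_add_right scaleR_sum_right)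
  next
    case False
    then show ?thesis using tangent_outside[OF field_tangent[OF V t] False]
      by (simp add: cov_deriv_outside scaleR_tvec_apply)
  qed
qed

lemma cov_deriv_cong:
  assumes "\<And>s. s \<in> I \<Longrightarrow> V s = W s" "t \<in> I"
  shows "D V t = D W t"
proof
  fix c
  have "((\<lambda>s. V s c) has_vector_derivative x) (at t within I) \<longleftrightarrow>
      ((\<lambda>s. W s c) has_vector_derivative x) (at t within I)" for x
    using has_vector_derivative_transform[of t I "\<lambda>s. V s c" "\<lambda>s. W s c"]
      has_vector_derivative_transform[of t I "\<lambda>s. W s c" "\<lambda>s. V s c"] assms by auto
  then have "param_deriv I (\<lambda>s. V s c) t = param_deriv I (\<lambda>s. W s c) t"
    by (simp add: param_deriv_def vector_derivative_def)
  then show "D V t c = D W t c" using assms by (simp add: cov_deriv_along_def)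
qed

end

section \<open>Compatibility with the metric\<close>

locale pseudo_riemannian_curve = curve_with_connection A I C nabla
  for A :: "'a::{t2_space,second_countable_topology} chart set" and I C nabla +
  fixes g :: "'a \<Rightarrow> 'a tvec \<Rightarrow> 'a tvec \<Rightarrow> real"
  assumes metric: "pseudo_riemannian_metric A g"
    and levi_civita: "levi_civita A g nabla"
begin

lemmas metric_conjuncts = metric[unfolded pseudo_riemannian_metric_def]

lemma g_sym: "u \<in> tangent_space A p \<Longrightarrow> v \<in> tangent_space A p \<Longrightarrow> g p u v = g p v u"
  using metric_conjuncts[THEN conjunct1] by blast

lemma g_add_left:
  assumes "u \<in> tangent_space A p" "v \<in> tangent_space A p" "w \<in> tangent_space A p"
  shows "g p (u + v) w = g p u w + g p v w"
  using metric_conjuncts[THEN conjunct2, THEN conjunct1] assms by blast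

lemma g_scaleR_left:
  assumes "u \<in> tangent_space A p" "w \<in> tangent_space A p"
  shows "g p (r *\<^sub>R u) w = r * g p u w"
  using metric_conjuncts[THEN conjunct2, THEN conjunct1] assms by blast

lemma g_add_right:
  assumes "u \<in> tangent_space A p" "v \<in> tangent_space A p" "w \<in> tangent_space A p"
  shows "g p w (u + v) = g p w u + g p w v"
  using g_add_left[OF assms] g_sym[OF assms(1,3)] g_sym[OF assms(2,3)]
    g_sym[OF tangent_add[OF assms(1,2)] assms(3)] by simp

lemma g_scaleR_right:
  assumes "u \<in> tangent_space A p" "w \<in> tangent_space A p"
  shows "g p w (r *\<^sub>R u) = r * g p w u"
  using g_scaleR_left[OF assms] g_sym[OF assms] g_sym[OF tangent_scaleR[OF assms(1)] assms(2)] by simp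

lemma g_diff_left:
  assumes "u \<in> tangent_space A p" "v \<in> tangent_space A p" "w \<in> tangent_space A p"
  shows "g p (u - v) w = g p u w - g p v w"
  using g_add_left[OF assms(1) tangent_scaleR[OF assms(2), of "-1"] assms(3)]
    g_scaleR_left[OF assms(2,3), of "-1"] by simp

lemma g_diff_right:
  assumes "u \<in> tangent_space A p" "v \<in> tangent_space A p" "w \<in> tangent_space A p"
  shows "g p w (u - v) = g p w u - g p w v"
  using g_add_right[OF assms(1) tangent_scaleR[OF assms(2), of "-1"] assms(3)]
    g_scaleR_right[OF assms(2,3), of "-1"] by simp

lemma g_zero_left: "w \<in> tangent_space A p \<Longrightarrow> g p 0 w = 0"
  using g_scaleR_left[of 0 p w 0] tangent_zero by simp

lemma g_zero_right: "w \<in> tangent_space A p \<Longrightarrow> g p w 0 = 0"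
  using g_zero_left g_sym tangent_zero by metis

lemma g_sum_left:
  assumes "finite J" "\<And>i. x i \<in> tangent_space A p" "w \<in> tangent_space A p"
  shows "g p (\<Sum>i\<in>J. x i) w = (\<Sum>i\<in>J. g p (x i) w)"
  using assms(1)
proof (induction J rule: finite_induct)
  case empty
  show ?case using g_zero_left[OF assms(3)] by (simp only: sum.empty)
next
  case (insert i J)
  have "sum x J \<in> tangent_space A p" using assms(2) by (rule tangent_sum)
  then show ?case
    by (simp only: sum.insert[OF insert.hyps] g_add_left[OF assms(2) _ assms(3)] insert.IH)
qed

lemma g_sum_right:
  assumes "finite J" "\<And>i. x i \<in> tangent_space A p" "w \<in> tangent_space A p"
  shows "g p w (\<Sum>i\<in>J. x i) = (\<Sum>i\<in>J. g p w (x i))"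
  unfolding g_sym[OF assms(3) tangent_sum[OF assms(2)]] g_sum_left[OF assms] g_sym[OF assms(2,3)] ..

lemma g_sum2:
  fixes x y :: "3 \<Rightarrow> 'a tvec"
  assumes "\<And>i. x i \<in> tangent_space A p" "\<And>i. y i \<in> tangent_space A p"
  shows "g p (\<Sum>i\<in>UNIV. x i) (\<Sum>j\<in>UNIV. y j) = (\<Sum>i\<in>UNIV. \<Sum>j\<in>UNIV. g p (x i) (y j))"
  unfolding g_sum_left[OF finite assms(1) tangent_sum[OF assms(2)]]
    g_sum_right[OF finite assms(2) assms(1)] ..

lemma g_nondegenerate:
  "u \<in> tangent_space A p \<Longrightarrow> (\<And>v. v \<in> tangent_space A p \<Longrightarrow> g p u v = 0) \<Longrightarrow> u = 0"
  using metric_conjuncts[THEN conjunct2, THEN conjunct2, THEN conjunct1] by blast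

lemma g_smooth:
  "open U \<Longrightarrow> smooth_vector_field A U X \<Longrightarrow> smooth_vector_field A U Y \<Longrightarrow>
    smooth_function A U (\<lambda>p. g p (X p) (Y p))"
  using metric_conjuncts[THEN conjunct2, THEN conjunct2, THEN conjunct2] by blast

lemma g_compatible:
  assumes "open U" "p \<in> U" "smooth_vector_field A U X" "smooth_vector_field A U Y"
    "v \<in> tangent_space A p"
  shows "dir_deriv A p v (\<lambda>q. g q (X q) (Y q)) = g p (nabla p v X) (Y p) + g p (X p) (nabla p v Y)"
proof -
  have "open U \<and> p \<in> U \<and> smooth_vector_field A U X \<and> smooth_vector_field A U Y" using assms by simp
  then show ?thesis
    using levi_civita[unfolded levi_civita_def, THEN conjunct2, THEN conjunct2, THEN spec, THEN spec,
        THEN spec, THEN spec, THEN mp] assms(5) by blast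
qed

lemma metric_along_expand:
  assumes V: "smooth_field_along A I C V" and W: "smooth_field_along A I C W"
    and c: "c \<in> A" and t: "t \<in> I" "C t \<in> chart_dom c"
  shows "g (C t) (V t) (W t) = (\<Sum>i\<in>UNIV. \<Sum>j\<in>UNIV. (V t c $ i * W t c $ j) *
    g (C t) (coord_field A c i (C t)) (coord_field A c j (C t)))"
proof -
  let ?E = "\<lambda>i. coord_field A c i (C t)"
  note E = coord_field_tangent[OF c t(2)]
  have "g (C t) (V t) (W t) = g (C t) (\<Sum>i\<in>UNIV. (V t c $ i) *\<^sub>R ?E i) (\<Sum>j\<in>UNIV. (W t c $ j) *\<^sub>R ?E j)"
    using field_expand[OF V c t] field_expand[OF W c t] by simp
  then show ?thesis
    unfolding g_sum2[OF tangent_scaleR[OF E] tangent_scaleR[OF E]]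
    by (simp add: g_scaleR_left g_scaleR_right E tangent_scaleR algebra_simps)
qed

lemma metric_along_smooth:
  assumes V: "smooth_field_along A I C V" and W: "smooth_field_along A I C W"
  shows "smooth_on I (\<lambda>t. g (C t) (V t) (W t))"
proof (rule smooth_on_I_local)
  fix c assume c: "c \<in> A"
  note o = open_chart_dom[OF c]
  note u = unique_deriv_preimage[OF o]
  note E = coord_field_smooth[OF c o order_refl]
  have "smooth_on {t \<in> I. C t \<in> chart_dom c} (\<lambda>t. \<Sum>i\<in>UNIV. \<Sum>j\<in>UNIV. (V t c $ i * W t c $ j) *
      g (C t) (coord_field A c i (C t)) (coord_field A c j (C t)))"
    by (intro smooth_on_sum[OF u] finite smooth_on_mult[OF u] field_component_smooth[OF V c]
        field_component_smooth[OF W c] function_along_smooth[OF g_smooth[OF o E E] o])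
  then show "smooth_on {t \<in> I. C t \<in> chart_dom c} (\<lambda>t. g (C t) (V t) (W t))"
    by (rule smooth_on_cong) (simp add: metric_along_expand[OF V W c])
qed

text \<open>Compatibility is assumed for vector fields on open sets only. Expanding both fields over coordinate
fields reduces the claim to the metric coefficients, to which it applies.\<close>

lemma metric_along_derivative:
  assumes V: "smooth_field_along A I C V" and W: "smooth_field_along A I C W" and t: "t \<in> I"
  shows "((\<lambda>s. g (C s) (V s) (W s)) has_vector_derivative
    g (C t) (D V t) (W t) + g (C t) (V t) (D W t)) (at t within I)"
proof -
  obtain c where c: "c \<in> A" "C t \<in> chart_dom c" by (rule chart_at)
  note o = open_chart_dom[OF c(1)]
  let ?E = "\<lambda>i. coord_field A c i (C t)" and ?n = "\<lambda>i. nabla (C t) (vel t) (coord_field A c i)"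
    and ?v = "\<lambda>i. V t c $ i" and ?w = "\<lambda>i. W t c $ i"
    and ?v' = "\<lambda>i. param_deriv I (\<lambda>s. V s c) t $ i" and ?w' = "\<lambda>i. param_deriv I (\<lambda>s. W s c) t $ i"
  note vel = velocity_tangent[OF t]
  note sE = coord_field_smooth[OF c(1) o order_refl]
  note E = coord_field_tangent[OF c]
  note n = nabla_tangent[OF sE o c(2) vel]
  have "((\<lambda>s. \<Sum>i\<in>UNIV. \<Sum>j\<in>UNIV. (V s c $ i * W s c $ j) *
      g (C s) (coord_field A c i (C s)) (coord_field A c j (C s))) has_vector_derivative
      (\<Sum>i\<in>UNIV. \<Sum>j\<in>UNIV. (?v i * ?w j) * (g (C t) (?n i) (?E j) + g (C t) (?E i) (?n j))
        + (?v i * ?w' j + ?v' i * ?w j) * g (C t) (?E i) (?E j))) (at t within I)"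
    unfolding g_compatible[OF o c(2) sE sE vel, symmetric]
    by (intro has_vector_derivative_sum has_vector_derivative_mult
        field_component_derivative[OF V c(1) t c(2)] field_component_derivative[OF W c(1) t c(2)]
        function_along_derivative[OF g_smooth[OF o sE sE] o t c(2)])
  then have "((\<lambda>s. g (C s) (V s) (W s)) has_vector_derivative
      (\<Sum>i\<in>UNIV. \<Sum>j\<in>UNIV. (?v i * ?w j) * (g (C t) (?n i) (?E j) + g (C t) (?E i) (?n j))
        + (?v i * ?w' j + ?v' i * ?w j) * g (C t) (?E i) (?E j))) (at t within I)"
    by (rule has_vector_derivative_near[OF _ o t c(2)]) (simp add: metric_along_expand[OF V W c(1)])
  moreover have "g (C t) (D V t) (W t) = (\<Sum>i\<in>UNIV. \<Sum>j\<in>UNIV. ?w j * (?v' i * g (C t) (?E i) (?E j)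
      + ?v i * g (C t) (?n i) (?E j)))"
    unfolding cov_deriv_expand[OF V c(1) t c(2)] field_expand[OF W c(1) t c(2), THEN arg_cong[where f="g _ _"]]
      g_sum2[OF tangent_add[OF tangent_scaleR[OF E] tangent_scaleR[OF n]] tangent_scaleR[OF E]]
    by (simp add: g_scaleR_left g_scaleR_right g_add_left E n tangent_scaleR algebra_simps)
  moreover have "g (C t) (V t) (D W t) = (\<Sum>i\<in>UNIV. \<Sum>j\<in>UNIV. ?v i * (?w' j * g (C t) (?E i) (?E j)
      + ?w j * g (C t) (?E i) (?n j)))"
    unfolding cov_deriv_expand[OF W c(1) t c(2)] field_expand[OF V c(1) t c(2), THEN arg_cong[where f="\<lambda>x. g _ x _"]]
      g_sum2[OF tangent_scaleR[OF E] tangent_add[OF tangent_scaleR[OF E] tangent_scaleR[OF n]]]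
    by (simp add: g_scaleR_left g_scaleR_right g_add_right E n tangent_scaleR algebra_simps)
  ultimately show ?thesis by (simp add: sum.distrib[symmetric] algebra_simps)
qed

text \<open>Most products of frame vectors are constant, and this is how their derivatives are exchanged.\<close>

lemma metric_along_const:
  assumes V: "smooth_field_along A I C V" and W: "smooth_field_along A I C W" and t: "t \<in> I"
    and k: "\<And>s. s \<in> I \<Longrightarrow> g (C s) (V s) (W s) = k"
  shows "g (C t) (D V t) (W t) = - g (C t) (V t) (D W t)"
proof -
  have "((\<lambda>s. g (C s) (V s) (W s)) has_vector_derivative 0) (at t within I)"
    by (rule has_vector_derivative_near[OF has_vector_derivative_const open_UNIV t])
      (use k in auto)
  from param_deriv_eqI[OF t this] param_deriv_eqI[OF t metric_along_derivative[OF V W t]]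
  show ?thesis by simp
qed

text \<open>The dual frame of \<open>x, n, w\<close> with respect to the metric is \<open>n, x, w\<close>, which gives the coefficients;
independence follows from the same products.\<close>

lemma frame_expand:
  assumes T: "x \<in> tangent_space A p" "n \<in> tangent_space A p" "w \<in> tangent_space A p"
    and g: "g p x x = 0" "g p x n = 1" "g p w w = 1" "g p n n = 0" "g p n w = 0" "g p x w = 0"
    and u: "u \<in> tangent_space A p"
  shows "u = g p u n *\<^sub>R x + g p u x *\<^sub>R n + g p u w *\<^sub>R w"
proof -
  have comb: "g p (\<alpha> *\<^sub>R x + \<beta> *\<^sub>R n + \<gamma> *\<^sub>R w) n = \<alpha>" "g p (\<alpha> *\<^sub>R x + \<beta> *\<^sub>R n + \<gamma> *\<^sub>R w) x = \<beta>"
    "g p (\<alpha> *\<^sub>R x + \<beta> *\<^sub>R n + \<gamma> *\<^sub>R w) w = \<gamma>" for \<alpha> \<beta> \<gamma>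
    using g g_sym[OF T(1,2)] g_sym[OF T(1,3)] g_sym[OF T(2,3)]
    by (simp_all add: g_add_left g_scaleR_left T tangent_add tangent_scaleR)
  have "\<alpha> = 0 \<and> \<beta> = 0 \<and> \<gamma> = 0" if "\<alpha> *\<^sub>R x + \<beta> *\<^sub>R n + \<gamma> *\<^sub>R w = 0" for \<alpha> \<beta> \<gamma>
    using comb[of \<alpha> \<beta> \<gamma>] unfolding that g_zero_left[OF T(1)] g_zero_left[OF T(2)] g_zero_left[OF T(3)]
    by simp
  then obtain \<alpha> \<beta> \<gamma> where "u = \<alpha> *\<^sub>R x + \<beta> *\<^sub>R n + \<gamma> *\<^sub>R w"
    using tangent_eq_span3[OF T _ u] by blast
  then show ?thesis using comb by simp
qed

end

section \<open>Frenet frames of null curves\<close>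

locale null_curve_in_manifold = pseudo_riemannian_curve A I C nabla g
  for A :: "'a::{t2_space,second_countable_topology} chart set" and I C nabla g +
  assumes null: "null_curve A g I C"
begin

lemma vel_null: "t \<in> I \<Longrightarrow> g (C t) (vel t) (vel t) = 0"
  and vel_nonzero: "t \<in> I \<Longrightarrow> vel t \<noteq> 0"
  using null unfolding null_curve_def by blast+

lemma cov_deriv_vel_orth: "t \<in> I \<Longrightarrow> g (C t) (D vel t) (vel t) = 0"
  using metric_along_const[OF velocity_smooth velocity_smooth, of t 0] vel_null
    g_sym[OF cov_deriv_tangent[OF velocity_smooth] velocity_tangent, of t] by simp

context
  fixes N W
  assumes frame: "frenet_frame A g I C N W"
begin

lemma frame_smooth: "smooth_field_along A I C N" "smooth_field_along A I C W"
  using frame unfolding frenet_frame_def by blast+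

lemmas frame_tangent = field_tangent[OF frame_smooth(1)] field_tangent[OF frame_smooth(2)]
  velocity_tangent

lemma frame_gram:
  assumes "t \<in> I"
  shows "g (C t) (vel t) (N t) = 1" "g (C t) (W t) (W t) = 1" "g (C t) (N t) (N t) = 0"
    "g (C t) (N t) (W t) = 0" "g (C t) (vel t) (W t) = 0"
    "g (C t) (N t) (vel t) = 1" "g (C t) (W t) (N t) = 0" "g (C t) (W t) (vel t) = 0"
  using frame assms g_sym[OF frame_tangent(1,3)] g_sym[OF frame_tangent(2,1)]
    g_sym[OF frame_tangent(2,3)] unfolding frenet_frame_def by simp_all

lemma frenet_expand:
  assumes t: "t \<in> I" and u: "u \<in> tangent_space A (C t)"
  shows "u = g (C t) u (N t) *\<^sub>R vel t + g (C t) u (vel t) *\<^sub>R N t + g (C t) u (W t) *\<^sub>R W t"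
  by (rule frame_expand[OF frame_tangent(3,1,2)[OF t] vel_null[OF t] frame_gram(1-5)[OF t] u])

text \<open>Each derivative is expanded in the frame; differentiating the constant products of frame vectors
shows that the remaining coefficients vanish or are opposite to one another.\<close>

lemma frenet_equations_hold:
  "frenet_equations A nabla I C N W (\<lambda>t. g (C t) (D vel t) (N t)) (\<lambda>t. g (C t) (D vel t) (W t))
    (\<lambda>t. g (C t) (D N t) (W t))"
  unfolding frenet_equations_def
proof (intro ballI conjI)
  fix t assume t: "t \<in> I"
  note T = cov_deriv_tangent[OF frame_smooth(1) t] cov_deriv_tangent[OF frame_smooth(2) t]
    cov_deriv_tangent[OF velocity_smooth t] frame_tangent[OF t]
  show "D vel t = g (C t) (D vel t) (N t) *\<^sub>R vel t + g (C t) (D vel t) (W t) *\<^sub>R W t"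
    using frenet_expand[OF t T(3)] cov_deriv_vel_orth[OF t] by simp
  have "g (C t) (D N t) (N t) = 0"
    using metric_along_const[OF frame_smooth(1) frame_smooth(1) t frame_gram(3)] g_sym[OF T(1,4)] by simp
  moreover have "g (C t) (D N t) (vel t) = - g (C t) (D vel t) (N t)"
    using metric_along_const[OF frame_smooth(1) velocity_smooth t frame_gram(6)] g_sym[OF T(3,4)] by simp
  ultimately show "D N t = - g (C t) (D vel t) (N t) *\<^sub>R N t + g (C t) (D N t) (W t) *\<^sub>R W t"
    using frenet_expand[OF t T(1)] by simp
  have "g (C t) (D W t) (W t) = 0"
    using metric_along_const[OF frame_smooth(2) frame_smooth(2) t frame_gram(2)] g_sym[OF T(2,5)] by simp
  moreover have "g (C t) (D W t) (vel t) = - g (C t) (D vel t) (W t)"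
    using metric_along_const[OF frame_smooth(2) velocity_smooth t frame_gram(8)] g_sym[OF T(3,5)] by simp
  moreover have "g (C t) (D W t) (N t) = - g (C t) (D N t) (W t)"
    using metric_along_const[OF frame_smooth(2) frame_smooth(1) t frame_gram(7)] g_sym[OF T(1,5)] by simp
  ultimately show "D W t = - g (C t) (D N t) (W t) *\<^sub>R vel t - g (C t) (D vel t) (W t) *\<^sub>R N t"
    using frenet_expand[OF t T(2)] by simp
qed

lemma frenet_coefficients:
  assumes eqs: "frenet_equations A nabla I C N W h k1 k2" and t: "t \<in> I"
  shows "h t = g (C t) (D vel t) (N t)" "k1 t = g (C t) (D vel t) (W t)" "k2 t = g (C t) (D N t) (W t)"
  using eqs t frame_gram[OF t] frame_tangent[OF t] unfolding frenet_equations_def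
  by (simp_all add: g_add_left g_diff_left g_scaleR_left tangent_scaleR tangent_neg)

lemma screen_bundle_span: "screen_bundle A g I C (\<lambda>t. span {W t})"
  unfolding screen_bundle_def
proof (intro ballI conjI)
  fix t assume t: "t \<in> I"
  note T = frame_tangent[OF t]
  show "subspace (span {W t})" by simp
  show "span {W t} \<inter> span {vel t} = {0}"
  proof (intro equalityI subsetI)
    fix x assume "x \<in> span {W t} \<inter> span {vel t}"
    then obtain r s where rs: "x = r *\<^sub>R W t" "x = s *\<^sub>R vel t"
      unfolding span_singleton by blast
    have "r = g (C t) (r *\<^sub>R W t) (W t)" using frame_gram[OF t] T by (simp add: g_scaleR_left)
    also have "\<dots> = g (C t) (s *\<^sub>R vel t) (W t)" using rs by simp
    also have "\<dots> = 0" using frame_gram[OF t] T by (simp add: g_scaleR_left)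
    finally show "x \<in> {0}" using rs by simp
  qed (auto simp: span_zero)
  show "{v + w |v w. v \<in> span {vel t} \<and> w \<in> span {W t}} =
      {u \<in> tangent_space A (C t). g (C t) u (vel t) = 0}"
  proof (intro equalityI subsetI)
    fix x assume "x \<in> {v + w |v w. v \<in> span {vel t} \<and> w \<in> span {W t}}"
    then obtain r s where x: "x = r *\<^sub>R vel t + s *\<^sub>R W t" by (auto simp: span_singleton)
    show "x \<in> {u \<in> tangent_space A (C t). g (C t) u (vel t) = 0}"
      using frame_gram[OF t] vel_null[OF t] T
      by (simp add: x g_add_left g_scaleR_left tangent_add tangent_scaleR)
  next
    fix x assume "x \<in> {u \<in> tangent_space A (C t). g (C t) u (vel t) = 0}"
    then have "x = g (C t) x (N t) *\<^sub>R vel t + g (C t) x (W t) *\<^sub>R W t"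
      using frenet_expand[OF t, of x] by simp
    then show "x \<in> {v + w |v w. v \<in> span {vel t} \<and> w \<in> span {W t}}"
      by (auto simp: span_singleton)
  qed
qed

text \<open>Two choices of \<open>N\<close> for the same \<open>W\<close> differ by a multiple of the velocity, and twice this multiple is
the squared length of the new vector.\<close>

lemma frenet_frame_unique:
  assumes M: "frenet_frame A g I C M W" and t: "t \<in> I"
  shows "M t = N t"
proof -
  have MT: "M t \<in> tangent_space A (C t)" using M t field_tangent unfolding frenet_frame_def by blast
  note T = frame_tangent[OF t]
  have gM: "g (C t) (M t) (M t) = 0" "g (C t) (M t) (W t) = 0" "g (C t) (M t) (vel t) = 1"
    using M t g_sym[OF T(3) MT] unfolding frenet_frame_def by auto
  define r where "r = g (C t) (M t) (N t)"
  have Mr: "M t = r *\<^sub>R vel t + N t"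
    using frenet_expand[OF t MT] gM by (simp add: r_def)
  have "g (C t) (M t) (M t) = 2 * r"
    using frame_gram[OF t] vel_null[OF t] T unfolding Mr
    by (simp add: g_add_left g_scaleR_left g_add_right g_scaleR_right tangent_add tangent_scaleR)
  then show ?thesis using gM Mr by simp
qed

text \<open>The unit vector of another screen is \<open>\<sigma> (W + \<mu> C')\<close> with \<open>\<sigma> = \<plusminus>1\<close>; the vector completing it to a frame
is then forced to be \<open>N - \<mu> W - (\<mu>^2 / 2) C'\<close>. In the formula for \<open>k2\<close>, the quadratic term
collects the contributions of the component of \<open>D W\<close> along \<open>N\<close> and of \<open>\<mu> D C'\<close>.\<close>

lemma change_of_screen:
  fixes \<sigma> :: real
  assumes \<mu>: "smooth_on I \<mu>" and \<sigma>: "\<sigma> * \<sigma> = 1"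
  defines "M \<equiv> \<lambda>t. N t + (- \<mu> t) *\<^sub>R W t + (- (\<mu> t)\<^sup>2 / 2) *\<^sub>R vel t"
    and "Z \<equiv> \<lambda>t. \<sigma> *\<^sub>R (W t + \<mu> t *\<^sub>R vel t)"
  shows change_of_screen_frame: "frenet_frame A g I C M Z"
    and change_of_screen_h: "t \<in> I \<Longrightarrow> g (C t) (D vel t) (M t) =
      g (C t) (D vel t) (N t) - \<mu> t * g (C t) (D vel t) (W t)"
    and change_of_screen_k2: "t \<in> I \<Longrightarrow> g (C t) (D M t) (Z t) = \<sigma> * (g (C t) (D N t) (W t)
      + (\<mu> t)\<^sup>2 / 2 * g (C t) (D vel t) (W t) - param_deriv I \<mu> t - \<mu> t * g (C t) (D vel t) (N t))"
proof -
  note u = unique_deriv_I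
  have const: "smooth_on I (\<lambda>_. r)" for r :: real by (rule smooth_on_const[OF u])
  have \<mu>1: "smooth_on I (\<lambda>t. - \<mu> t)"
    using smooth_on_mult[OF u const[of "-1"] \<mu>] by simp
  have \<mu>2: "smooth_on I (\<lambda>t. - (\<mu> t)\<^sup>2 / 2)"
    using smooth_on_mult[OF u const[of "-1/2"] smooth_on_mult[OF u \<mu> \<mu>]] by (simp add: power2_eq_square)
  have WZ: "smooth_field_along A I C (\<lambda>t. W t + \<mu> t *\<^sub>R vel t)"
    by (intro field_along_add field_along_scaleR frame_smooth \<mu> velocity_smooth)
  have sM: "smooth_field_along A I C M"
    unfolding M_def by (intro field_along_add field_along_scaleR \<mu>1 \<mu>2 frame_smooth velocity_smooth)
  have sZ: "smooth_field_along A I C Z"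
    unfolding Z_def by (intro field_along_scaleR const WZ)
  show frame': "frenet_frame A g I C M Z"
    unfolding frenet_frame_def
  proof (intro conjI ballI sM sZ)
    fix t assume t: "t \<in> I"
    note T = frame_tangent[OF t] and G = frame_gram[OF t] vel_null[OF t]
    note rules = g_add_left g_scaleR_left g_add_right g_scaleR_right
      g_diff_left g_diff_right tangent_add tangent_scaleR tangent_diff
    show "g (C t) (vel t) (M t) = 1" using T G by (simp add: M_def rules)
    show "g (C t) (Z t) (Z t) = 1" using T G \<sigma> by (simp add: Z_def rules)
    show "g (C t) (M t) (M t) = 0" using T G by (simp add: M_def rules power2_eq_square)
    show "g (C t) (M t) (Z t) = 0" using T G by (simp add: M_def Z_def rules)
    show "g (C t) (vel t) (Z t) = 0" using T G by (simp add: Z_def rules)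
  qed
  note rules = g_add_left g_scaleR_left g_add_right g_scaleR_right
      g_diff_left g_diff_right tangent_add tangent_scaleR tangent_diff
  {
    assume t: "t \<in> I"
    note T = frame_tangent[OF t] cov_deriv_tangent[OF frame_smooth(1) t]
      cov_deriv_tangent[OF frame_smooth(2) t] cov_deriv_tangent[OF velocity_smooth t]
    show h: "g (C t) (D vel t) (M t) = g (C t) (D vel t) (N t) - \<mu> t * g (C t) (D vel t) (W t)"
      using T cov_deriv_vel_orth[OF t] by (simp add: M_def rules)
    have MT: "M t \<in> tangent_space A (C t)" by (rule field_tangent[OF sM t])
    have gM: "g (C t) (M t) (Z t) = 0" if "t \<in> I" for t
      using frame' that unfolding frenet_frame_def by blast
    have "D Z t = \<sigma> *\<^sub>R (D W t + (param_deriv I \<mu> t *\<^sub>R vel t + \<mu> t *\<^sub>R D vel t))"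
    proof -
      have "D Z t = 0 *\<^sub>R (W t + \<mu> t *\<^sub>R vel t) + \<sigma> *\<^sub>R D (\<lambda>t. W t + \<mu> t *\<^sub>R vel t) t"
        unfolding Z_def by (rule cov_deriv_scaleR[OF WZ t has_vector_derivative_const])
      also have "D (\<lambda>t. W t + \<mu> t *\<^sub>R vel t) t = D W t + D (\<lambda>t. \<mu> t *\<^sub>R vel t) t"
        by (intro cov_deriv_add frame_smooth field_along_scaleR \<mu> velocity_smooth t)
      also have "D (\<lambda>t. \<mu> t *\<^sub>R vel t) t = param_deriv I \<mu> t *\<^sub>R vel t + \<mu> t *\<^sub>R D vel t"
        by (rule cov_deriv_scaleR[OF velocity_smooth t has_param_deriv_I[OF \<mu> t]])
      finally show ?thesis by (simp only: scaleR_zero_left add_0_left)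
    qed
    moreover have Mv: "g (C t) (M t) (vel t) = 1"
      using frame' t g_sym[OF T(3) MT] unfolding frenet_frame_def by simp
    ultimately have "g (C t) (M t) (D Z t) = \<sigma> * (g (C t) (M t) (D W t) + param_deriv I \<mu> t
        + \<mu> t * g (C t) (M t) (D vel t))"
      using T MT by (simp add: rules)
    moreover have "g (C t) (M t) (D W t) = - g (C t) (D N t) (W t)
        + (\<mu> t)\<^sup>2 / 2 * g (C t) (D vel t) (W t)"
    proof -
      have "D W t = - g (C t) (D N t) (W t) *\<^sub>R vel t - g (C t) (D vel t) (W t) *\<^sub>R N t"
        using frenet_equations_hold t unfolding frenet_equations_def by blast
      then have "D W t = (- g (C t) (D N t) (W t)) *\<^sub>R vel t + (- g (C t) (D vel t) (W t)) *\<^sub>R N t"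
        by simp
      then have "g (C t) (M t) (D W t) = (- g (C t) (D N t) (W t)) * g (C t) (M t) (vel t)
          + (- g (C t) (D vel t) (W t)) * g (C t) (M t) (N t)"
        using T MT by (simp only: rules)
      moreover have "g (C t) (M t) (N t) = - (\<mu> t)\<^sup>2 / 2"
        using T frame_gram[OF t] by (simp add: M_def rules)
      ultimately show ?thesis using Mv by simp
    qed
    moreover have "g (C t) (D M t) (Z t) = - g (C t) (M t) (D Z t)"
      by (rule metric_along_const[OF sM sZ t gM])
    moreover have "g (C t) (M t) (D vel t) = g (C t) (D vel t) (N t) - \<mu> t * g (C t) (D vel t) (W t)"
      using h g_sym[OF T(6) MT] by simp
    ultimately have "g (C t) (D M t) (Z t) = - (\<sigma> * ((- g (C t) (D N t) (W t)
        + (\<mu> t)\<^sup>2 / 2 * g (C t) (D vel t) (W t)) + param_deriv I \<mu> t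
        + \<mu> t * (g (C t) (D vel t) (N t) - \<mu> t * g (C t) (D vel t) (W t))))"
      by (simp only:)
    then show "g (C t) (D M t) (Z t) = \<sigma> * (g (C t) (D N t) (W t)
      + (\<mu> t)\<^sup>2 / 2 * g (C t) (D vel t) (W t) - param_deriv I \<mu> t - \<mu> t * g (C t) (D vel t) (N t))"
      by (simp add: field_simps power2_eq_square)
  }
qed

lemma frenet_frame_cong:
  assumes "\<And>t. t \<in> I \<Longrightarrow> M t = N t" "\<And>t. t \<in> I \<Longrightarrow> Z t = W t"
  shows "frenet_frame A g I C M Z"
  using frame assms field_along_cong[of N M] field_along_cong[of W Z]
  unfolding frenet_frame_def by simp

end

end

section \<open>Sasaki-like almost contact B-metric structures\<close>

text \<open>Stated for an abstract vector space so that rewriting does not unfold the pointwise operations on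
tangent vectors.\<close>

lemma solve_for_summand:
  fixes P v x :: "'v::real_vector"
  assumes "0 = P + (- e) *\<^sub>R x + (- 1) *\<^sub>R v + (e *\<^sub>R x + e *\<^sub>R x)"
  shows "P = v + (- e) *\<^sub>R x"
  using assms by (simp add: algebra_simps eq_neg_iff_add_eq_0)

locale sasaki_null_curve = null_curve_in_manifold A I C nabla g
  for A :: "'a::{t2_space,second_countable_topology} chart set" and I C nabla g +
  fixes \<phi> :: "'a \<Rightarrow> 'a tvec \<Rightarrow> 'a tvec" and \<xi> :: "'a \<Rightarrow> 'a tvec" and \<eta> :: "'a \<Rightarrow> 'a tvec \<Rightarrow> real"
  assumes almost_contact: "almost_contact_B_metric_manifold A \<phi> \<xi> \<eta> g"
    and sasaki: "sasaki_like A \<phi> \<xi> \<eta> g nabla"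
begin

lemma
  shows phi_endomorphism: "smooth_endomorphism A \<phi>" and xi_smooth: "smooth_vector_field A UNIV \<xi>"
    and eta_one_form: "smooth_one_form A \<eta>"
    and phi_phi: "u \<in> tangent_space A p \<Longrightarrow> \<phi> p (\<phi> p u) = - u + \<eta> p u *\<^sub>R \<xi> p"
    and eta_xi: "\<eta> p (\<xi> p) = 1"
    and g_phi_phi: "u \<in> tangent_space A p \<Longrightarrow> v \<in> tangent_space A p \<Longrightarrow>
      g p (\<phi> p u) (\<phi> p v) = - g p u v + \<eta> p u * \<eta> p v"
  using almost_contact unfolding almost_contact_B_metric_manifold_def by simp_all

lemma xi_tangent: "\<xi> p \<in> tangent_space A p"
  using xi_smooth unfolding smooth_vector_field_def by simp

lemma phi_tangent: "u \<in> tangent_space A p \<Longrightarrow> \<phi> p u \<in> tangent_space A p"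
  using phi_endomorphism[unfolded smooth_endomorphism_def, THEN conjunct1] by blast

lemma phi_add: "u \<in> tangent_space A p \<Longrightarrow> v \<in> tangent_space A p \<Longrightarrow> \<phi> p (u + v) = \<phi> p u + \<phi> p v"
  using phi_endomorphism[unfolded smooth_endomorphism_def, THEN conjunct1] by blast

lemma phi_scaleR: "u \<in> tangent_space A p \<Longrightarrow> \<phi> p (r *\<^sub>R u) = r *\<^sub>R \<phi> p u"
  using phi_endomorphism[unfolded smooth_endomorphism_def, THEN conjunct1] by blast

lemma phi_smooth:
  "open U \<Longrightarrow> smooth_vector_field A U X \<Longrightarrow> smooth_vector_field A U (\<lambda>p. \<phi> p (X p))"
  using phi_endomorphism[unfolded smooth_endomorphism_def, THEN conjunct2] by blast

lemma eta_scaleR: "u \<in> tangent_space A p \<Longrightarrow> \<eta> p (r *\<^sub>R u) = r * \<eta> p u"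
  using eta_one_form[unfolded smooth_one_form_def, THEN conjunct1] by blast

lemma xi_nonzero: "\<xi> p \<noteq> 0"
  using eta_xi[of p] eta_scaleR[OF tangent_zero, of p 0] by auto

text \<open>From \<open>\<phi>\<^sup>2 \<xi> = 0\<close> one gets \<open>\<phi> \<xi> = \<lambda> \<xi>\<close> by applying \<open>\<phi>\<^sup>2\<close> to \<open>\<phi> \<xi>\<close>; then \<open>\<phi>\<^sup>2 \<xi> = \<lambda>\<^sup>2 \<xi>\<close> forces \<open>\<lambda> = 0\<close>.\<close>

lemma phi_xi: "\<phi> p (\<xi> p) = 0"
proof -
  let ?x = "\<phi> p (\<xi> p)"
  note T = phi_tangent[OF xi_tangent]
  have "\<phi> p ?x = 0" using phi_phi[OF xi_tangent] eta_xi by simp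
  moreover have "\<phi> p 0 = 0" using phi_scaleR[OF tangent_zero, of p 0] by simp
  ultimately have x: "?x = \<eta> p ?x *\<^sub>R \<xi> p" using phi_phi[OF T, of p] by simp
  then have "\<phi> p ?x = \<eta> p ?x *\<^sub>R ?x" using phi_scaleR[OF xi_tangent, of p "\<eta> p ?x"] by simp
  then show ?thesis using \<open>\<phi> p ?x = 0\<close> x by (metis scaleR_eq_0_iff)
qed

text \<open>Compare \<open>\<phi>\<^sup>2 (\<phi> u)\<close> with \<open>\<phi> (\<phi>\<^sup>2 u)\<close>.\<close>

lemma eta_phi:
  assumes u: "u \<in> tangent_space A p"
  shows "\<eta> p (\<phi> p u) = 0"
proof -
  have "\<phi> p (\<phi> p (\<phi> p u)) = \<phi> p ((-1) *\<^sub>R u + \<eta> p u *\<^sub>R \<xi> p)" using phi_phi[OF u] by simp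
  also have "\<dots> = - \<phi> p u"
    using u by (simp only: phi_add phi_scaleR tangent_scaleR xi_tangent phi_xi) simp
  finally have "\<eta> p (\<phi> p u) *\<^sub>R \<xi> p = 0" using phi_phi[OF phi_tangent[OF u]] by simp
  then show ?thesis using xi_nonzero by simp
qed

text \<open>Evaluate \<open>g(\<phi> u, \<phi> (\<phi> v))\<close> in two ways.\<close>

lemma g_phi:
  assumes u: "u \<in> tangent_space A p" and v: "v \<in> tangent_space A p"
  shows "g p (\<phi> p u) v = g p u (\<phi> p v)"
proof -
  have "- g p u (\<phi> p v) = g p (\<phi> p u) (\<phi> p (\<phi> p v))"
    using g_phi_phi[OF u phi_tangent[OF v]] eta_phi[OF v] by simp
  also have "\<dots> = g p (\<phi> p u) ((-1) *\<^sub>R v + \<eta> p v *\<^sub>R \<xi> p)" using phi_phi[OF v] by simp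
  also have "\<dots> = - g p (\<phi> p u) v + \<eta> p v * g p (\<phi> p u) (\<xi> p)"
    using u v by (simp only: g_add_right g_scaleR_right tangent_scaleR phi_tangent xi_tangent)
  also have "g p (\<phi> p u) (\<xi> p) = 0"
  proof -
    have "g p (\<phi> p (\<phi> p u)) (\<phi> p (\<xi> p)) = - g p (\<phi> p u) (\<xi> p)"
      using g_phi_phi[OF phi_tangent[OF u] xi_tangent] eta_phi[OF u] by simp
    then show ?thesis by (simp only: phi_xi g_zero_right[OF phi_tangent[OF phi_tangent[OF u]]])
  qed
  finally show ?thesis by simp
qed

lemma g_xi:
  assumes u: "u \<in> tangent_space A p"
  shows "g p u (\<xi> p) = \<eta> p u"
proof -
  have "g p (\<phi> p u) (\<phi> p (\<xi> p)) = - g p u (\<xi> p) + \<eta> p u"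
    using g_phi_phi[OF u xi_tangent] eta_xi by simp
  then show ?thesis by (simp only: phi_xi g_zero_right[OF phi_tangent[OF u]])
qed

lemma nabla_phi:
  assumes "open U" "p \<in> U" "smooth_vector_field A U Y" "v \<in> tangent_space A p"
  shows "nabla p v (\<lambda>q. \<phi> q (Y q)) = \<phi> p (nabla p v Y) + (- g p v (Y p)) *\<^sub>R \<xi> p
    + (- \<eta> p (Y p)) *\<^sub>R v + (2 * \<eta> p v * \<eta> p (Y p)) *\<^sub>R \<xi> p"
proof -
  have "open U \<and> p \<in> U \<and> smooth_vector_field A U Y" using assms by simp
  from sasaki[unfolded sasaki_like_def, THEN spec, THEN spec, THEN spec, THEN mp, OF this] assms(4)
  have "nabla p v (\<lambda>q. \<phi> q (Y q)) - \<phi> p (nabla p v Y) =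
      - g p v (Y p) *\<^sub>R \<xi> p - \<eta> p (Y p) *\<^sub>R v + (2 * \<eta> p v * \<eta> p (Y p)) *\<^sub>R \<xi> p" by blast
  then show ?thesis by (simp add: algebra_simps)
qed

lemma phi_sum:
  assumes "finite J" "\<And>i. x i \<in> tangent_space A p"
  shows "\<phi> p (\<Sum>i\<in>J. x i) = (\<Sum>i\<in>J. \<phi> p (x i))"
  using assms(1)
proof (induction J rule: finite_induct)
  case empty
  show ?case using phi_scaleR[OF tangent_zero, of p 0] by (simp only: sum.empty scaleR_zero_left)
next
  case (insert i J)
  have "sum x J \<in> tangent_space A p" using assms(2) by (rule tangent_sum)
  then show ?case by (simp only: sum.insert[OF insert.hyps] phi_add[OF assms(2)] insert.IH)
qed

lemma phi_field_expand:
  assumes V: "smooth_field_along A I C V" and c: "c \<in> A" and t: "t \<in> I" "C t \<in> chart_dom c"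
  shows "\<phi> (C t) (V t) = (\<Sum>i\<in>UNIV. (V t c $ i) *\<^sub>R \<phi> (C t) (coord_field A c i (C t)))"
  unfolding field_expand[OF V c t, THEN arg_cong[where f="\<phi> _"]]
    phi_sum[OF finite tangent_scaleR[OF coord_field_tangent[OF c t(2)]]]
    phi_scaleR[OF coord_field_tangent[OF c t(2)]] ..

lemma phi_field_smooth:
  assumes V: "smooth_field_along A I C V"
  shows "smooth_field_along A I C (\<lambda>t. \<phi> (C t) (V t))"
proof (rule smooth_field_alongI)
  show "\<phi> (C t) (V t) \<in> tangent_space A (C t)" if "t \<in> I" for t
    using field_tangent[OF V that] by (rule phi_tangent)
  show "\<phi> (C t) (V t) = (\<Sum>i\<in>UNIV. (V t c $ i) *\<^sub>R \<phi> (C t) (coord_field A c i (C t)))"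
    if "c \<in> A" "t \<in> I" "C t \<in> chart_dom c" for c t
    using phi_field_expand[OF V that] .
  show "smooth_on {t \<in> I. C t \<in> chart_dom c} (\<lambda>t. V t c $ i)" if "c \<in> A" for c i
    using field_component_smooth[OF V that] .
  show "smooth_vector_field A (chart_dom c) (\<lambda>p. \<phi> p (coord_field A c i p))" if "c \<in> A" for c i
    using phi_smooth[OF open_chart_dom[OF that] coord_field_smooth[OF that open_chart_dom[OF that]]]
    by simp
qed

text \<open>The Sasaki-like condition is about vector fields on open sets; it is applied to the coordinate
fields, and the correction term is linear in the field that \<open>\<phi>\<close> is applied to.\<close>

lemma cov_deriv_phi:
  assumes V: "smooth_field_along A I C V" and t: "t \<in> I"
  shows "D (\<lambda>s. \<phi> (C s) (V s)) t = \<phi> (C t) (D V t) + (- g (C t) (vel t) (V t)) *\<^sub>R \<xi> (C t)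
    + (- \<eta> (C t) (V t)) *\<^sub>R vel t + (2 * \<eta> (C t) (vel t) * \<eta> (C t) (V t)) *\<^sub>R \<xi> (C t)"
proof -
  obtain c where c: "c \<in> A" "C t \<in> chart_dom c" by (rule chart_at)
  note o = open_chart_dom[OF c(1)]
  let ?E = "\<lambda>i. coord_field A c i (C t)" and ?n = "\<lambda>i. nabla (C t) (vel t) (coord_field A c i)"
    and ?v = "\<lambda>i. V t c $ i" and ?v' = "\<lambda>i. param_deriv I (\<lambda>s. V s c) t $ i"
  note vel = velocity_tangent[OF t]
  note sE = coord_field_smooth[OF c(1) o order_refl]
  note E = coord_field_tangent[OF c]
  note n = nabla_tangent[OF sE o c(2) vel]
  have "D (\<lambda>s. \<phi> (C s) (V s)) t = (\<Sum>i\<in>UNIV. ?v' i *\<^sub>R \<phi> (C t) (?E i)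
      + ?v i *\<^sub>R nabla (C t) (vel t) (\<lambda>p. \<phi> p (coord_field A c i p)))"
    by (rule cov_deriv_combination[OF t o c(2) phi_smooth[OF o sE] field_component_derivative[OF V c(1) t c(2)]])
      (rule phi_field_expand[OF V c(1)])
  also have "\<dots> = (\<Sum>i\<in>UNIV. (?v' i *\<^sub>R \<phi> (C t) (?E i) + ?v i *\<^sub>R \<phi> (C t) (?n i))
      + ((?v i * - g (C t) (vel t) (?E i)) *\<^sub>R \<xi> (C t) + (?v i * - \<eta> (C t) (?E i)) *\<^sub>R vel t
      + (?v i * (2 * \<eta> (C t) (vel t) * \<eta> (C t) (?E i))) *\<^sub>R \<xi> (C t)))"
    unfolding nabla_phi[OF o c(2) sE vel] by (simp only: scaleR_add_right scaleR_scaleR add.assoc)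
  also have "\<dots> = (\<Sum>i\<in>UNIV. ?v' i *\<^sub>R \<phi> (C t) (?E i) + ?v i *\<^sub>R \<phi> (C t) (?n i))
      + ((\<Sum>i\<in>UNIV. ?v i * - g (C t) (vel t) (?E i)) *\<^sub>R \<xi> (C t)
      + (\<Sum>i\<in>UNIV. ?v i * - \<eta> (C t) (?E i)) *\<^sub>R vel t
      + (\<Sum>i\<in>UNIV. ?v i * (2 * \<eta> (C t) (vel t) * \<eta> (C t) (?E i))) *\<^sub>R \<xi> (C t))"
    by (simp only: sum.distrib scaleR_sum_left)
  also have "(\<Sum>i\<in>UNIV. ?v' i *\<^sub>R \<phi> (C t) (?E i) + ?v i *\<^sub>R \<phi> (C t) (?n i)) = \<phi> (C t) (D V t)"
    unfolding cov_deriv_expand[OF V c(1) t c(2)]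
      phi_sum[OF finite tangent_add[OF tangent_scaleR[OF E] tangent_scaleR[OF n]]]
      phi_add[OF tangent_scaleR[OF E] tangent_scaleR[OF n]] phi_scaleR[OF E] phi_scaleR[OF n] ..
  also have "(\<Sum>i\<in>UNIV. ?v i * - g (C t) (vel t) (?E i)) = - g (C t) (vel t) (V t)"
    unfolding field_expand[OF V c(1) t c(2), THEN arg_cong[where f="g _ _"]]
      g_sum_right[OF finite tangent_scaleR[OF E] vel] g_scaleR_right[OF E vel]
    by (simp add: sum_negf)
  also have eta: "(\<Sum>i\<in>UNIV. ?v i * \<eta> (C t) (?E i)) = \<eta> (C t) (V t)"
    unfolding g_xi[OF E, symmetric] g_xi[OF field_tangent[OF V t], symmetric]
      field_expand[OF V c(1) t c(2), THEN arg_cong[where f="\<lambda>x. g _ x _"]]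
      g_sum_left[OF finite tangent_scaleR[OF E] xi_tangent] g_scaleR_left[OF E xi_tangent] ..
  then have "(\<Sum>i\<in>UNIV. ?v i * - \<eta> (C t) (?E i)) = - \<eta> (C t) (V t)"
    by (simp add: sum_negf)
  also have "(\<Sum>i\<in>UNIV. ?v i * (2 * \<eta> (C t) (vel t) * \<eta> (C t) (?E i)))
      = 2 * \<eta> (C t) (vel t) * \<eta> (C t) (V t)"
    unfolding eta[symmetric] sum_distrib_left by (simp add: mult_ac)
  finally show ?thesis by (simp only: add.assoc)
qed

text \<open>Differentiating \<open>\<phi> \<xi> = 0\<close> determines \<open>\<phi> (D \<xi>)\<close>, hence \<open>D \<xi>\<close> up to a multiple of \<open>\<xi>\<close>; this multiple
vanishes because \<open>\<xi>\<close> has constant length.\<close>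

lemma cov_deriv_xi:
  assumes t: "t \<in> I"
  shows "D (\<lambda>s. \<xi> (C s)) t = - \<phi> (C t) (vel t)"
proof -
  let ?x = "\<lambda>s. \<xi> (C s)"
  note vel = velocity_tangent[OF t]
  have X: "smooth_field_along A I C ?x" using vector_field_along[OF xi_smooth] .
  note DX = cov_deriv_tangent[OF X t]
  \<comment> \<open>writing the zero field as a multiple of \<open>\<xi>\<close> lets the Leibniz rule compute its derivative\<close>
  have "D (\<lambda>s. \<phi> (C s) (?x s)) t = D (\<lambda>s. 0 *\<^sub>R ?x s) t"
    by (rule cov_deriv_cong) (simp_all add: phi_xi t)
  also have "\<dots> = 0"
    using cov_deriv_scaleR[OF X t has_vector_derivative_const, of 0] by simp
  finally have "0 = \<phi> (C t) (D ?x t) + (- \<eta> (C t) (vel t)) *\<^sub>R \<xi> (C t) + (- 1) *\<^sub>R vel t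
      + (2 * \<eta> (C t) (vel t) * 1) *\<^sub>R \<xi> (C t)"
    unfolding cov_deriv_phi[OF X t] g_xi[OF vel] eta_xi by (rule sym)
  also have "(2 * \<eta> (C t) (vel t) * 1) *\<^sub>R \<xi> (C t) =
      \<eta> (C t) (vel t) *\<^sub>R \<xi> (C t) + \<eta> (C t) (vel t) *\<^sub>R \<xi> (C t)"
    by (simp only: mult_2 scaleR_add_left mult_1_right)
  finally have "\<phi> (C t) (D ?x t) = vel t + (- \<eta> (C t) (vel t)) *\<^sub>R \<xi> (C t)"
    by (rule solve_for_summand)
  then have "\<phi> (C t) (\<phi> (C t) (D ?x t)) = \<phi> (C t) (vel t + (- \<eta> (C t) (vel t)) *\<^sub>R \<xi> (C t))"
    by (rule arg_cong)
  also have "\<dots> = \<phi> (C t) (vel t)"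
    by (simp only: phi_add phi_scaleR vel xi_tangent tangent_scaleR phi_xi scaleR_zero_right add_0_right)
  finally have "\<phi> (C t) (\<phi> (C t) (D ?x t)) = \<phi> (C t) (vel t)" .
  moreover have "\<eta> (C t) (D ?x t) = 0"
  proof -
    have "g (C s) (\<xi> (C s)) (\<xi> (C s)) = 1" if "s \<in> I" for s
      unfolding g_xi[OF xi_tangent] eta_xi ..
    from metric_along_const[OF X X t this] g_sym[OF DX xi_tangent]
    have "g (C t) (D ?x t) (\<xi> (C t)) = 0" by simp
    then show ?thesis unfolding g_xi[OF DX] .
  qed
  ultimately have "\<phi> (C t) (vel t) = - D ?x t" using phi_phi[OF DX] by simp
  then show ?thesis by simp
qed

end

section \<open>Slant null curves\<close>

text \<open>The left-hand side is \<open>g(D W, N)\<close> for the first frame, apart from the factor \<open>\<epsilon> / sqrt q\<close>, as it results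
from the products of basis vectors.\<close>

lemma slant_k2_identity:
  fixes a b b1 q :: real
  assumes q: "q = a^4 + b\<^sup>2" and "q \<noteq> 0"
  shows "(- b1 * a^4 / q + 2 * a^3) * (a^3 / (2 * q)) - a\<^sup>2 + (b - a * b * b1 / q) * (a\<^sup>2 * b / (2 * q))
      + a * (- (a\<^sup>2 / (2 * q)) * ((b1 - 2 * a^3) / 2) + b / q * (a * b))
    = - (- 2 * a\<^sup>2 * q + 3 * a^3 * b1) / (4 * q)"
  using assms(2) by (simp add: divide_simps) (use q in algebra)

text \<open>The left-hand side is \<open>k2 - \<mu> h / 2 - \<mu>'\<close> for the change between the two screens, apart from the
factor \<open>\<epsilon> / sqrt q\<close>.\<close>

lemma slant_bar_k2_identity:
  fixes a b b1 b2 q K :: real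
  assumes q: "q = a^4 + b\<^sup>2" and K: "K = - 2 * q + a * b1" and "q \<noteq> 0" "K \<noteq> 0"
  shows "(- 2 * a\<^sup>2 * q + 3 * a^3 * b1) / (4 * q) - b\<^sup>2 * b1\<^sup>2 / (4 * q * K)
      - ((b1\<^sup>2 + b * b2) / K - b\<^sup>2 * b1\<^sup>2 / (q * K) - b * b1 * (- 4 * b * b1 + a * b2) / K\<^sup>2)
    = (q * (8 * b * b2 + 20 * a^3 * b1 - 8 * a^6 - 8 * a\<^sup>2 * b\<^sup>2) - a * b1^3
        - 2 * (3 * a^4 + 7 * b\<^sup>2) * b1\<^sup>2) / (4 * K\<^sup>2)"
  using assms(3,4) by (simp add: divide_simps) (use q K in algebra)

locale slant_null_curve = sasaki_null_curve A I C nabla g \<phi> \<xi> \<eta>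
  for A :: "'a::{t2_space,second_countable_topology} chart set" and I C nabla g \<phi> \<xi> \<eta> +
  fixes a :: real
  assumes slant: "slant A \<eta> I C a"
begin

definition F :: "real \<Rightarrow> 'a tvec" where "F t = \<phi> (C t) (vel t)"
definition b :: "real \<Rightarrow> real" where "b t = g (C t) (vel t) (F t)"
definition b1 :: "real \<Rightarrow> real" where "b1 = param_deriv I b"
definition b2 :: "real \<Rightarrow> real" where "b2 = param_deriv I b1"
definition q :: "real \<Rightarrow> real" where "q t = a^4 + (b t)\<^sup>2"
text \<open>Up to the factor \<open>\<epsilon> / (2 sqrt q)\<close>, this is \<open>k1\<close> for the first frame.\<close>

definition K :: "real \<Rightarrow> real" where "K t = - 2 * q t + a * b1 t"

lemma xi_along: "smooth_field_along A I C (\<lambda>t. \<xi> (C t))"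
  using vector_field_along[OF xi_smooth] .

lemma F_smooth: "smooth_field_along A I C F"
  unfolding F_def by (rule phi_field_smooth[OF velocity_smooth])

lemma b_smooth: "smooth_on I b"
  using metric_along_smooth[OF velocity_smooth F_smooth] by (simp add: b_def[abs_def])

lemma b1_smooth: "smooth_on I b1"
  unfolding b1_def by (rule param_deriv_smooth_I[OF b_smooth])

lemma b_deriv: "t \<in> I \<Longrightarrow> (b has_real_derivative b1 t) (at t within I)"
  unfolding has_real_derivative_iff_has_vector_derivative b1_def
  by (rule has_param_deriv_I[OF b_smooth])

lemma b1_deriv: "t \<in> I \<Longrightarrow> (b1 has_real_derivative b2 t) (at t within I)"
  unfolding has_real_derivative_iff_has_vector_derivative b2_def
  by (rule has_param_deriv_I[OF b1_smooth])

context
  fixes t assumes t: "t \<in> I"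
begin

lemma basis_tangent: "\<xi> (C t) \<in> tangent_space A (C t)" "vel t \<in> tangent_space A (C t)"
  "F t \<in> tangent_space A (C t)" "D vel t \<in> tangent_space A (C t)"
  using xi_tangent velocity_tangent[OF t] field_tangent[OF F_smooth t] cov_deriv_tangent[OF velocity_smooth t]
  by simp_all

lemma eta_vel: "\<eta> (C t) (vel t) = a"
  using slant t unfolding slant_def by blast

lemma basis_gram: "g (C t) (vel t) (vel t) = 0" "g (C t) (vel t) (\<xi> (C t)) = a" "g (C t) (vel t) (F t) = b t"
  "g (C t) (\<xi> (C t)) (\<xi> (C t)) = 1" "g (C t) (F t) (\<xi> (C t)) = 0" "g (C t) (F t) (F t) = a\<^sup>2"
  "g (C t) (\<xi> (C t)) (vel t) = a" "g (C t) (F t) (vel t) = b t" "g (C t) (\<xi> (C t)) (F t) = 0"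
proof -
  note T = basis_tangent
  show 1: "g (C t) (vel t) (vel t) = 0" using vel_null[OF t] .
  show 2: "g (C t) (vel t) (\<xi> (C t)) = a" using g_xi[OF T(2)] eta_vel by simp
  show 3: "g (C t) (vel t) (F t) = b t" by (simp add: b_def)
  show "g (C t) (\<xi> (C t)) (\<xi> (C t)) = 1" using g_xi[OF T(1)] eta_xi by simp
  show 5: "g (C t) (F t) (\<xi> (C t)) = 0" using g_xi[OF T(3)] eta_phi[OF T(2)] by (simp add: F_def)
  show "g (C t) (F t) (F t) = a\<^sup>2"
    unfolding F_def g_phi_phi[OF T(2,2)] 1 eta_vel by (simp add: power2_eq_square)
  show "g (C t) (\<xi> (C t)) (vel t) = a" using g_sym[OF T(1,2)] 2 by simp
  show "g (C t) (F t) (vel t) = b t" using g_sym[OF T(3,2)] 3 by simp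
  show "g (C t) (\<xi> (C t)) (F t) = 0" using g_sym[OF T(1,3)] 5 by simp
qed

lemma g_comb: "g (C t) (x *\<^sub>R \<xi> (C t) + y *\<^sub>R vel t + z *\<^sub>R F t) (x' *\<^sub>R \<xi> (C t) + y' *\<^sub>R vel t + z' *\<^sub>R F t)
    = x * x' + a * (x * y' + y * x') + b t * (y * z' + z * y') + a\<^sup>2 * z * z'"
  using basis_tangent
  by (simp add: g_add_left g_add_right g_scaleR_left g_scaleR_right tangent_add tangent_scaleR basis_gram
      algebra_simps)

lemma phi_comb: "\<phi> (C t) (x *\<^sub>R \<xi> (C t) + y *\<^sub>R vel t + z *\<^sub>R F t)
    = (a * z) *\<^sub>R \<xi> (C t) + (- z) *\<^sub>R vel t + y *\<^sub>R F t"
proof -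
  have "\<phi> (C t) (F t) = (-1) *\<^sub>R vel t + a *\<^sub>R \<xi> (C t)"
    unfolding F_def phi_phi[OF basis_tangent(2)] eta_vel by simp
  then have "\<phi> (C t) (x *\<^sub>R \<xi> (C t) + y *\<^sub>R vel t + z *\<^sub>R F t)
      = x *\<^sub>R 0 + y *\<^sub>R F t + z *\<^sub>R ((-1) *\<^sub>R vel t + a *\<^sub>R \<xi> (C t))"
    using basis_tangent by (simp only: phi_add phi_scaleR tangent_add tangent_scaleR phi_xi F_def)
  then show ?thesis by (simp add: algebra_simps)
qed

lemma cov_deriv_F: "D F t = \<phi> (C t) (D vel t) + (- a) *\<^sub>R vel t + (2 * a\<^sup>2) *\<^sub>R \<xi> (C t)"
  unfolding F_def cov_deriv_phi[OF velocity_smooth t] basis_gram(1) eta_vel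
  by (simp add: power2_eq_square mult.assoc)

text \<open>Differentiate \<open>g(C', C') = 0\<close>, \<open>g(C', \<xi>) = a\<close> and \<open>b = g(C', \<phi> C')\<close>. In the last case both factors
contribute \<open>g(D C', F)\<close>, because \<open>\<phi>\<close> is symmetric for \<open>g\<close>; this explains the half, and \<open>2 a^3\<close> is the
product of the velocity with the Sasaki-like correction in \<open>D F\<close>.\<close>

lemma g_acceleration: "g (C t) (D vel t) (vel t) = 0" "g (C t) (D vel t) (\<xi> (C t)) = b t"
  "g (C t) (D vel t) (F t) = (b1 t - 2 * a^3) / 2"
proof -
  note T = basis_tangent
  show 1: "g (C t) (D vel t) (vel t) = 0" by (rule cov_deriv_vel_orth[OF t])
  have "g (C s) (vel s) (\<xi> (C s)) = a" if "s \<in> I" for s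
    using g_xi[OF velocity_tangent[OF that]] slant that unfolding slant_def by simp
  from metric_along_const[OF velocity_smooth xi_along t this]
  have "g (C t) (D vel t) (\<xi> (C t)) = - g (C t) (vel t) ((-1) *\<^sub>R F t)"
    unfolding cov_deriv_xi[OF t] F_def by simp
  then show "g (C t) (D vel t) (\<xi> (C t)) = b t" using T by (simp only: g_scaleR_right basis_gram)
  have "b1 t = g (C t) (D vel t) (F t) + g (C t) (vel t) (D F t)"
    unfolding b1_def
    by (rule param_deriv_eqI[OF t])
      (use metric_along_derivative[OF velocity_smooth F_smooth t] in \<open>simp add: b_def[abs_def]\<close>)
  also have "g (C t) (vel t) (D F t) = g (C t) (vel t) (\<phi> (C t) (D vel t)) + 2 * a^3"
    unfolding cov_deriv_F
    using T phi_tangent[OF T(4)]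
    by (simp only: g_add_right g_scaleR_right tangent_add tangent_scaleR basis_gram)
      (simp add: power2_eq_square power3_eq_cube)
  also have "g (C t) (vel t) (\<phi> (C t) (D vel t)) = g (C t) (D vel t) (F t)"
    using g_phi[OF T(2,4)] g_sym[OF T(3,4)] by (simp add: F_def)
  finally show "g (C t) (D vel t) (F t) = (b1 t - 2 * a^3) / 2" by simp
qed

lemma g_cov_deriv_comb:
  assumes "smooth_on I x" "smooth_on I y" "smooth_on I z" and u: "u \<in> tangent_space A (C t)"
    and x': "(x has_real_derivative x') (at t within I)" and y': "(y has_real_derivative y') (at t within I)"
    and z': "(z has_real_derivative z') (at t within I)"
  shows "g (C t) (D (\<lambda>t. x t *\<^sub>R \<xi> (C t) + y t *\<^sub>R vel t + z t *\<^sub>R F t) t) u =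
      (x' + 2 * a\<^sup>2 * z t) * g (C t) (\<xi> (C t)) u + (y' - a * z t) * g (C t) (vel t) u
    + (z' - x t) * g (C t) (F t) u + y t * g (C t) (D vel t) u + z t * g (C t) (D vel t) (\<phi> (C t) u)"
proof -
  note T = basis_tangent phi_tangent[OF basis_tangent(4)] u
  note X = field_along_scaleR[OF assms(1) xi_along]
  note Y = field_along_scaleR[OF assms(2) velocity_smooth]
  note Z = field_along_scaleR[OF assms(3) F_smooth]
  note d = x'[unfolded has_real_derivative_iff_has_vector_derivative]
    y'[unfolded has_real_derivative_iff_has_vector_derivative]
    z'[unfolded has_real_derivative_iff_has_vector_derivative]
  have "D (\<lambda>t. x t *\<^sub>R \<xi> (C t) + y t *\<^sub>R vel t + z t *\<^sub>R F t) t =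
      (x' *\<^sub>R \<xi> (C t) + x t *\<^sub>R (- 1) *\<^sub>R F t) + (y' *\<^sub>R vel t + y t *\<^sub>R D vel t) + (z' *\<^sub>R F t + z t *\<^sub>R D F t)"
    unfolding cov_deriv_add[OF field_along_add[OF X Y] Z t] cov_deriv_add[OF X Y t]
      cov_deriv_scaleR[OF xi_along t d(1)] cov_deriv_scaleR[OF velocity_smooth t d(2)]
      cov_deriv_scaleR[OF F_smooth t d(3)] cov_deriv_xi[OF t] F_def[symmetric] by simp
  then show ?thesis
    unfolding cov_deriv_F using T g_phi[OF T(4) u]
    by (simp only: g_add_left g_scaleR_left tangent_add tangent_scaleR) (simp add: algebra_simps)
qed

text \<open>If \<open>a = b = 0\<close>, then the velocity is orthogonal to \<open>\<xi>\<close>, to \<open>F\<close> and to itself. These vectors span the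
tangent space, so nondegeneracy makes the velocity vanish.\<close>

lemma q_pos: "q t > 0"
proof (rule ccontr)
  assume "\<not> q t > 0"
  then have "a^4 + (b t)\<^sup>2 \<le> 0" by (simp add: q_def)
  moreover have "a^4 \<ge> 0" "(b t)\<^sup>2 \<ge> 0" by simp_all
  ultimately have "a^4 = 0" "(b t)\<^sup>2 = 0" by linarith+
  then have ab: "a = 0" "b t = 0" by simp_all
  note T = basis_tangent
  have indep: "\<alpha> = 0 \<and> \<beta> = 0 \<and> \<gamma> = 0" if eq: "\<alpha> *\<^sub>R \<xi> (C t) + \<beta> *\<^sub>R vel t + \<gamma> *\<^sub>R F t = 0" for \<alpha> \<beta> \<gamma>
  proof -
    have "g (C t) (\<alpha> *\<^sub>R \<xi> (C t) + \<beta> *\<^sub>R vel t + \<gamma> *\<^sub>R F t) (1 *\<^sub>R \<xi> (C t) + 0 *\<^sub>R vel t + 0 *\<^sub>R F t) = \<alpha>"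
      unfolding g_comb using ab by simp
    then have \<alpha>: "\<alpha> = 0" unfolding eq using T by (simp only: g_zero_left tangent_add tangent_scaleR)
    have e1: "\<beta> *\<^sub>R vel t + \<gamma> *\<^sub>R F t = 0" using eq \<alpha> by (simp only: scaleR_zero_left add_0_left)
    have "\<phi> (C t) (0 *\<^sub>R \<xi> (C t) + \<beta> *\<^sub>R vel t + \<gamma> *\<^sub>R F t) = \<phi> (C t) (0 *\<^sub>R \<xi> (C t))"
      using eq \<alpha> by (simp only: scaleR_zero_left)
    then have e2: "(- \<gamma>) *\<^sub>R vel t + \<beta> *\<^sub>R F t = 0"
      unfolding phi_comb phi_scaleR[OF T(1)] ab by (simp only: mult_zero_left scaleR_zero_left add_0_left)
    \<comment> \<open>on the plane spanned by the velocity and \<open>F\<close>, the map \<open>\<phi>\<close> is a complex structure, so a real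
      relation between them can be multiplied by the conjugate coefficient\<close>
    have "(\<beta> * \<beta> + \<gamma> * \<gamma>) *\<^sub>R vel t = \<beta> *\<^sub>R (\<beta> *\<^sub>R vel t + \<gamma> *\<^sub>R F t) - \<gamma> *\<^sub>R ((- \<gamma>) *\<^sub>R vel t + \<beta> *\<^sub>R F t)"
      by (simp add: algebra_simps)
    also have "\<dots> = 0" by (simp only: e1 e2 scaleR_zero_right diff_zero)
    finally have "\<beta> * \<beta> + \<gamma> * \<gamma> = 0" using vel_nonzero[OF t] by simp
    then show ?thesis using \<alpha> by (simp add: sum_squares_eq_zero_iff)
  qed
  have "g (C t) (vel t) v = 0" if vT: "v \<in> tangent_space A (C t)" for v
  proof -
    obtain \<alpha> \<beta> \<gamma> where v: "v = \<alpha> *\<^sub>R \<xi> (C t) + \<beta> *\<^sub>R vel t + \<gamma> *\<^sub>R F t"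
      using tangent_eq_span3[OF T(1-3) indep vT] by blast
    have "g (C t) (0 *\<^sub>R \<xi> (C t) + 1 *\<^sub>R vel t + 0 *\<^sub>R F t) v = 0"
      unfolding v g_comb using ab by simp
    then show ?thesis by (simp only: scaleR_zero_left scaleR_one add_0_left add_0_right)
  qed
  then show False using g_nondegenerate[OF T(2)] vel_nonzero[OF t] by blast
qed

lemma sqrt_q_deriv: "((\<lambda>s. sqrt (q s)) has_real_derivative b t * b1 t / sqrt (q t)) (at t within I)"
  unfolding q_def using q_pos
  by (auto intro!: derivative_eq_intros b_deriv[OF t] simp: q_def field_simps)

end

lemma const_smooth: "smooth_on I (\<lambda>_. c)"
  by (rule smooth_on_const[OF unique_deriv_I])

lemma q_smooth: "smooth_on I q"
  unfolding q_def[abs_def] power2_eq_square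
  by (intro smooth_on_add smooth_on_mult unique_deriv_I b_smooth const_smooth)

lemma sqrt_q_smooth: "smooth_on I (\<lambda>t. sqrt (q t))"
  by (intro smooth_on_sqrt unique_deriv_I q_smooth q_pos)

lemma K_smooth: "smooth_on I K"
  unfolding K_def[abs_def]
  by (intro smooth_on_add smooth_on_mult unique_deriv_I b1_smooth q_smooth const_smooth)

definition slant_N :: "real \<Rightarrow> 'a tvec" where
  "slant_N t = (a^3 / q t) *\<^sub>R \<xi> (C t) + (- (a\<^sup>2 / (2 * q t))) *\<^sub>R vel t + (b t / q t) *\<^sub>R F t"

text \<open>The summand with coefficient \<open>0\<close> keeps all frame vectors in the common form to which \<open>g_comb\<close> and
\<open>g_cov_deriv_comb\<close> apply.\<close>

definition slant_W :: "real \<Rightarrow> real \<Rightarrow> 'a tvec" where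
  "slant_W \<epsilon> t = (- \<epsilon> * b t / sqrt (q t)) *\<^sub>R \<xi> (C t) + 0 *\<^sub>R vel t + (\<epsilon> * a / sqrt (q t)) *\<^sub>R F t"

lemma slant_W_coeff_smooth:
  "smooth_on I (\<lambda>t. - \<epsilon> * b t / sqrt (q t))" "smooth_on I (\<lambda>t. \<epsilon> * a / sqrt (q t))"
  by (intro smooth_on_divide smooth_on_mult unique_deriv_I b_smooth sqrt_q_smooth const_smooth,
      use q_pos in force)+

lemma slant_N_smooth: "smooth_field_along A I C slant_N"
proof -
  have "smooth_on I (\<lambda>t. a^3 / q t)" "smooth_on I (\<lambda>t. b t / q t)" "smooth_on I (\<lambda>t. (- a\<^sup>2 / 2) / q t)"
    by (intro smooth_on_divide unique_deriv_I b_smooth q_smooth const_smooth, use q_pos in force)+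
  then show ?thesis unfolding slant_N_def[abs_def]
    by (intro field_along_add field_along_scaleR xi_along velocity_smooth F_smooth) simp_all
qed

lemma slant_W_smooth: "smooth_field_along A I C (slant_W \<epsilon>)"
  unfolding slant_W_def[abs_def]
  by (intro field_along_add field_along_scaleR xi_along velocity_smooth F_smooth slant_W_coeff_smooth const_smooth)

lemma frenet_frame_slant_W:
  assumes \<epsilon>: "\<epsilon> * \<epsilon> = 1"
  shows "frenet_frame A g I C slant_N (slant_W \<epsilon>)"
  unfolding frenet_frame_def
proof (intro conjI ballI slant_N_smooth slant_W_smooth)
  fix t assume t: "t \<in> I"
  have vel: "vel t = 0 *\<^sub>R \<xi> (C t) + 1 *\<^sub>R vel t + 0 *\<^sub>R F t"
    by (simp only: scaleR_zero_left scaleR_one add_0_left add_0_right)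
  define Q r where "Q = q t" and "r = sqrt (q t)"
  have r: "r > 0" "r * r = Q" "Q > 0" "Q = a^4 + b t * b t"
    using q_pos[OF t] by (simp_all add: r_def Q_def q_def power2_eq_square)
  show "g (C t) (vel t) (slant_N t) = 1"
    unfolding slant_N_def Q_def[symmetric] vel[THEN arg_cong[where f="\<lambda>x. g _ x _"]] g_comb[OF t]
    using r(3) by (simp add: divide_simps) (use r(4) in algebra)
  show "g (C t) (slant_W \<epsilon> t) (slant_W \<epsilon> t) = 1"
    unfolding slant_W_def r_def[symmetric] g_comb[OF t]
    using r(1) by (simp add: divide_simps) (use r(2,4) \<epsilon> in algebra)
  show "g (C t) (slant_N t) (slant_N t) = 0"
    unfolding slant_N_def Q_def[symmetric] g_comb[OF t]
    using r(3) by (simp add: divide_simps, simp add: eval_nat_numeral)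
  show "g (C t) (slant_N t) (slant_W \<epsilon> t) = 0"
    unfolding slant_N_def slant_W_def Q_def[symmetric] r_def[symmetric] g_comb[OF t]
    using r(1,3) by (simp add: divide_simps, simp add: eval_nat_numeral)
  show "g (C t) (vel t) (slant_W \<epsilon> t) = 0"
    unfolding slant_W_def r_def[symmetric] vel[THEN arg_cong[where f="\<lambda>x. g _ x _"]] g_comb[OF t]
    using r(1) by (simp add: divide_simps)
qed

lemma h_slant_W:
  assumes t: "t \<in> I"
  shows "g (C t) (D vel t) (slant_N t) = b t * b1 t / (2 * q t)"
  unfolding slant_N_def using q_pos[OF t] basis_tangent[OF t]
  by (simp only: g_add_right g_scaleR_right tangent_add tangent_scaleR g_acceleration[OF t])
    (simp add: field_simps)

lemma k1_slant_W:
  assumes t: "t \<in> I"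
  shows "g (C t) (D vel t) (slant_W \<epsilon> t) = \<epsilon> * K t / (2 * sqrt (q t))"
  unfolding slant_W_def K_def using q_pos[OF t] basis_tangent[OF t]
  by (simp only: g_add_right g_scaleR_right tangent_add tangent_scaleR g_acceleration[OF t])
    (simp add: divide_simps, simp add: q_def algebra_simps power2_eq_square power3_eq_cube power4_eq_xxxx)

text \<open>Since \<open>g(N, W) = 0\<close>, one may differentiate \<open>W\<close> instead of \<open>N\<close>; \<open>W\<close> has the simpler coefficients.\<close>

lemma k2_slant_W:
  assumes t: "t \<in> I" and \<epsilon>: "\<epsilon> * \<epsilon> = 1"
  shows "g (C t) (D slant_N t) (slant_W \<epsilon> t) = \<epsilon> / sqrt (q t) * ((- 2 * a\<^sup>2 * q t + 3 * a^3 * b1 t) / (4 * q t))"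
proof -
  define r where "r = sqrt (q t)"
  have r: "r > 0" "r * r = q t" "q t > 0" "q t = a^4 + (b t)\<^sup>2"
    using q_pos[OF t] by (simp_all add: r_def q_def)
  note T = basis_tangent[OF t]
  have N: "slant_N t \<in> tangent_space A (C t)" using field_tangent[OF slant_N_smooth t] .
  have d1: "((\<lambda>s. - \<epsilon> * b s / sqrt (q s)) has_real_derivative - (\<epsilon> / r) * (b1 t * a^4 / q t)) (at t within I)"
  proof (rule DERIV_cong[OF DERIV_divide[OF DERIV_cmult[OF b_deriv[OF t]] sqrt_q_deriv[OF t]]])
    show "sqrt (q t) \<noteq> 0" using r by simp
    show "(- \<epsilon> * b1 t * sqrt (q t) - - \<epsilon> * b t * (b t * b1 t / sqrt (q t))) / (sqrt (q t) * sqrt (q t))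
        = - (\<epsilon> / r) * (b1 t * a^4 / q t)"
      unfolding r_def[symmetric] using r(1,3) by (simp add: divide_simps) (use r(2,4) in algebra)
  qed
  have d2: "((\<lambda>s. \<epsilon> * a / sqrt (q s)) has_real_derivative - (\<epsilon> / r) * (a * b t * b1 t / q t)) (at t within I)"
  proof (rule DERIV_cong[OF DERIV_divide[OF DERIV_const sqrt_q_deriv[OF t]]])
    show "sqrt (q t) \<noteq> 0" using r by simp
    show "(0 * sqrt (q t) - \<epsilon> * a * (b t * b1 t / sqrt (q t))) / (sqrt (q t) * sqrt (q t))
        = - (\<epsilon> / r) * (a * b t * b1 t / q t)"
      unfolding r_def[symmetric] r(2) using r(1,3) by (simp add: divide_simps)
  qed
  have comb: "g (C t) (x *\<^sub>R \<xi> (C t) + y *\<^sub>R vel t + z *\<^sub>R F t) (slant_N t) = x * (a^3 / (2 * q t)) + y + z * (a\<^sup>2 * b t / (2 * q t))"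
    for x y z
    unfolding slant_N_def g_comb[OF t] using r(3) by (simp add: divide_simps) (use r(4) in algebra)
  have basis: "g (C t) (\<xi> (C t)) (slant_N t) = a^3 / (2 * q t)" "g (C t) (vel t) (slant_N t) = 1"
    "g (C t) (F t) (slant_N t) = a\<^sup>2 * b t / (2 * q t)"
    using comb[of 1 0 0] comb[of 0 1 0] comb[of 0 0 1]
    by (simp_all only: scaleR_zero_left scaleR_one add_0_left add_0_right)
  have phiN: "g (C t) (D vel t) (\<phi> (C t) (slant_N t)) =
      - (a\<^sup>2 / (2 * q t)) * ((b1 t - 2 * a^3) / 2) + b t / q t * (a * b t)"
    unfolding slant_N_def phi_comb[OF t]
    using T by (simp only: g_add_right g_scaleR_right tangent_add tangent_scaleR g_acceleration[OF t]) simp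
  have "g (C t) (D slant_N t) (slant_W \<epsilon> t) = - g (C t) (D (slant_W \<epsilon>) t) (slant_N t)"
    using metric_along_const[OF slant_N_smooth slant_W_smooth t frame_gram(4)[OF frenet_frame_slant_W[OF \<epsilon>]]]
      g_sym[OF N cov_deriv_tangent[OF slant_W_smooth t]] by simp
  also have "g (C t) (D (slant_W \<epsilon>) t) (slant_N t) = \<epsilon> / r * ((- b1 t * a^4 / q t + 2 * a^3) * (a^3 / (2 * q t)) - a\<^sup>2
      + (b t - a * b t * b1 t / q t) * (a\<^sup>2 * b t / (2 * q t))
      + a * (- (a\<^sup>2 / (2 * q t)) * ((b1 t - 2 * a^3) / 2) + b t / q t * (a * b t)))"
    unfolding slant_W_def[abs_def]
      g_cov_deriv_comb[OF t slant_W_coeff_smooth(1) const_smooth slant_W_coeff_smooth(2) N d1 DERIV_const d2]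
      basis phiN r_def[symmetric]
    using r(1,3) by (simp add: field_simps power2_eq_square power3_eq_cube power4_eq_xxxx)
  finally show ?thesis
    unfolding slant_k2_identity[OF r(4) less_imp_neq[OF r(3), symmetric]] r_def
    by (simp only: mult_minus_right minus_minus minus_divide_left[symmetric])
qed

text \<open>If \<open>K\<close> vanishes at \<open>t\<close>, then the first frame shows that the acceleration is there a multiple of the
velocity, and so every frame has \<open>k1 = 0\<close> at \<open>t\<close>.\<close>

lemma K_nonzero:
  assumes ng: "non_geodesic A g nabla I C" and t: "t \<in> I"
  shows "K t \<noteq> 0"
proof
  assume K: "K t = 0"
  obtain N W h k1 k2 where fr: "frenet_frame A g I C N W"
    and eq: "frenet_equations A nabla I C N W h k1 k2" and k1: "k1 t \<noteq> 0"
    using ng t unfolding non_geodesic_def by blast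
  have W: "W t \<in> tangent_space A (C t)" using frame_tangent(2)[OF fr t] .
  have fr1: "frenet_frame A g I C slant_N (slant_W 1)" by (rule frenet_frame_slant_W) simp
  have "D vel t = g (C t) (D vel t) (slant_N t) *\<^sub>R vel t"
    using frenet_expand[OF fr1 t basis_tangent(4)[OF t]]
    unfolding g_acceleration(1)[OF t] k1_slant_W[OF t] K by simp
  then have "g (C t) (D vel t) (W t) = g (C t) (D vel t) (slant_N t) * g (C t) (vel t) (W t)"
    using g_scaleR_left[OF velocity_tangent[OF t] W] by metis
  then show False using frenet_coefficients(2)[OF fr eq t] k1 frame_gram(5)[OF fr t] by simp
qed

lemma frenet_W:
  assumes \<epsilon>: "\<epsilon> * \<epsilon> = 1" and W: "\<And>t. t \<in> I \<Longrightarrow> W t = slant_W \<epsilon> t"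
  shows "screen_bundle A g I C (\<lambda>t. span {W t})"
    and "\<exists>N h k1 k2. frenet_frame A g I C N W \<and> frenet_equations A nabla I C N W h k1 k2"
    and "frenet_frame A g I C N W \<Longrightarrow> frenet_equations A nabla I C N W h k1 k2 \<Longrightarrow> t \<in> I \<Longrightarrow>
      N t = slant_N t \<and> h t = b t * b1 t / (2 * q t) \<and>
      k2 t = \<epsilon> * ((- 2 * a\<^sup>2 * q t + 3 * a^3 * b1 t) / (4 * q t powr (3/2)))"
proof -
  have frame: "frenet_frame A g I C slant_N W"
    by (rule frenet_frame_cong[OF frenet_frame_slant_W[OF \<epsilon>]]) (simp_all add: W)
  show "screen_bundle A g I C (\<lambda>t. span {W t})" by (rule screen_bundle_span[OF frame])
  show "\<exists>N h k1 k2. frenet_frame A g I C N W \<and> frenet_equations A nabla I C N W h k1 k2"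
    using frame frenet_equations_hold[OF frame] by blast
  assume fr: "frenet_frame A g I C N W" and eq: "frenet_equations A nabla I C N W h k1 k2" and t: "t \<in> I"
  have N: "N s = slant_N s" if "s \<in> I" for s by (rule frenet_frame_unique[OF frame fr that])
  have "q t powr (3/2) = q t powr 1 * q t powr (1/2)" unfolding powr_add[symmetric] by simp
  then have "q t powr (3/2) = q t * sqrt (q t)" using q_pos[OF t] by (simp add: powr_half_sqrt)
  moreover have "k2 t = \<epsilon> / sqrt (q t) * ((- 2 * a\<^sup>2 * q t + 3 * a^3 * b1 t) / (4 * q t))"
    using frenet_coefficients(3)[OF fr eq t] k2_slant_W[OF t \<epsilon>] W[OF t] cov_deriv_cong[OF N t] by simp
  moreover have "h t = b t * b1 t / (2 * q t)"
    using frenet_coefficients(1)[OF fr eq t] h_slant_W[OF t] N[OF t] by simp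
  ultimately show "N t = slant_N t \<and> h t = b t * b1 t / (2 * q t) \<and>
      k2 t = \<epsilon> * ((- 2 * a\<^sup>2 * q t + 3 * a^3 * b1 t) / (4 * q t powr (3/2)))"
    using N[OF t] by simp
qed

text \<open>The quotient \<open>h / k1\<close> of the first frame.\<close>

definition \<mu> :: "real \<Rightarrow> real \<Rightarrow> real" where "\<mu> \<epsilon> t = \<epsilon> * b t * b1 t / (sqrt (q t) * K t)"

definition bar_N :: "real \<Rightarrow> 'a tvec" where
  "bar_N t = ((b1 t - 2 * a^3) / K t) *\<^sub>R \<xi> (C t)
    - ((4 * a\<^sup>2 * (q t - a * b1 t) + (b1 t)\<^sup>2) / (2 * (K t)\<^sup>2)) *\<^sub>R vel t - (2 * b t / K t) *\<^sub>R F t"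

context
  assumes ng: "non_geodesic A g nabla I C"
begin

lemma mu_smooth: "smooth_on I (\<mu> \<epsilon>)"
  unfolding \<mu>_def[abs_def]
  by (intro smooth_on_divide smooth_on_mult unique_deriv_I b_smooth b1_smooth sqrt_q_smooth K_smooth const_smooth)
    (use q_pos K_nonzero[OF ng] in force)

lemma mu_deriv:
  assumes t: "t \<in> I"
  shows "param_deriv I (\<mu> \<epsilon>) t = \<epsilon> / sqrt (q t) * (((b1 t)\<^sup>2 + b t * b2 t) / K t
    - (b t)\<^sup>2 * (b1 t)\<^sup>2 / (q t * K t) - b t * b1 t * (- 4 * b t * b1 t + a * b2 t) / (K t)\<^sup>2)"
proof (rule param_deriv_eqI[OF t])
  define r where "r = sqrt (q t)"
  have r: "r > 0" "r * r = q t" "q t > 0" "K t \<noteq> 0"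
    using q_pos[OF t] K_nonzero[OF ng t] by (simp_all add: r_def)
  have "(q has_real_derivative 2 * b t * b1 t) (at t within I)"
    unfolding q_def[abs_def] by (auto intro!: derivative_eq_intros b_deriv[OF t])
  then have Kd: "(K has_real_derivative - 4 * b t * b1 t + a * b2 t) (at t within I)"
    unfolding K_def[abs_def] by (auto intro!: derivative_eq_intros b1_deriv[OF t])
  have "((\<lambda>s. \<epsilon> * (b s * b1 s) / (sqrt (q s) * K s)) has_real_derivative
      (\<epsilon> * (b1 t * b1 t + b2 t * b t) * (sqrt (q t) * K t) - \<epsilon> * (b t * b1 t) *
        (b t * b1 t / sqrt (q t) * K t + (- 4 * b t * b1 t + a * b2 t) * sqrt (q t)))
      / ((sqrt (q t) * K t) * (sqrt (q t) * K t))) (at t within I)"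
    by (intro DERIV_divide DERIV_cmult DERIV_mult b_deriv[OF t] b1_deriv[OF t] sqrt_q_deriv[OF t] Kd)
      (use r in simp)
  also have "(\<epsilon> * (b1 t * b1 t + b2 t * b t) * (sqrt (q t) * K t) - \<epsilon> * (b t * b1 t) *
        (b t * b1 t / sqrt (q t) * K t + (- 4 * b t * b1 t + a * b2 t) * sqrt (q t)))
      / ((sqrt (q t) * K t) * (sqrt (q t) * K t))
    = \<epsilon> / sqrt (q t) * (((b1 t)\<^sup>2 + b t * b2 t) / K t
    - (b t)\<^sup>2 * (b1 t)\<^sup>2 / (q t * K t) - b t * b1 t * (- 4 * b t * b1 t + a * b2 t) / (K t)\<^sup>2)"
    unfolding r_def[symmetric] r(2)[symmetric]
    using r(1,4) by (simp add: field_simps power2_eq_square)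
  finally show "(\<mu> \<epsilon> has_vector_derivative \<epsilon> / sqrt (q t) * (((b1 t)\<^sup>2 + b t * b2 t) / K t
    - (b t)\<^sup>2 * (b1 t)\<^sup>2 / (q t * K t) - b t * b1 t * (- 4 * b t * b1 t + a * b2 t) / (K t)\<^sup>2)) (at t within I)"
    unfolding has_real_derivative_iff_has_vector_derivative \<mu>_def[abs_def] by (simp only: mult.assoc)
qed

lemma bar_N_eq:
  assumes t: "t \<in> I" and \<epsilon>: "\<epsilon> * \<epsilon> = 1"
  shows "slant_N t + (- \<mu> \<epsilon> t) *\<^sub>R slant_W \<epsilon> t + (- (\<mu> \<epsilon> t)\<^sup>2 / 2) *\<^sub>R vel t = bar_N t"
proof -
  define r where "r = sqrt (q t)"
  have r: "r > 0" "r * r = q t" "q t > 0" "K t \<noteq> 0" "q t = a^4 + (b t)\<^sup>2" "K t = - 2 * q t + a * b1 t"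
    using q_pos[OF t] K_nonzero[OF ng t] by (simp_all add: r_def q_def K_def)
  have \<mu>: "\<mu> \<epsilon> t * \<epsilon> / r = b t * b1 t / (q t * K t)"
    unfolding \<mu>_def r_def[symmetric] using r(1-4) \<epsilon> by (simp add: divide_simps)
  have \<mu>2: "(\<mu> \<epsilon> t)\<^sup>2 = (b t * b1 t)\<^sup>2 / (q t * (K t)\<^sup>2)"
    unfolding \<mu>_def r_def[symmetric] using r(1-4) \<epsilon> by (simp add: divide_simps) (use r(2) \<epsilon> in \<open>simp add: power2_eq_square\<close>)
  have "slant_N t + (- \<mu> \<epsilon> t) *\<^sub>R slant_W \<epsilon> t + (- (\<mu> \<epsilon> t)\<^sup>2 / 2) *\<^sub>R vel t =
      (a^3 / q t + b t * (\<mu> \<epsilon> t * \<epsilon> / r)) *\<^sub>R \<xi> (C t) - (a\<^sup>2 / (2 * q t) + (\<mu> \<epsilon> t)\<^sup>2 / 2) *\<^sub>R vel t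
      - (a * (\<mu> \<epsilon> t * \<epsilon> / r) - b t / q t) *\<^sub>R F t"
    unfolding slant_N_def slant_W_def r_def[symmetric] by (simp add: algebra_simps)
  also have "a^3 / q t + b t * (\<mu> \<epsilon> t * \<epsilon> / r) = (b1 t - 2 * a^3) / K t"
    unfolding \<mu> using r(3,4) by (simp add: divide_simps) (use r(5,6) in algebra)
  also have "a\<^sup>2 / (2 * q t) + (\<mu> \<epsilon> t)\<^sup>2 / 2 = (4 * a\<^sup>2 * (q t - a * b1 t) + (b1 t)\<^sup>2) / (2 * (K t)\<^sup>2)"
    unfolding \<mu>2 using r(3,4) by (simp add: divide_simps) (use r(5,6) in algebra)
  also have "a * (\<mu> \<epsilon> t * \<epsilon> / r) - b t / q t = 2 * b t / K t"
    unfolding \<mu> using r(3,4) by (simp add: divide_simps) (use r(6) in algebra)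
  finally show ?thesis unfolding bar_N_def .
qed

lemma frenet_Wb:
  assumes \<epsilon>: "\<epsilon> * \<epsilon> = 1" and \<epsilon>1: "\<epsilon>1 * \<epsilon>1 = 1"
    and Z: "\<And>t. t \<in> I \<Longrightarrow> Z t = \<epsilon>1 *\<^sub>R (slant_W \<epsilon> t + \<mu> \<epsilon> t *\<^sub>R vel t)"
  shows "screen_bundle A g I C (\<lambda>t. span {Z t})"
    and "\<exists>N h k1 k2. frenet_frame A g I C N Z \<and> frenet_equations A nabla I C N Z h k1 k2"
    and "frenet_frame A g I C N Z \<Longrightarrow> frenet_equations A nabla I C N Z h k1 k2 \<Longrightarrow> t \<in> I \<Longrightarrow>
      h t = 0 \<and> N t = bar_N t \<and> k2 t = \<epsilon>1 * \<epsilon> *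
        ((q t * (8 * b t * b2 t + 20 * a^3 * b1 t - 8 * a^6 - 8 * a\<^sup>2 * (b t)\<^sup>2) - a * (b1 t)^3
        - 2 * (3 * a^4 + 7 * (b t)\<^sup>2) * (b1 t)\<^sup>2) / (4 * sqrt (q t) * (K t)\<^sup>2))"
proof -
  note fr0 = frenet_frame_slant_W[OF \<epsilon>]
  have frame: "frenet_frame A g I C bar_N Z"
    by (rule frenet_frame_cong[OF change_of_screen_frame[OF fr0 mu_smooth \<epsilon>1]])
      (simp_all only: bar_N_eq[OF _ \<epsilon>] Z)
  show "screen_bundle A g I C (\<lambda>t. span {Z t})" by (rule screen_bundle_span[OF frame])
  show "\<exists>N h k1 k2. frenet_frame A g I C N Z \<and> frenet_equations A nabla I C N Z h k1 k2"
    using frame frenet_equations_hold[OF frame] by blast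
  assume fr: "frenet_frame A g I C N Z" and eq: "frenet_equations A nabla I C N Z h k1 k2" and t: "t \<in> I"
  have N: "N s = bar_N s" if "s \<in> I" for s by (rule frenet_frame_unique[OF frame fr that])
  define r where "r = sqrt (q t)"
  have r: "r > 0" "r * r = q t" "q t > 0" "K t \<noteq> 0" "q t = a^4 + (b t)\<^sup>2" "K t = - 2 * q t + a * b1 t"
    using q_pos[OF t] K_nonzero[OF ng t] by (simp_all add: r_def q_def K_def)
  let ?h = "b t * b1 t / (2 * q t)" and ?k1 = "\<epsilon> * K t / (2 * r)"
  \<comment> \<open>the choice of \<open>\<mu>\<close>: this cancels \<open>h\<close>\<close>
  have \<mu>k1: "\<mu> \<epsilon> t * ?k1 = ?h"
    unfolding \<mu>_def r_def[symmetric] using r(1-4) by (simp add: divide_simps) (use \<epsilon> in simp)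
  have h: "h t = 0"
    using frenet_coefficients(1)[OF fr eq t] change_of_screen_h[OF fr0 mu_smooth \<epsilon>1 t, of \<epsilon>]
      N[OF t] bar_N_eq[OF t \<epsilon>] h_slant_W[OF t] k1_slant_W[OF t] \<mu>k1 by (simp add: r_def)
  have N': "N s = slant_N s + (- \<mu> \<epsilon> s) *\<^sub>R slant_W \<epsilon> s + (- (\<mu> \<epsilon> s)\<^sup>2 / 2) *\<^sub>R vel s" if "s \<in> I" for s
    using N[OF that] bar_N_eq[OF that \<epsilon>] by simp
  have DN: "D N t = D (\<lambda>s. slant_N s + (- \<mu> \<epsilon> s) *\<^sub>R slant_W \<epsilon> s + (- (\<mu> \<epsilon> s)\<^sup>2 / 2) *\<^sub>R vel s) t"
    by (rule cov_deriv_cong[OF N' t])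
  have "k2 t = g (C t) (D N t) (Z t)" by (rule frenet_coefficients(3)[OF fr eq t])
  also have "\<dots> = \<epsilon>1 * (\<epsilon> / r * ((- 2 * a\<^sup>2 * q t + 3 * a^3 * b1 t) / (4 * q t))
      + (\<mu> \<epsilon> t)\<^sup>2 / 2 * ?k1 - param_deriv I (\<mu> \<epsilon>) t - \<mu> \<epsilon> t * ?h)"
    unfolding DN Z[OF t] change_of_screen_k2[OF fr0 mu_smooth \<epsilon>1 t]
      k2_slant_W[OF t \<epsilon>] k1_slant_W[OF t] h_slant_W[OF t] r_def ..
  also have "(\<mu> \<epsilon> t)\<^sup>2 / 2 * ?k1 = \<mu> \<epsilon> t * ?h / 2"
    unfolding \<mu>k1[symmetric] by (simp add: power2_eq_square)
  also have "\<epsilon> / r * ((- 2 * a\<^sup>2 * q t + 3 * a^3 * b1 t) / (4 * q t)) + \<mu> \<epsilon> t * ?h / 2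
      - param_deriv I (\<mu> \<epsilon>) t - \<mu> \<epsilon> t * ?h
    = \<epsilon> / r * ((- 2 * a\<^sup>2 * q t + 3 * a^3 * b1 t) / (4 * q t) - (b t)\<^sup>2 * (b1 t)\<^sup>2 / (4 * q t * K t)
      - (((b1 t)\<^sup>2 + b t * b2 t) / K t - (b t)\<^sup>2 * (b1 t)\<^sup>2 / (q t * K t)
        - b t * b1 t * (- 4 * b t * b1 t + a * b2 t) / (K t)\<^sup>2))"
  proof -
    have "\<mu> \<epsilon> t * ?h / 2 = \<epsilon> / r * ((b t)\<^sup>2 * (b1 t)\<^sup>2 / (4 * q t * K t))"
      unfolding \<mu>_def r_def[symmetric] by (simp add: power2_eq_square mult_ac)
    moreover have "m / 2 = y \<Longrightarrow> u + m / 2 - p - m = u - y - p" for m y u p :: real by simp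
    ultimately show ?thesis unfolding mu_deriv[OF t] r_def[symmetric] right_diff_distrib by blast
  qed
  also note slant_bar_k2_identity[OF r(5,6) less_imp_neq[OF r(3), symmetric] r(4)]
  finally have "k2 t = \<epsilon>1 * \<epsilon> *
        ((q t * (8 * b t * b2 t + 20 * a^3 * b1 t - 8 * a^6 - 8 * a\<^sup>2 * (b t)\<^sup>2) - a * (b1 t)^3
        - 2 * (3 * a^4 + 7 * (b t)\<^sup>2) * (b1 t)\<^sup>2) / (4 * sqrt (q t) * (K t)\<^sup>2))"
    unfolding r_def by (simp add: divide_divide_eq_left mult_ac)
  then show "h t = 0 \<and> N t = bar_N t \<and> k2 t = \<epsilon>1 * \<epsilon> *
        ((q t * (8 * b t * b2 t + 20 * a^3 * b1 t - 8 * a^6 - 8 * a\<^sup>2 * (b t)\<^sup>2) - a * (b1 t)^3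
        - 2 * (3 * a^4 + 7 * (b t)\<^sup>2) * (b1 t)\<^sup>2) / (4 * sqrt (q t) * (K t)\<^sup>2))"
    using h N[OF t] by simp
qed

end

end

section \<open>The Frenet frames of the two screen bundles\<close>

theorem proposition3p7:
  fixes A :: "'a::{t2_space,second_countable_topology} chart set"
    and \<phi> :: "'a \<Rightarrow> 'a tvec \<Rightarrow> 'a tvec"
    and \<xi> :: "'a \<Rightarrow> 'a tvec"
    and \<eta> :: "'a \<Rightarrow> 'a tvec \<Rightarrow> real"
    and g :: "'a \<Rightarrow> 'a tvec \<Rightarrow> 'a tvec \<Rightarrow> real"
    and nabla :: "'a connection"
    and I :: "real set" and C :: "real \<Rightarrow> 'a"
    and C' F W Wb :: "real \<Rightarrow> 'a tvec"
    and a \<epsilon> \<epsilon>1 :: real and b b1 b2 :: "real \<Rightarrow> real"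
  assumes manifold: "almost_contact_B_metric_manifold A \<phi> \<xi> \<eta> g"
    and connection: "levi_civita A g nabla"
    and sasaki: "sasaki_like A \<phi> \<xi> \<eta> g nabla"
    and null: "null_curve A g I C"
    and slant: "slant A \<eta> I C a"
    and nongeodesic: "non_geodesic A g nabla I C"
    and C'_def: "C' = velocity A I C"
    and F_def: "F = (\<lambda>t. \<phi> (C t) (C' t))"
    and b_def: "b = (\<lambda>t. g (C t) (C' t) (F t))"
    and b1_def: "b1 = param_deriv I b"
    and b2_def: "b2 = param_deriv I b1"
    and eps: "\<epsilon> \<in> {1, -1}" "\<epsilon>1 \<in> {1, -1}"
    and W_def: "\<And>t. t \<in> I \<Longrightarrow> W t =
       (- \<epsilon> * b t / sqrt (a^4 + (b t)^2)) *\<^sub>R \<xi> (C t)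
       + (\<epsilon> * a / sqrt (a^4 + (b t)^2)) *\<^sub>R F t"
    and Wb_def: "\<And>t. t \<in> I \<Longrightarrow> Wb t = \<epsilon>1 *\<^sub>R (
       (- \<epsilon> * b t / sqrt (a^4 + (b t)^2)) *\<^sub>R \<xi> (C t)
       + (\<epsilon> * b t * b1 t /
            (sqrt (a^4 + (b t)^2) * (- 2 * (a^4 + (b t)^2) + a * b1 t))) *\<^sub>R C' t
       + (\<epsilon> * a / sqrt (a^4 + (b t)^2)) *\<^sub>R F t)"
  shows
    "(screen_bundle A g I C (\<lambda>t. span {W t}) \<and>
     (\<exists>N h k1 k2. frenet_frame A g I C N W \<and> frenet_equations A nabla I C N W h k1 k2) \<and>
     (\<forall>N h k1 k2. frenet_frame A g I C N W \<and> frenet_equations A nabla I C N W h k1 k2 \<longrightarrow>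
        (\<forall>t\<in>I.
           N t = (a^3 / (a^4 + (b t)^2)) *\<^sub>R \<xi> (C t)
                 - (a^2 / (2 * (a^4 + (b t)^2))) *\<^sub>R C' t
                 + (b t / (a^4 + (b t)^2)) *\<^sub>R F t \<and>
           h t = b t * b1 t / (2 * (a^4 + (b t)^2)) \<and>
           k2 t = \<epsilon> * ((- 2 * a^2 * (a^4 + (b t)^2) + 3 * a^3 * b1 t)
                        / (4 * (a^4 + (b t)^2) powr (3/2))))))
     \<and>
     (screen_bundle A g I C (\<lambda>t. span {Wb t}) \<and>
     (\<exists>Nb hb kb1 kb2. frenet_frame A g I C Nb Wb \<and>
        frenet_equations A nabla I C Nb Wb hb kb1 kb2) \<and>
     (\<forall>Nb hb kb1 kb2. frenet_frame A g I C Nb Wb \<and>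
        frenet_equations A nabla I C Nb Wb hb kb1 kb2 \<longrightarrow>
        distinguished_parameter I hb \<and>
        (\<forall>t\<in>I.
           Nb t = ((b1 t - 2 * a^3) / (- 2 * (a^4 + (b t)^2) + a * b1 t)) *\<^sub>R \<xi> (C t)
                  - ((4 * a^2 * (a^4 + (b t)^2 - a * b1 t) + (b1 t)^2)
                      / (2 * (- 2 * (a^4 + (b t)^2) + a * b1 t)^2)) *\<^sub>R C' t
                  - (2 * b t / (- 2 * (a^4 + (b t)^2) + a * b1 t)) *\<^sub>R F t \<and>
           kb2 t = \<epsilon>1 * \<epsilon> *
             (((a^4 + (b t)^2) * (8 * b t * b2 t + 20 * a^3 * b1 t - 8 * a^6 - 8 * a^2 * (b t)^2)
               - a * (b1 t)^3 - 2 * (3 * a^4 + 7 * (b t)^2) * (b1 t)^2)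
              / (4 * sqrt (a^4 + (b t)^2) * (- 2 * (a^4 + (b t)^2) + a * b1 t)^2)))))"
proof -
  interpret S: slant_null_curve A I C nabla g \<phi> \<xi> \<eta> a
  proof
    show "smooth_atlas A" "pseudo_riemannian_metric A g"
      using manifold unfolding almost_contact_B_metric_manifold_def by blast+
    show "smooth_curve A I C" using null unfolding null_curve_def by blast
    show "affine_connection A nabla" using connection unfolding levi_civita_def by blast
  qed (fact connection null manifold sasaki slant)+
  have F: "F = S.F" by (rule ext) (simp only: F_def C'_def S.F_def)
  have b: "b = S.b" by (rule ext) (simp only: b_def F C'_def S.b_def)
  have b1: "b1 = S.b1" unfolding b1_def S.b1_def b ..
  have b2: "b2 = S.b2" unfolding b2_def S.b2_def b1 ..
  have sq: "\<epsilon> * \<epsilon> = 1" "\<epsilon>1 * \<epsilon>1 = 1" using eps by auto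
  have W: "W t = S.slant_W \<epsilon> t" if "t \<in> I" for t
    unfolding W_def[OF that] S.slant_W_def F b S.q_def by simp
  have Wb: "Wb t = \<epsilon>1 *\<^sub>R (S.slant_W \<epsilon> t + S.\<mu> \<epsilon> t *\<^sub>R velocity A I C t)" if "t \<in> I" for t
    unfolding Wb_def[OF that] S.slant_W_def S.\<mu>_def F b b1 C'_def S.q_def S.K_def
    by (simp only: scaleR_zero_left add_0_left add_0_right add.assoc add.commute add.left_commute)
  note q = S.q_def[symmetric] and K = S.K_def[symmetric]
  have slant_N: "S.slant_N t = (a^3 / S.q t) *\<^sub>R \<xi> (C t) - (a^2 / (2 * S.q t)) *\<^sub>R C' t
      + (S.b t / S.q t) *\<^sub>R F t" for t
    unfolding S.slant_N_def F C'_def by simp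
  show ?thesis
  proof (intro conjI allI impI)
    show "screen_bundle A g I C (\<lambda>t. span {W t})"
      and "\<exists>N h k1 k2. frenet_frame A g I C N W \<and> frenet_equations A nabla I C N W h k1 k2"
      and "screen_bundle A g I C (\<lambda>t. span {Wb t})"
      and "\<exists>Nb hb kb1 kb2. frenet_frame A g I C Nb Wb \<and>
        frenet_equations A nabla I C Nb Wb hb kb1 kb2"
      using S.frenet_W(1,2)[OF sq(1) W] S.frenet_Wb(1,2)[OF nongeodesic sq Wb] by blast+
  next
    fix N h k1 k2
    assume "frenet_frame A g I C N W \<and> frenet_equations A nabla I C N W h k1 k2"
    then show "\<forall>t\<in>I.
           N t = (a^3 / (a^4 + (b t)^2)) *\<^sub>R \<xi> (C t)
                 - (a^2 / (2 * (a^4 + (b t)^2))) *\<^sub>R C' t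
                 + (b t / (a^4 + (b t)^2)) *\<^sub>R F t \<and>
           h t = b t * b1 t / (2 * (a^4 + (b t)^2)) \<and>
           k2 t = \<epsilon> * ((- 2 * a^2 * (a^4 + (b t)^2) + 3 * a^3 * b1 t)
                        / (4 * (a^4 + (b t)^2) powr (3/2)))"
      unfolding b b1 q slant_N[symmetric] using S.frenet_W(3)[OF sq(1) W] by blast
  next
    fix Nb hb kb1 kb2
    assume fr: "frenet_frame A g I C Nb Wb \<and> frenet_equations A nabla I C Nb Wb hb kb1 kb2"
    note bar = S.frenet_Wb(3)[OF nongeodesic sq Wb conjunct1[OF fr] conjunct2[OF fr]]
    show "distinguished_parameter I hb"
      unfolding distinguished_parameter_def using bar by blast
    show "\<forall>t\<in>I.
           Nb t = ((b1 t - 2 * a^3) / (- 2 * (a^4 + (b t)^2) + a * b1 t)) *\<^sub>R \<xi> (C t)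
                  - ((4 * a^2 * (a^4 + (b t)^2 - a * b1 t) + (b1 t)^2)
                      / (2 * (- 2 * (a^4 + (b t)^2) + a * b1 t)^2)) *\<^sub>R C' t
                  - (2 * b t / (- 2 * (a^4 + (b t)^2) + a * b1 t)) *\<^sub>R F t \<and>
           kb2 t = \<epsilon>1 * \<epsilon> *
             (((a^4 + (b t)^2) * (8 * b t * b2 t + 20 * a^3 * b1 t - 8 * a^6 - 8 * a^2 * (b t)^2)
               - a * (b1 t)^3 - 2 * (3 * a^4 + 7 * (b t)^2) * (b1 t)^2)
              / (4 * sqrt (a^4 + (b t)^2) * (- 2 * (a^4 + (b t)^2) + a * b1 t)^2))"
      unfolding F C'_def b b1 b2 q K S.bar_N_def[symmetric] using bar by blast
  qed
qed

end
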